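(* Let $(\mathrm{C},\otimes,e)$ be a small strict cocomplete cocontinuous symmetric monoidal category. Then $\mathrm{mor}(\mathrm{C})$, the set of all arrows of $\mathrm{C}$, carries a $(\mathsf{scpx}_{\neq\emptyset},\{\circ_k^c\})$-algebra structure given by the structure maps $$\overrightarrow{\mathcal{Z}}_n^c\colon\mathsf{scpx}_{\neq\emptyset}(n)\times\mathrm{mor}(\mathrm{C})^n\to\mathrm{mor}(\mathrm{C}),\qquad \overrightarrow{\mathcal{Z}}_n^c(K;\underline{f})=\Bigl(\operatorname{colim}_{I\in\mathrm{cat}(K)}z_n(I;\underline{f})\to z_n([n];\underline{f})\Bigr),\quad n\ge1,$$ where the arrow is the canonical morphism from the colimit of $z_n(-;\underline{f})\colon\mathrm{cat}(K)\to\mathrm{C}$ to $z_n([n];\underline{f})=\bigotimes_{j=1}^nX_j$ (for $\underline f=(f_j\colon Y_j\to X_j)_{j\in[n]}$).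
   Context: Simplicial complexes: for $n\ge1$, $[n]=\{1,\dots,n\}$, $\mathsf{scpx}_{\neq\emptyset}(n)$ is the set of non-empty families $K$ of subsets of $[n]$ closed under taking subsets (so $\emptyset\in K$; ghost vertices allowed), with $\mathbb{S}_n$ acting by relabelling. For $I\subseteq[n]$ put $I^{<k}=\{i\in I\mid i<k\}$, $I^{>k}=\{i\in I\mid i>k\}$, $I+\ell=\{i+\ell\mid i\in I\}$. The composition operad $(\mathsf{scpx}_{\neq\emptyset},\{\circ_k^c\})$ has, for $K$ on $[n]$, $L$ on $[m]$, $k\in[n]$, $K\circ_k^cL$ equal to the set of all subsets of the sets $I\circ_k^cJ$, $I\in K$, $J\in L$, where $I\circ_k^cJ=I^{<k}\sqcup([m]+k-1)\sqcup(I^{>k}+m-1)$ if $k\in I$ and $I\circ_k^cJ=I^{<k}\sqcup(J+k-1)\sqcup(I^{>k}+m-1)$ if $k\notin I$. Its unit is $\{\emptyset\}$ on $[1]$. $\mathrm{cat}(K)$ is the poset $K$ ordered by inclusion, regarded as a category. Cubical functor: for $\underline{f}=(f_i\colon Y_i\to X_i)_{i\in[n]}$ arrows of $\mathrm{C}$, $z_n(-;\underline{f})\colon(\wp([n]),\subseteq)\to\mathrm{C}$ (with $\wp([n])$ the power set of $[n]$) is given by $z_n(I;\underline{f})=\bigotimes_{i=1}^nZ_i^I$ with $Z_i^I=X_i$ if $i\in I$ and $Z_i^I=Y_i$ if $i\notin I$; on $I\subseteq J$ it is $\bigotimes_i\phi_i$ with $\phi_i=\mathrm{id}_{X_i}$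 if $i\in I$, $\phi_i=f_i$ if $i\in J\setminus I$, $\phi_i=\mathrm{id}_{Y_i}$ if $i\notin J$. "Cocontinuous" means that $\otimes$ preserves colimits in each variable. An algebra over a set operad $\mathcal{O}$ on a set $X$ is a morphism of operads from $\mathcal{O}$ to the endomorphism operad of $X$ (with $\mathrm{End}_X(n)=\mathrm{Hom}(X^n,X)$), i.e. maps $\mathcal{O}(n)\times X^n\to X$ compatible with units, symmetric group actions and compositions.
   Formalization: Equivariance on mor(C) fails if X⊗Y≠Y⊗X, and arbitrary colimit choices break the unit law; so: for suitable choices mor(C) satisfies unit and composition laws, and equivariance if the symmetry is the identity; for any symmetry and choices, a full algebra on arrows modulo isomorphism. *)

theory Defs
  imports "HOL-Library.FuncSet" "HOL-Library.Infinite_Typeclass" "HOL-Combinatorics.Permutations"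
begin

section \<open>Categories, functors, colimits\<close>

record ('o, 'a) cat_struct =
  Obj :: "'o set"
  Mor :: "'a set"
  Dom :: "'a \<Rightarrow> 'o"
  Cod :: "'a \<Rightarrow> 'o"
  Ide :: "'o \<Rightarrow> 'a"
  Cmp :: "'a \<Rightarrow> 'a \<Rightarrow> 'a"  \<comment> \<open>\<open>Cmp C g f\<close> is \<open>g\<close> after \<open>f\<close>\<close>

definition hom_set :: "('o, 'a, 'z) cat_struct_scheme \<Rightarrow> 'o \<Rightarrow> 'o \<Rightarrow> 'a set" where
  "hom_set C x y = {f \<in> Mor C. Dom C f = x \<and> Cod C f = y}"

locale category =
  fixes C :: "('o, 'a, 'z) cat_struct_scheme" (structure)
  assumes dom_obj: "f \<in> Mor C \<Longrightarrow> Dom C f \<in> Obj C"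
    and cod_obj: "f \<in> Mor C \<Longrightarrow> Cod C f \<in> Obj C"
    and ide_hom: "x \<in> Obj C \<Longrightarrow> Ide C x \<in> hom_set C x x"
    and cmp_hom: "f \<in> hom_set C x y \<Longrightarrow> g \<in> hom_set C y z \<Longrightarrow> Cmp C g f \<in> hom_set C x z"
    and cmp_ide: "f \<in> hom_set C x y \<Longrightarrow> Cmp C f (Ide C x) = f"
    and ide_cmp: "f \<in> hom_set C x y \<Longrightarrow> Cmp C (Ide C y) f = f"
    and cmp_assoc: "f \<in> hom_set C w x \<Longrightarrow> g \<in> hom_set C x y \<Longrightarrow> h \<in> hom_set C y z
      \<Longrightarrow> Cmp C h (Cmp C g f) = Cmp C (Cmp C h g) f"

definition is_functor ::
  "('i, 'j, 'y) cat_struct_scheme \<Rightarrow> ('o, 'a, 'z) cat_struct_scheme \<Rightarrow> ('i \<Rightarrow> 'o) \<Rightarrow> ('j \<Rightarrow> 'a) \<Rightarrow> bool"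
  where
  "is_functor D C Fo Fa \<longleftrightarrow>
     (\<forall>i\<in>Obj D. Fo i \<in> Obj C) \<and>
     (\<forall>i\<in>Obj D. \<forall>j\<in>Obj D. \<forall>u\<in>hom_set D i j. Fa u \<in> hom_set C (Fo i) (Fo j)) \<and>
     (\<forall>i\<in>Obj D. Fa (Ide D i) = Ide C (Fo i)) \<and>
     (\<forall>i\<in>Obj D. \<forall>j\<in>Obj D. \<forall>k\<in>Obj D. \<forall>u\<in>hom_set D i j. \<forall>v\<in>hom_set D j k.
        Fa (Cmp D v u) = Cmp C (Fa v) (Fa u))"

definition is_cocone ::
  "('i, 'j, 'y) cat_struct_scheme \<Rightarrow> ('o, 'a, 'z) cat_struct_scheme \<Rightarrow> ('i \<Rightarrow> 'o) \<Rightarrow> ('j \<Rightarrow> 'a)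
     \<Rightarrow> 'o \<Rightarrow> ('i \<Rightarrow> 'a) \<Rightarrow> bool"
  where
  "is_cocone D C Fo Fa c \<gamma> \<longleftrightarrow>
     c \<in> Obj C \<and>
     (\<forall>i\<in>Obj D. \<gamma> i \<in> hom_set C (Fo i) c) \<and>
     (\<forall>u\<in>Mor D. Cmp C (\<gamma> (Cod D u)) (Fa u) = \<gamma> (Dom D u))"

definition is_colimit ::
  "('i, 'j, 'y) cat_struct_scheme \<Rightarrow> ('o, 'a, 'z) cat_struct_scheme \<Rightarrow> ('i \<Rightarrow> 'o) \<Rightarrow> ('j \<Rightarrow> 'a)
     \<Rightarrow> 'o \<Rightarrow> ('i \<Rightarrow> 'a) \<Rightarrow> bool"
  where
  "is_colimit D C Fo Fa c \<gamma> \<longleftrightarrow>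
     is_cocone D C Fo Fa c \<gamma> \<and>
     (\<forall>d \<delta>. is_cocone D C Fo Fa d \<delta> \<longrightarrow>
        (\<exists>!h. h \<in> hom_set C c d \<and> (\<forall>i\<in>Obj D. Cmp C h (\<gamma> i) = \<delta> i)))"

text \<open>
  The infinite type \<open>'i\<close> plays the role of the universe of small sets: a diagram shape is small
  if its objects and arrows are elements of \<open>'i\<close>. The type is kept independent of the types
  of objects and arrows of \<open>C\<close>, because a category with all colimits of the size of its own set
  of arrows is a preorder. Infiniteness ensures that all finite shapes are small.
\<close>

definition cocomplete :: "'i::infinite itself \<Rightarrow> ('o, 'a, 'z) cat_struct_scheme \<Rightarrow> bool" where
  "cocomplete U C \<longleftrightarrow>
     (\<forall>(D :: ('i, 'i) cat_struct) Fo Fa. category D \<and> is_functor D C Fo Fa \<longrightarrow>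
        (\<exists>c \<gamma>. is_colimit D C Fo Fa c \<gamma>))"

definition preserves_colimits ::
  "'i::infinite itself \<Rightarrow> ('o, 'a, 'z) cat_struct_scheme \<Rightarrow> ('o \<Rightarrow> 'o) \<Rightarrow> ('a \<Rightarrow> 'a) \<Rightarrow> bool"
  where
  "preserves_colimits U C Go Ga \<longleftrightarrow>
     (\<forall>(D :: ('i, 'i) cat_struct) Fo Fa c \<gamma>.
        category D \<and> is_functor D C Fo Fa \<and> is_colimit D C Fo Fa c \<gamma> \<longrightarrow>
        is_colimit D C (Go \<circ> Fo) (Ga \<circ> Fa) (Go c) (Ga \<circ> \<gamma>))"

definition is_iso :: "('o, 'a, 'z) cat_struct_scheme \<Rightarrow> 'a \<Rightarrow> bool" where
  "is_iso C f \<longleftrightarrow> f \<in> Mor C \<and>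
     (\<exists>g \<in> hom_set C (Cod C f) (Dom C f).
        Cmp C g f = Ide C (Dom C f) \<and> Cmp C f g = Ide C (Cod C f))"

text \<open>Isomorphism in the arrow category of \<open>C\<close>.\<close>

definition arrow_iso :: "('o, 'a, 'z) cat_struct_scheme \<Rightarrow> ('a \<times> 'a) set" where
  "arrow_iso C = {(f, g). f \<in> Mor C \<and> g \<in> Mor C \<and>
     (\<exists>a \<in> hom_set C (Dom C f) (Dom C g). \<exists>b \<in> hom_set C (Cod C f) (Cod C g).
        is_iso C a \<and> is_iso C b \<and> Cmp C b f = Cmp C g a)}"


section \<open>Strict symmetric monoidal categories\<close>

record ('o, 'a) smc_struct = "('o, 'a) cat_struct" +
  tenO :: "'o \<Rightarrow> 'o \<Rightarrow> 'o"
  tenA :: "'a \<Rightarrow> 'a \<Rightarrow> 'a"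
  unitO :: 'o
  symA :: "'o \<Rightarrow> 'o \<Rightarrow> 'a"

text \<open>Strict means that the associativity and unit constraints are identities; the symmetry
  need not be one.\<close>

locale strict_symmetric_monoidal_category = category C
  for C :: "('o, 'a, 'z) smc_struct_scheme" (structure) +
  assumes unit_obj: "unitO C \<in> Obj C"
    and ten_obj: "x \<in> Obj C \<Longrightarrow> y \<in> Obj C \<Longrightarrow> tenO C x y \<in> Obj C"
    and ten_hom: "f \<in> hom_set C x x' \<Longrightarrow> g \<in> hom_set C y y'
      \<Longrightarrow> tenA C f g \<in> hom_set C (tenO C x y) (tenO C x' y')"
    and ten_ide: "x \<in> Obj C \<Longrightarrow> y \<in> Obj C \<Longrightarrow> tenA C (Ide C x) (Ide C y) = Ide C (tenO C x y)"
    and ten_cmp: "f \<in> hom_set C x x' \<Longrightarrow> f' \<in> hom_set C x' x'' \<Longrightarrow>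
      g \<in> hom_set C y y' \<Longrightarrow> g' \<in> hom_set C y' y'' \<Longrightarrow>
      tenA C (Cmp C f' f) (Cmp C g' g) = Cmp C (tenA C f' g') (tenA C f g)"
    and tenO_assoc: "x \<in> Obj C \<Longrightarrow> y \<in> Obj C \<Longrightarrow> z \<in> Obj C
      \<Longrightarrow> tenO C (tenO C x y) z = tenO C x (tenO C y z)"
    and tenA_assoc: "f \<in> Mor C \<Longrightarrow> g \<in> Mor C \<Longrightarrow> h \<in> Mor C
      \<Longrightarrow> tenA C (tenA C f g) h = tenA C f (tenA C g h)"
    and tenO_unit: "x \<in> Obj C \<Longrightarrow> tenO C (unitO C) x = x" "x \<in> Obj C \<Longrightarrow> tenO C x (unitO C) = x"
    and tenA_unit: "f \<in> Mor C \<Longrightarrow> tenA C (Ide C (unitO C)) f = f"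
      "f \<in> Mor C \<Longrightarrow> tenA C f (Ide C (unitO C)) = f"
    and sym_hom: "x \<in> Obj C \<Longrightarrow> y \<in> Obj C \<Longrightarrow> symA C x y \<in> hom_set C (tenO C x y) (tenO C y x)"
    and sym_natural: "f \<in> hom_set C x x' \<Longrightarrow> g \<in> hom_set C y y' \<Longrightarrow>
      Cmp C (symA C x' y') (tenA C f g) = Cmp C (tenA C g f) (symA C x y)"
    and sym_inverse: "x \<in> Obj C \<Longrightarrow> y \<in> Obj C
      \<Longrightarrow> Cmp C (symA C y x) (symA C x y) = Ide C (tenO C x y)"
    and sym_unit: "x \<in> Obj C \<Longrightarrow> symA C x (unitO C) = Ide C x"
    and sym_hexagon: "x \<in> Obj C \<Longrightarrow> y \<in> Obj C \<Longrightarrow> z \<in> Obj C \<Longrightarrow>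
      symA C (tenO C x y) z =
        Cmp C (tenA C (symA C x z) (Ide C y)) (tenA C (Ide C x) (symA C y z))"

text \<open>The stricter notion of strictness: the symmetry is an identity as well, so that
  \<open>x \<otimes> y = y \<otimes> x\<close>. Literal equivariance of operations built from \<open>\<otimes>\<close> needs it; otherwise
  equivariance holds up to isomorphism of arrows.\<close>

definition trivial_symmetry :: "('o, 'a, 'z) smc_struct_scheme \<Rightarrow> bool" where
  "trivial_symmetry C \<longleftrightarrow> (\<forall>x\<in>Obj C. \<forall>y\<in>Obj C. symA C x y = Ide C (tenO C x y))"

definition cocontinuous :: "'i::infinite itself \<Rightarrow> ('o, 'a, 'z) smc_struct_scheme \<Rightarrow> bool" where
  "cocontinuous U C \<longleftrightarrow>
     (\<forall>x\<in>Obj C. preserves_colimits U C (tenO C x) (tenA C (Ide C x)) \<and>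
                preserves_colimits U C (\<lambda>y. tenO C y x) (\<lambda>f. tenA C f (Ide C x)))"

text \<open>The iterated products \<open>x 1 \<otimes> \<dots> \<otimes> x n\<close>.\<close>

primrec tensO :: "('o, 'a, 'z) smc_struct_scheme \<Rightarrow> nat \<Rightarrow> (nat \<Rightarrow> 'o) \<Rightarrow> 'o" where
  "tensO C 0 x = unitO C"
| "tensO C (Suc n) x = tenO C (tensO C n x) (x (Suc n))"

primrec tensA :: "('o, 'a, 'z) smc_struct_scheme \<Rightarrow> nat \<Rightarrow> (nat \<Rightarrow> 'a) \<Rightarrow> 'a" where
  "tensA C 0 f = Ide C (unitO C)"
| "tensA C (Suc n) f = tenA C (tensA C n f) (f (Suc n))"


section \<open>Set operads and their algebras\<close>

text \<open>
  The data of a set operad with operations in arities \<open>n \<ge> 1\<close>, presented by partial compositions.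
  The symmetric groups act on the left, \<open>act n s\<close> being the action of a permutation \<open>s\<close> of
  \<open>{1..n}\<close>; \<open>pcomp n m k p q\<close> is \<open>p \<circ>\<^sub>k q\<close> for \<open>p\<close> of arity \<open>n\<close> and \<open>q\<close> of arity \<open>m\<close>.
\<close>

record 'p set_operad =
  ops :: "nat \<Rightarrow> 'p set"
  opunit :: 'p
  act :: "nat \<Rightarrow> (nat \<Rightarrow> nat) \<Rightarrow> 'p \<Rightarrow> 'p"
  pcomp :: "nat \<Rightarrow> nat \<Rightarrow> nat \<Rightarrow> 'p \<Rightarrow> 'p \<Rightarrow> 'p"

definition ns_operad_morphism :: "'p set_operad \<Rightarrow> 'q set_operad \<Rightarrow> (nat \<Rightarrow> 'p \<Rightarrow> 'q) \<Rightarrow> bool" where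
  "ns_operad_morphism P Q \<theta> \<longleftrightarrow>
     (\<forall>n\<ge>1. \<forall>p\<in>ops P n. \<theta> n p \<in> ops Q n) \<and>
     \<theta> 1 (opunit P) = opunit Q \<and>
     (\<forall>n\<ge>1. \<forall>m\<ge>1. \<forall>k\<in>{1..n}. \<forall>p\<in>ops P n. \<forall>q\<in>ops P m.
        \<theta> (n + m - 1) (pcomp P n m k p q) = pcomp Q n m k (\<theta> n p) (\<theta> m q))"

definition operad_morphism :: "'p set_operad \<Rightarrow> 'q set_operad \<Rightarrow> (nat \<Rightarrow> 'p \<Rightarrow> 'q) \<Rightarrow> bool" where
  "operad_morphism P Q \<theta> \<longleftrightarrow>
     ns_operad_morphism P Q \<theta> \<and>
     (\<forall>n\<ge>1. \<forall>s. s permutes {1..n} \<longrightarrow> (\<forall>p\<in>ops P n. \<theta> n (act P n s p) = act Q n s (\<theta> n p)))"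

definition tuples :: "'x set \<Rightarrow> nat \<Rightarrow> (nat \<Rightarrow> 'x) set" where
  "tuples X n = {1..n} \<rightarrow>\<^sub>E X"

text \<open>The composite of \<open>\<phi>\<close> and \<open>\<psi>\<close> sends \<open>(x\<^sub>1, \<dots>, x\<^sub>n\<^sub>+\<^sub>m\<^sub>-\<^sub>1)\<close> to
  \<open>\<phi> (x\<^sub>1, \<dots>, x\<^sub>k\<^sub>-\<^sub>1, \<psi> (x\<^sub>k, \<dots>, x\<^sub>k\<^sub>+\<^sub>m\<^sub>-\<^sub>1), x\<^sub>k\<^sub>+\<^sub>m, \<dots>, x\<^sub>n\<^sub>+\<^sub>m\<^sub>-\<^sub>1)\<close>.\<close>

definition End_operad :: "'x set \<Rightarrow> ((nat \<Rightarrow> 'x) \<Rightarrow> 'x) set_operad" where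
  "End_operad X = \<lparr>
     ops = (\<lambda>n. tuples X n \<rightarrow>\<^sub>E X),
     opunit = (\<lambda>x\<in>tuples X 1. x 1),
     act = (\<lambda>n s \<phi>. \<lambda>x\<in>tuples X n. \<phi> (x \<circ> s)),
     pcomp = (\<lambda>n m k \<phi> \<psi>. \<lambda>x\<in>tuples X (n + m - 1).
       \<phi> (\<lambda>i\<in>{1..n}. if i < k then x i
                      else if i = k then \<psi> (\<lambda>j\<in>{1..m}. x (j + k - 1))
                      else x (i + m - 1))) \<rparr>"

definition operad_algebra :: "'p set_operad \<Rightarrow> 'x set \<Rightarrow> (nat \<Rightarrow> 'p \<Rightarrow> (nat \<Rightarrow> 'x) \<Rightarrow> 'x) \<Rightarrow> bool" where
  "operad_algebra P X \<theta> \<longleftrightarrow> operad_morphism P (End_operad X) \<theta>"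

definition ns_operad_algebra :: "'p set_operad \<Rightarrow> 'x set \<Rightarrow> (nat \<Rightarrow> 'p \<Rightarrow> (nat \<Rightarrow> 'x) \<Rightarrow> 'x) \<Rightarrow> bool" where
  "ns_operad_algebra P X \<theta> \<longleftrightarrow> ns_operad_morphism P (End_operad X) \<theta>"


section \<open>The composition operad of simplicial complexes\<close>

definition scpx :: "nat \<Rightarrow> nat set set set" where
  "scpx n = {K. K \<noteq> {} \<and> K \<subseteq> Pow {1..n} \<and> (\<forall>I\<in>K. \<forall>J. J \<subseteq> I \<longrightarrow> J \<in> K)}"

definition set_comp :: "nat \<Rightarrow> nat \<Rightarrow> nat set \<Rightarrow> nat set \<Rightarrow> nat set" where
  "set_comp m k I J =
     {i \<in> I. i < k} \<union>
     (\<lambda>j. j + k - 1) ` (if k \<in> I then {1..m} else J) \<union>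
     (\<lambda>i. i + m - 1) ` {i \<in> I. i > k}"

definition scpx_comp :: "nat \<Rightarrow> nat \<Rightarrow> nat set set \<Rightarrow> nat set set \<Rightarrow> nat set set" where
  "scpx_comp m k K L = {S. \<exists>I\<in>K. \<exists>J\<in>L. S \<subseteq> set_comp m k I J}"

definition scpx_operad :: "nat set set set_operad" where
  "scpx_operad = \<lparr>
     ops = scpx,
     opunit = {{}},
     act = (\<lambda>n s K. image s ` K),
     pcomp = (\<lambda>n m k K L. scpx_comp m k K L) \<rparr>"

definition cat :: "nat set set \<Rightarrow> (nat set, nat set \<times> nat set) cat_struct" where
  "cat K = \<lparr>
     Obj = K,
     Mor = {(I, J). I \<in> K \<and> J \<in> K \<and> I \<subseteq> J},
     Dom = fst,
     Cod = snd,
     Ide = (\<lambda>I. (I, I)),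
     Cmp = (\<lambda>v u. (fst u, snd v)) \<rparr>"


section \<open>The cubical functor and the canonical arrow\<close>

definition zO :: "('o, 'a, 'z) smc_struct_scheme \<Rightarrow> nat \<Rightarrow> (nat \<Rightarrow> 'a) \<Rightarrow> nat set \<Rightarrow> 'o" where
  "zO C n f I = tensO C n (\<lambda>i. if i \<in> I then Cod C (f i) else Dom C (f i))"

definition zA :: "('o, 'a, 'z) smc_struct_scheme \<Rightarrow> nat \<Rightarrow> (nat \<Rightarrow> 'a) \<Rightarrow> nat set \<times> nat set \<Rightarrow> 'a" where
  "zA C n f u = tensA C n (\<lambda>i. if i \<in> fst u then Ide C (Cod C (f i))
                               else if i \<in> snd u then f i
                               else Ide C (Dom C (f i)))"

text \<open>
  \<open>canonical_arrow C n K f g\<close>: for some colimit of \<open>z\<^sub>n(-; f)\<close> on \<open>cat K\<close>, \<open>g\<close> is the arrow from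
  it to \<open>z\<^sub>n([n]; f)\<close> induced by the maps \<open>z\<^sub>n(I; f) \<rightarrow> z\<^sub>n([n]; f)\<close>. This is a relation in \<open>g\<close>
  because a colimit is only determined up to unique isomorphism.
\<close>

definition canonical_arrow ::
  "('o, 'a, 'z) smc_struct_scheme \<Rightarrow> nat \<Rightarrow> nat set set \<Rightarrow> (nat \<Rightarrow> 'a) \<Rightarrow> 'a \<Rightarrow> bool"
  where
  "canonical_arrow C n K f g \<longleftrightarrow>
     (\<exists>c \<gamma>. is_colimit (cat K) C (zO C n f) (zA C n f) c \<gamma> \<and>
        g \<in> hom_set C c (zO C n f {1..n}) \<and>
        (\<forall>I\<in>K. Cmp C g (\<gamma> I) = zA C n f (I, {1..n})))"

end

theory Submission
  imports Defs
begin

text \<open>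
  Everything rests on one computation of iterated colimits. Let \<open>g: c \<rightarrow> X\<close> be the canonical arrow of
  \<open>L\<close> for a block of consecutive arrows, and use \<open>g\<close> as the \<open>k\<close>-th entry of the tuple to which \<open>K\<close>
  is applied. A vertex \<open>z(I)\<close> of the diagram over \<open>K\<close> is a tensor product with the factor \<open>X\<close> in
  position \<open>k\<close> if \<open>k \<in> I\<close> and the factor \<open>c\<close> otherwise. In the second case \<open>c\<close> is itself a colimit
  over \<open>L\<close>, and as tensoring is cocontinuous so is \<open>z(I)\<close>. Hence the colimit over \<open>K\<close> is the colimit
  of all \<open>z(I \<circ>\<^sub>k J)\<close> with \<open>I \<in> K\<close>, \<open>J \<in> L\<close>, and by the formula for \<open>I \<circ>\<^sub>k J\<close> these sets generate
  exactly the composite complex. So a canonical arrow of \<open>K\<close> with \<open>g\<close> inserted is a canonical arrow of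
  \<open>K \<circ>\<^sub>k L\<close>: \<open>canonical_arrow_substitution\<close>. The universal property is checked
  directly on cocones.

  The canonical arrow of given data is determined only up to an isomorphism over its target
  (\<open>canonical_arrow_slice_unique\<close>). For the algebra on \<open>mor(C)\<close> itself this is overcome by choosing one
  arrow in every isomorphism class over a fixed target: both sides of the composition law are
  chosen arrows and lie in the same class, so they are equal. The unit law asks instead that
  the value on the unit be the given arrow; since the unit of the operad decomposes only into
  units, this value can be prescribed without disturbing the rest (\<open>strict_Z\<close>). Relabelling by
  a permutation moves the canonical arrow along a permutation of tensor factors, which is an
  identity as soon as the symmetry is trivial (\<open>canonical_arrow_permute\<close>).

  For isomorphism classes of arrows it remains to see that canonical arrows depend on the given arrows
  up to isomorphism only, and here any symmetry is good enough: a permutation of tensor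
  factors is an isomorphism, natural in the factors (\<open>permutes_factors_exists\<close>).
\<close>


section \<open>Colimits along relabelled and finite shapes\<close>

lemma is_cocone_cong:
  assumes "\<And>i. i \<in> Obj D \<Longrightarrow> Fo i = Fo' i" "\<And>u. u \<in> Mor D \<Longrightarrow> Fa u = Fa' u"
    and "\<And>i. i \<in> Obj D \<Longrightarrow> \<gamma> i = \<gamma>' i"
    and "\<And>u. u \<in> Mor D \<Longrightarrow> Dom D u \<in> Obj D \<and> Cod D u \<in> Obj D"
  shows "is_cocone D C Fo Fa c \<gamma> \<longleftrightarrow> is_cocone D C Fo' Fa' c \<gamma>'"
  using assms by (simp add: is_cocone_def)

lemma is_colimit_cong:
  assumes "\<And>i. i \<in> Obj D \<Longrightarrow> Fo i = Fo' i" "\<And>u. u \<in> Mor D \<Longrightarrow> Fa u = Fa' u"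
    and "\<And>i. i \<in> Obj D \<Longrightarrow> \<gamma> i = \<gamma>' i"
    and "\<And>u. u \<in> Mor D \<Longrightarrow> Dom D u \<in> Obj D \<and> Cod D u \<in> Obj D"
  shows "is_colimit D C Fo Fa c \<gamma> \<longleftrightarrow> is_colimit D C Fo' Fa' c \<gamma>'"
proof -
  have "is_cocone D C Fo Fa c \<gamma> \<longleftrightarrow> is_cocone D C Fo' Fa' c \<gamma>'"
    using assms by (rule is_cocone_cong)
  moreover have "is_cocone D C Fo Fa d \<delta> \<longleftrightarrow> is_cocone D C Fo' Fa' d \<delta>" for d \<delta>
    using assms(1,2) refl assms(4) by (rule is_cocone_cong)
  ultimately show ?thesis
    using assms(3) by (simp add: is_colimit_def)
qed

lemma is_cocone_reindex:
  assumes "Obj D' = \<phi> ` Obj D" "Mor D' = \<psi> ` Mor D"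
    and "\<And>u. u \<in> Mor D \<Longrightarrow> Dom D' (\<psi> u) = \<phi> (Dom D u) \<and> Cod D' (\<psi> u) = \<phi> (Cod D u)"
  shows "is_cocone D' C Fo Fa c \<gamma> \<longleftrightarrow> is_cocone D C (Fo \<circ> \<phi>) (Fa \<circ> \<psi>) c (\<gamma> \<circ> \<phi>)"
  using assms by (simp add: is_cocone_def)

text \<open>Only the underlying graph of the shape enters the definition of a colimit, so an
  isomorphism of graphs is enough to move colimits from one shape to another.\<close>

lemma is_colimit_reindex:
  assumes "Obj D' = \<phi> ` Obj D" "Mor D' = \<psi> ` Mor D"
    and "\<And>u. u \<in> Mor D \<Longrightarrow> Dom D' (\<psi> u) = \<phi> (Dom D u) \<and> Cod D' (\<psi> u) = \<phi> (Cod D u)"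
    and "inj_on \<phi> (Obj D)"
    and "\<And>u. u \<in> Mor D \<Longrightarrow> Dom D u \<in> Obj D \<and> Cod D u \<in> Obj D"
  shows "is_colimit D' C Fo Fa c \<gamma> \<longleftrightarrow> is_colimit D C (Fo \<circ> \<phi>) (Fa \<circ> \<psi>) c (\<gamma> \<circ> \<phi>)"
proof -
  note coc = is_cocone_reindex[OF assms(1-3), where C = C and Fo = Fo and Fa = Fa]
  have "(\<forall>d \<delta>. is_cocone D' C Fo Fa d \<delta> \<longrightarrow>
          (\<exists>!h. h \<in> hom_set C c d \<and> (\<forall>i\<in>Obj D'. Cmp C h (\<gamma> i) = \<delta> i))) \<longleftrightarrow>
        (\<forall>d \<delta>. is_cocone D C (Fo \<circ> \<phi>) (Fa \<circ> \<psi>) d \<delta> \<longrightarrow>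
          (\<exists>!h. h \<in> hom_set C c d \<and> (\<forall>i\<in>Obj D. Cmp C h ((\<gamma> \<circ> \<phi>) i) = \<delta> i)))"
    (is "?L \<longleftrightarrow> ?R")
  proof
    assume L: ?L
    show ?R
    proof (intro allI impI)
      fix d \<delta> assume \<delta>: "is_cocone D C (Fo \<circ> \<phi>) (Fa \<circ> \<psi>) d \<delta>"
      define \<delta>' where "\<delta>' = \<delta> \<circ> inv_into (Obj D) \<phi>"
      have eq: "(\<delta>' \<circ> \<phi>) i = \<delta> i" if "i \<in> Obj D" for i
        using that assms(4) by (simp add: \<delta>'_def)
      have "is_cocone D C (Fo \<circ> \<phi>) (Fa \<circ> \<psi>) d (\<delta>' \<circ> \<phi>)"
        using \<delta> by (subst is_cocone_cong[OF refl refl eq assms(5)])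
      then have "is_cocone D' C Fo Fa d \<delta>'"
        by (simp add: coc)
      with L have "\<exists>!h. h \<in> hom_set C c d \<and> (\<forall>i\<in>Obj D'. Cmp C h (\<gamma> i) = \<delta>' i)"
        by blast
      moreover have "(\<forall>i\<in>Obj D'. Cmp C h (\<gamma> i) = \<delta>' i) \<longleftrightarrow>
          (\<forall>i\<in>Obj D. Cmp C h ((\<gamma> \<circ> \<phi>) i) = \<delta> i)" for h
        using eq by (simp add: assms(1))
      ultimately show "\<exists>!h. h \<in> hom_set C c d \<and> (\<forall>i\<in>Obj D. Cmp C h ((\<gamma> \<circ> \<phi>) i) = \<delta> i)"
        by simp
    qed
  next
    assume R: ?R
    show ?L
    proof (intro allI impI)
      fix d \<delta> assume "is_cocone D' C Fo Fa d \<delta>"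
      then have "is_cocone D C (Fo \<circ> \<phi>) (Fa \<circ> \<psi>) d (\<delta> \<circ> \<phi>)"
        by (simp add: coc)
      with R have "\<exists>!h. h \<in> hom_set C c d \<and> (\<forall>i\<in>Obj D. Cmp C h ((\<gamma> \<circ> \<phi>) i) = (\<delta> \<circ> \<phi>) i)"
        by blast
      then show "\<exists>!h. h \<in> hom_set C c d \<and> (\<forall>i\<in>Obj D'. Cmp C h (\<gamma> i) = \<delta> i)"
        by (simp add: assms(1))
    qed
  qed
  then show ?thesis
    using coc by (simp add: is_colimit_def)
qed

lemma is_functor_compose:
  assumes "is_functor D C Fo Fa" "is_functor C E Go Ga"
  shows "is_functor D E (Go \<circ> Fo) (Ga \<circ> Fa)"
  unfolding is_functor_def
proof (intro conjI ballI)
  have obj: "Fo i \<in> Obj C" if "i \<in> Obj D" for i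
    using assms(1) that by (simp add: is_functor_def)
  have hom: "Fa u \<in> hom_set C (Fo i) (Fo j)" if "i \<in> Obj D" "j \<in> Obj D" "u \<in> hom_set D i j"
    for i j u using assms(1) that by (simp add: is_functor_def)
  fix i assume i: "i \<in> Obj D"
  then show "(Go \<circ> Fo) i \<in> Obj E" "(Ga \<circ> Fa) (Ide D i) = Ide E ((Go \<circ> Fo) i)"
    using assms by (simp_all add: is_functor_def)
  fix j u assume j: "j \<in> Obj D" and u: "u \<in> hom_set D i j"
  show "(Ga \<circ> Fa) u \<in> hom_set E ((Go \<circ> Fo) i) ((Go \<circ> Fo) j)"
    using assms(2) obj[OF i] obj[OF j] hom[OF i j u] by (simp add: is_functor_def)
  fix k v assume k: "k \<in> Obj D" and v: "v \<in> hom_set D j k"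
  have "Fa (Cmp D v u) = Cmp C (Fa v) (Fa u)"
    using assms(1) i j k u v by (simp add: is_functor_def)
  moreover have "Ga (Cmp C (Fa v) (Fa u)) = Cmp E (Ga (Fa v)) (Ga (Fa u))"
    using assms(2) obj[OF i] obj[OF j] obj[OF k] hom[OF i j u] hom[OF j k v]
    by (simp add: is_functor_def)
  ultimately show "(Ga \<circ> Fa) (Cmp D v u) = Cmp E ((Ga \<circ> Fa) v) ((Ga \<circ> Fa) u)"
    by simp
qed

lemma finite_injection_into_infinite:
  assumes "finite A"
  obtains \<phi> :: "'b \<Rightarrow> 'i::infinite" where "inj_on \<phi> A"
proof -
  obtain B :: "'i set" where "finite B" "card B = card A"
    using infinite_arbitrarily_large[OF infinite_UNIV] by blast
  then show thesis
    using assms that finite_same_card_bij[of A B] by (auto simp: bij_betw_def)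
qed

text \<open>The copy, inside the universe of small sets, of a shape that lives elsewhere.\<close>

definition encode_shape ::
  "('i \<Rightarrow> 'p) \<Rightarrow> ('j \<Rightarrow> 'q) \<Rightarrow> ('i, 'j) cat_struct \<Rightarrow> ('p, 'q) cat_struct" where
  "encode_shape \<phi> \<psi> D = \<lparr>
     Obj = \<phi> ` Obj D,
     Mor = \<psi> ` Mor D,
     Dom = \<phi> \<circ> Dom D \<circ> inv_into (Mor D) \<psi>,
     Cod = \<phi> \<circ> Cod D \<circ> inv_into (Mor D) \<psi>,
     Ide = \<psi> \<circ> Ide D \<circ> inv_into (Obj D) \<phi>,
     Cmp = (\<lambda>v u. \<psi> (Cmp D (inv_into (Mor D) \<psi> v) (inv_into (Mor D) \<psi> u))) \<rparr>"

lemma hom_encode_shape: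
  assumes "category D" "inj_on \<phi> (Obj D)" "inj_on \<psi> (Mor D)" "i \<in> Obj D" "j \<in> Obj D"
  shows "hom_set (encode_shape \<phi> \<psi> D) (\<phi> i) (\<phi> j) = \<psi> ` hom_set D i j"
proof -
  interpret category D by fact
  show ?thesis
    using assms dom_obj cod_obj
    by (auto simp: hom_set_def encode_shape_def inj_on_eq_iff[OF assms(2)] image_iff)
qed

lemma category_encode_shape:
  assumes "category D" "inj_on \<phi> (Obj D)" "inj_on \<psi> (Mor D)"
  shows "category (encode_shape \<phi> \<psi> D)"
proof -
  interpret category D by fact
  let ?E = "encode_shape \<phi> \<psi> D"
  have mor: "u \<in> Mor D" if "u \<in> hom_set D x y" for u x y
    using that by (simp add: hom_set_def)
  have hom_preimage: "\<exists>u i j. i \<in> Obj D \<and> j \<in> Obj D \<and> x = \<phi> i \<and> y = \<phi> j \<and> f = \<psi> u \<and> u \<in> hom_set D i j"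
    if "f \<in> hom_set ?E x y" for f x y
  proof -
    from that obtain u where u: "u \<in> Mor D" "f = \<psi> u" "x = \<phi> (Dom D u)" "y = \<phi> (Cod D u)"
      using assms(3) by (auto simp: hom_set_def encode_shape_def)
    then have "Dom D u \<in> Obj D" "Cod D u \<in> Obj D" "u \<in> hom_set D (Dom D u) (Cod D u)"
      using dom_obj cod_obj by (auto simp: hom_set_def)
    with u show ?thesis by blast
  qed
  have cmp: "Cmp ?E (\<psi> v) (\<psi> u) = \<psi> (Cmp D v u)" if "u \<in> Mor D" "v \<in> Mor D" for u v
    using that assms(3) by (simp add: encode_shape_def)
  have ide: "Ide ?E (\<phi> i) = \<psi> (Ide D i)" if "i \<in> Obj D" for i
    using that assms(2) by (simp add: encode_shape_def)
  note hom = hom_encode_shape[OF assms]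
  show ?thesis
  proof
    fix f assume "f \<in> Mor ?E"
    then show "Dom ?E f \<in> Obj ?E" "Cod ?E f \<in> Obj ?E"
      using assms dom_obj cod_obj by (auto simp: encode_shape_def)
  next
    fix x assume "x \<in> Obj ?E"
    then obtain i where "i \<in> Obj D" "x = \<phi> i" by (auto simp: encode_shape_def)
    then show "Ide ?E x \<in> hom_set ?E x x"
      using hom ide ide_hom by auto
  next
    fix f g x y z assume f: "f \<in> hom_set ?E x y" and g: "g \<in> hom_set ?E y z"
    from hom_preimage[OF f] obtain u i j where u: "i \<in> Obj D" "j \<in> Obj D" "x = \<phi> i"
        "y = \<phi> j" "f = \<psi> u" "u \<in> hom_set D i j"
      by blast
    from hom_preimage[OF g] obtain v j' k where v: "j' \<in> Obj D" "k \<in> Obj D" "y = \<phi> j'"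
        "z = \<phi> k" "g = \<psi> v" "v \<in> hom_set D j' k"
      by blast
    from u v have j': "j' = j"
      using inj_onD[OF assms(2), of j' j] by simp
    have "Cmp D v u \<in> hom_set D i k"
      using cmp_hom[OF u(6)] v(6) by (simp add: j')
    then show "Cmp ?E g f \<in> hom_set ?E x z"
      using hom[OF u(1) v(2)] cmp[OF mor[OF u(6)] mor[OF v(6)]] by (simp add: u(3,5) v(4,5))
  next
    fix f x y assume f: "f \<in> hom_set ?E x y"
    from hom_preimage[OF f] obtain u i j where u: "i \<in> Obj D" "j \<in> Obj D" "x = \<phi> i"
        "y = \<phi> j" "f = \<psi> u" "u \<in> hom_set D i j"
      by blast
    show "Cmp ?E f (Ide ?E x) = f"
      unfolding u(3,5) ide[OF u(1)] cmp[OF mor[OF ide_hom[OF u(1)]] mor[OF u(6)]]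
      by (simp only: cmp_ide[OF u(6)])
    show "Cmp ?E (Ide ?E y) f = f"
      unfolding u(4,5) ide[OF u(2)] cmp[OF mor[OF u(6)] mor[OF ide_hom[OF u(2)]]]
      by (simp only: ide_cmp[OF u(6)])
  next
    fix f g h w x y z
    assume f: "f \<in> hom_set ?E w x" and g: "g \<in> hom_set ?E x y" and h: "h \<in> hom_set ?E y z"
    from hom_preimage[OF f] obtain u i j where u: "i \<in> Obj D" "j \<in> Obj D" "w = \<phi> i"
        "x = \<phi> j" "f = \<psi> u" "u \<in> hom_set D i j"
      by blast
    from hom_preimage[OF g] obtain v j' k where v: "j' \<in> Obj D" "k \<in> Obj D" "x = \<phi> j'"
        "y = \<phi> k" "g = \<psi> v" "v \<in> hom_set D j' k"
      by blast
    from hom_preimage[OF h] obtain t k' l where t: "k' \<in> Obj D" "l \<in> Obj D" "y = \<phi> k'"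
        "z = \<phi> l" "h = \<psi> t" "t \<in> hom_set D k' l"
      by blast
    have "j' = j" "k' = k"
      using u v t inj_onD[OF assms(2), of j' j] inj_onD[OF assms(2), of k' k] by simp_all
    then have hs: "v \<in> hom_set D j k" "t \<in> hom_set D k l"
      using v(6) t(6) by simp_all
    note ms = mor[OF u(6)] mor[OF hs(1)] mor[OF hs(2)]
      mor[OF cmp_hom[OF u(6) hs(1)]] mor[OF cmp_hom[OF hs]]
    show "Cmp ?E h (Cmp ?E g f) = Cmp ?E (Cmp ?E h g) f"
      by (simp only: u(5) v(5) t(5) cmp ms cmp_assoc[OF u(6) hs])
  qed
qed

lemma is_functor_encode_shape:
  assumes "category D" "inj_on \<phi> (Obj D)" "inj_on \<psi> (Mor D)" "is_functor D C Fo Fa"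
  shows "is_functor (encode_shape \<phi> \<psi> D) C (Fo \<circ> inv_into (Obj D) \<phi>) (Fa \<circ> inv_into (Mor D) \<psi>)"
proof -
  interpret category D by fact
  let ?E = "encode_shape \<phi> \<psi> D"
  have obj: "Obj ?E = \<phi> ` Obj D" by (simp add: encode_shape_def)
  have mor: "u \<in> Mor D" if "u \<in> hom_set D x y" for u x y
    using that by (simp add: hom_set_def)
  have cmp: "Cmp ?E (\<psi> v) (\<psi> u) = \<psi> (Cmp D v u)" if "u \<in> Mor D" "v \<in> Mor D" for u v
    using that assms(3) by (simp add: encode_shape_def)
  have ide: "Ide ?E (\<phi> i) = \<psi> (Ide D i)" if "i \<in> Obj D" for i
    using that assms(2) by (simp add: encode_shape_def)
  note hom = hom_encode_shape[OF assms(1-3)]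
  show ?thesis
    unfolding is_functor_def obj ball_simps
  proof (intro conjI ballI)
    fix i assume i: "i \<in> Obj D"
    then show "(Fo \<circ> inv_into (Obj D) \<phi>) (\<phi> i) \<in> Obj C"
      using assms by (simp add: is_functor_def)
    show "(Fa \<circ> inv_into (Mor D) \<psi>) (Ide ?E (\<phi> i)) = Ide C ((Fo \<circ> inv_into (Obj D) \<phi>) (\<phi> i))"
      using assms i by (simp add: is_functor_def ide mor[OF ide_hom])
    fix j assume j: "j \<in> Obj D"
    {
      fix u assume "u \<in> hom_set ?E (\<phi> i) (\<phi> j)"
      then show "(Fa \<circ> inv_into (Mor D) \<psi>) u \<in>
          hom_set C ((Fo \<circ> inv_into (Obj D) \<phi>) (\<phi> i)) ((Fo \<circ> inv_into (Obj D) \<phi>) (\<phi> j))"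
        using assms i j by (auto simp: hom is_functor_def mor)
    }
    fix k u v assume k: "k \<in> Obj D"
      and u: "u \<in> hom_set ?E (\<phi> i) (\<phi> j)" and v: "v \<in> hom_set ?E (\<phi> j) (\<phi> k)"
    then obtain u' v' where u': "u = \<psi> u'" "u' \<in> hom_set D i j"
      and v': "v = \<psi> v'" "v' \<in> hom_set D j k"
      using i j by (auto simp: hom)
    have "Cmp D v' u' \<in> Mor D"
      using u' v' by (auto intro!: mor cmp_hom)
    then show "(Fa \<circ> inv_into (Mor D) \<psi>) (Cmp ?E v u) =
        Cmp C ((Fa \<circ> inv_into (Mor D) \<psi>) v) ((Fa \<circ> inv_into (Mor D) \<psi>) u)"
      using assms i j k u' v' by (auto simp: cmp mor is_functor_def)
  qed
qed

lemma is_colimit_encode_shape: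
  assumes "category D" "inj_on \<phi> (Obj D)" "inj_on \<psi> (Mor D)"
  shows "is_colimit (encode_shape \<phi> \<psi> D) C Fo Fa c \<gamma> \<longleftrightarrow>
    is_colimit D C (Fo \<circ> \<phi>) (Fa \<circ> \<psi>) c (\<gamma> \<circ> \<phi>)"
proof (rule is_colimit_reindex)
  interpret category D by fact
  show "Dom D u \<in> Obj D \<and> Cod D u \<in> Obj D" if "u \<in> Mor D" for u
    using that dom_obj[of u] cod_obj[of u] by blast
qed (use assms in \<open>auto simp: encode_shape_def\<close>)

text \<open>The diagrams of interest have shapes whose objects are sets of numbers, not elements of the
  universe \<open>'i\<close>. A finite shape has a copy there because \<open>'i\<close> is infinite, so cocompleteness
  and preservation of colimits extend to it.\<close>

lemma cocomplete_finite_shape: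
  fixes D :: "('b, 'c) cat_struct"
  assumes "cocomplete TYPE('i::infinite) C"
    and "category D" "finite (Obj D)" "finite (Mor D)" "is_functor D C Fo Fa"
  shows "\<exists>c \<gamma>. is_colimit D C Fo Fa c \<gamma>"
proof -
  interpret category D by fact
  obtain \<phi> :: "'b \<Rightarrow> 'i" where \<phi>: "inj_on \<phi> (Obj D)"
    using finite_injection_into_infinite assms(3) .
  obtain \<psi> :: "'c \<Rightarrow> 'i" where \<psi>: "inj_on \<psi> (Mor D)"
    using finite_injection_into_infinite assms(4) .
  note enc = \<open>category D\<close> \<phi> \<psi>
  obtain c \<gamma> where "is_colimit (encode_shape \<phi> \<psi> D) C
      (Fo \<circ> inv_into (Obj D) \<phi>) (Fa \<circ> inv_into (Mor D) \<psi>) c \<gamma>"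
    using assms(1) category_encode_shape[OF enc] is_functor_encode_shape[OF enc assms(5)]
    unfolding cocomplete_def by blast
  then have "is_colimit D C (Fo \<circ> inv_into (Obj D) \<phi> \<circ> \<phi>) (Fa \<circ> inv_into (Mor D) \<psi> \<circ> \<psi>) c (\<gamma> \<circ> \<phi>)"
    by (simp add: is_colimit_encode_shape[OF enc])
  then have "is_colimit D C Fo Fa c (\<gamma> \<circ> \<phi>)"
    by (subst (asm) is_colimit_cong) (use \<phi> \<psi> dom_obj cod_obj in auto)
  then show ?thesis by blast
qed

lemma preserves_colimits_finite_shape:
  fixes D :: "('b, 'c) cat_struct"
  assumes "preserves_colimits TYPE('i::infinite) C Go Ga"
    and "category D" "finite (Obj D)" "finite (Mor D)" "is_functor D C Fo Fa"
    and "is_colimit D C Fo Fa c \<gamma>"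
  shows "is_colimit D C (Go \<circ> Fo) (Ga \<circ> Fa) (Go c) (Ga \<circ> \<gamma>)"
proof -
  interpret category D by fact
  obtain \<phi> :: "'b \<Rightarrow> 'i" where \<phi>: "inj_on \<phi> (Obj D)"
    using finite_injection_into_infinite assms(3) .
  obtain \<psi> :: "'c \<Rightarrow> 'i" where \<psi>: "inj_on \<psi> (Mor D)"
    using finite_injection_into_infinite assms(4) .
  note enc = \<open>category D\<close> \<phi> \<psi>
  let ?Fo = "Fo \<circ> inv_into (Obj D) \<phi>" and ?Fa = "Fa \<circ> inv_into (Mor D) \<psi>"
    and ?\<gamma> = "\<gamma> \<circ> inv_into (Obj D) \<phi>"
  have "is_colimit D C (?Fo \<circ> \<phi>) (?Fa \<circ> \<psi>) c (?\<gamma> \<circ> \<phi>)"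
    using assms(6) by (subst is_colimit_cong) (use \<phi> \<psi> dom_obj cod_obj in auto)
  then have "is_colimit (encode_shape \<phi> \<psi> D) C ?Fo ?Fa c ?\<gamma>"
    by (simp only: is_colimit_encode_shape[OF enc])
  then have "is_colimit (encode_shape \<phi> \<psi> D) C (Go \<circ> ?Fo) (Ga \<circ> ?Fa) (Go c) (Ga \<circ> ?\<gamma>)"
    using assms(1) category_encode_shape[OF enc] is_functor_encode_shape[OF enc assms(5)]
    unfolding preserves_colimits_def by blast
  then have "is_colimit D C (Go \<circ> ?Fo \<circ> \<phi>) (Ga \<circ> ?Fa \<circ> \<psi>) (Go c) (Ga \<circ> ?\<gamma> \<circ> \<phi>)"
    by (simp only: is_colimit_encode_shape[OF enc])
  then show ?thesis
    by (subst (asm) is_colimit_cong) (use \<phi> \<psi> dom_obj cod_obj in auto)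
qed

lemma preserves_colimits_compose:
  assumes "is_functor C C Go Ga"
    and "preserves_colimits TYPE('i::infinite) C Go Ga" "preserves_colimits TYPE('i) C Ho Ha"
  shows "preserves_colimits TYPE('i) C (\<lambda>x. Ho (Go x)) (\<lambda>f. Ha (Ga f))"
  unfolding preserves_colimits_def
proof (intro allI impI, elim conjE)
  fix D :: "('i, 'i) cat_struct" and Fo Fa c \<gamma>
  assume D: "category D" "is_functor D C Fo Fa" "is_colimit D C Fo Fa c \<gamma>"
  then have "is_colimit D C (Go \<circ> Fo) (Ga \<circ> Fa) (Go c) (Ga \<circ> \<gamma>)"
    using assms(2) unfolding preserves_colimits_def by blast
  then have "is_colimit D C (Ho \<circ> (Go \<circ> Fo)) (Ha \<circ> (Ga \<circ> Fa)) (Ho (Go c)) (Ha \<circ> (Ga \<circ> \<gamma>))"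
    using assms(3) D is_functor_compose[OF D(2) assms(1)]
    unfolding preserves_colimits_def by blast
  then show "is_colimit D C ((\<lambda>x. Ho (Go x)) \<circ> Fo) ((\<lambda>f. Ha (Ga f)) \<circ> Fa)
      (Ho (Go c)) ((\<lambda>f. Ha (Ga f)) \<circ> \<gamma>)"
    by (simp add: o_def)
qed

lemma hom_cat: "hom_set (cat K) I J = (if I \<in> K \<and> J \<in> K \<and> I \<subseteq> J then {(I, J)} else {})"
  by (auto simp: hom_set_def cat_def)

lemma category_cat: "category (cat K)"
  by (rule category.intro) (simp_all add: hom_cat split: if_splits, auto simp add: cat_def)


section \<open>Finite tensor products\<close>

lemma cat_simps:
  "Obj (cat K) = K" "Mor (cat K) = {(I, J). I \<in> K \<and> J \<in> K \<and> I \<subseteq> J}" "Dom (cat K) = fst"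
  "Cod (cat K) = snd" "Ide (cat K) I = (I, I)" "Cmp (cat K) v u = (fst u, snd v)"
  by (simp_all add: cat_def)

context category
begin

abbreviation hom :: "'o \<Rightarrow> 'o \<Rightarrow> 'a set" where
  "hom x y \<equiv> hom_set C x y"

abbreviation comp :: "'a \<Rightarrow> 'a \<Rightarrow> 'a" (infixr "\<cdot>" 70) where
  "g \<cdot> f \<equiv> Cmp C g f"

lemma hom_mor: "f \<in> hom x y \<Longrightarrow> f \<in> Mor C"
  by (simp add: hom_set_def)

lemma hom_dom: "f \<in> hom x y \<Longrightarrow> Dom C f = x" and hom_cod: "f \<in> hom x y \<Longrightarrow> Cod C f = y"
  by (simp_all add: hom_set_def)

lemma mor_hom: "f \<in> Mor C \<Longrightarrow> f \<in> hom (Dom C f) (Cod C f)"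
  by (simp add: hom_set_def)

lemma hom_obj: "f \<in> hom x y \<Longrightarrow> x \<in> Obj C" "f \<in> hom x y \<Longrightarrow> y \<in> Obj C"
  using dom_obj cod_obj by (auto simp: hom_set_def)

lemma Ide_inject: "x \<in> Obj C \<Longrightarrow> y \<in> Obj C \<Longrightarrow> Ide C x = Ide C y \<longleftrightarrow> x = y"
  using ide_hom hom_dom by metis

end

lemma tensO_cong: "(\<And>i. i \<in> {1..n} \<Longrightarrow> x i = y i) \<Longrightarrow> tensO C n x = tensO C n y"
  by (induction n) auto

lemma tensA_cong: "(\<And>i. i \<in> {1..n} \<Longrightarrow> f i = g i) \<Longrightarrow> tensA C n f = tensA C n g"
  by (induction n) auto

context strict_symmetric_monoidal_category
begin

lemma tensO_obj: "(\<And>i. i \<in> {1..n} \<Longrightarrow> x i \<in> Obj C) \<Longrightarrow> tensO C n x \<in> Obj C"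
  by (induction n) (auto simp: unit_obj ten_obj)

lemma tensA_hom:
  "(\<And>i. i \<in> {1..n} \<Longrightarrow> f i \<in> hom (x i) (y i)) \<Longrightarrow> tensA C n f \<in> hom (tensO C n x) (tensO C n y)"
  by (induction n) (auto simp: unit_obj ide_hom ten_hom)

lemma tensA_mor: "(\<And>i. i \<in> {1..n} \<Longrightarrow> f i \<in> Mor C) \<Longrightarrow> tensA C n f \<in> Mor C"
  using tensA_hom[of n f "\<lambda>i. Dom C (f i)" "\<lambda>i. Cod C (f i)"] mor_hom hom_mor by blast

lemma tensA_ide:
  "(\<And>i. i \<in> {1..n} \<Longrightarrow> x i \<in> Obj C) \<Longrightarrow> tensA C n (\<lambda>i. Ide C (x i)) = Ide C (tensO C n x)"
proof (induction n)
  case (Suc n)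
  have "tensO C n x \<in> Obj C" using Suc.prems by (intro tensO_obj) auto
  with Suc show ?case by (simp add: ten_ide)
qed simp

lemma tensA_cmp:
  assumes "\<And>i. i \<in> {1..n} \<Longrightarrow> f i \<in> hom (x i) (y i)" "\<And>i. i \<in> {1..n} \<Longrightarrow> g i \<in> hom (y i) (z i)"
  shows "tensA C n (\<lambda>i. g i \<cdot> f i) = tensA C n g \<cdot> tensA C n f"
  using assms
proof (induction n)
  case 0
  then show ?case using cmp_ide[OF ide_hom[OF unit_obj]] by simp
next
  case (Suc n)
  have "tensA C n f \<in> hom (tensO C n x) (tensO C n y)" "tensA C n g \<in> hom (tensO C n y) (tensO C n z)"
    using Suc.prems by (auto intro!: tensA_hom)
  then have "tenA C (tensA C n g \<cdot> tensA C n f) (g (Suc n) \<cdot> f (Suc n)) =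
      tenA C (tensA C n g) (g (Suc n)) \<cdot> tenA C (tensA C n f) (f (Suc n))"
    using Suc.prems by (intro ten_cmp) auto
  with Suc show ?case by simp
qed

lemma tensA_add:
  assumes "\<And>i. i \<in> {1..p + q} \<Longrightarrow> f i \<in> Mor C"
  shows "tensA C (p + q) f = tenA C (tensA C p f) (tensA C q (\<lambda>i. f (p + i)))"
  using assms
proof (induction q)
  case 0
  then have "tensA C p f \<in> Mor C" by (intro tensA_mor) auto
  then show ?case by (simp add: tenA_unit)
next
  case (Suc q)
  have "tensA C p f \<in> Mor C" "tensA C q (\<lambda>i. f (p + i)) \<in> Mor C"
    using Suc.prems by (auto intro!: tensA_mor)
  with Suc show ?case by (simp add: tenA_assoc)
qed

text \<open>Strict associativity in operadic form: the factors in positions \<open>k, \<dots>, k + m - 1\<close> may be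
  bracketed together and counted as the single factor in position \<open>k\<close>.\<close>

lemma tensA_graft:
  assumes "k \<in> {1..n}" "\<And>i. i \<in> {1..n + m - 1} \<Longrightarrow> f i \<in> Mor C"
  shows "tensA C (n + m - 1) f =
    tensA C n (\<lambda>i. if i < k then f i else if i = k then tensA C m (\<lambda>j. f (j + k - 1))
                   else f (i + m - 1))"
proof -
  from assms(1) obtain p q where k: "k = Suc p" and n: "n = Suc p + q"
    by (metis Suc_le_D atLeastAtMost_iff le_Suc_ex One_nat_def)
  let ?g = "\<lambda>i. if i < Suc p then f i else if i = Suc p then tensA C m (\<lambda>j. f (j + Suc p - 1))
                   else f (i + m - 1)"
  have "tensA C (Suc p + q + m - 1) f = tensA C (Suc p + q) ?g"
    if "\<And>i. i \<in> {1..Suc p + q + m - 1} \<Longrightarrow> f i \<in> Mor C" for q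
    using that
  proof (induction q)
    case 0
    have "tensA C (p + m) f = tenA C (tensA C p f) (tensA C m (\<lambda>j. f (p + j)))"
      using 0 by (intro tensA_add) auto
    moreover have "tensA C p f = tensA C p ?g"
      by (rule tensA_cong) auto
    ultimately show ?case by (simp add: add.commute)
  next
    case (Suc q)
    have eq: "Suc p + Suc q + m - 1 = Suc (Suc p + q + m - 1)" by simp
    have "tensA C (Suc p + q + m - 1) f = tensA C (Suc p + q) ?g"
      using Suc.prems by (intro Suc.IH) auto
    then show ?case by (subst eq) simp
  qed
  from this[of q] assms(2) show ?thesis unfolding k n by simp
qed

lemma tensO_graft:
  assumes "k \<in> {1..n}" "\<And>i. i \<in> {1..n + m - 1} \<Longrightarrow> x i \<in> Obj C"
  shows "tensO C (n + m - 1) x =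
    tensO C n (\<lambda>i. if i < k then x i else if i = k then tensO C m (\<lambda>j. x (j + k - 1))
                   else x (i + m - 1))" (is "_ = tensO C n ?y")
proof -
  have inner: "tensO C m (\<lambda>j. x (j + k - 1)) \<in> Obj C"
    "tensA C m (\<lambda>j. Ide C (x (j + k - 1))) = Ide C (tensO C m (\<lambda>j. x (j + k - 1)))"
    using assms(1) by (auto intro!: tensO_obj tensA_ide assms(2))
  have y: "?y i \<in> Obj C" if "i \<in> {1..n}" for i
    using that assms(1) inner by (auto intro!: assms(2))
  have "Ide C (tensO C (n + m - 1) x) = tensA C (n + m - 1) (\<lambda>i. Ide C (x i))"
    by (rule tensA_ide[symmetric]) (rule assms(2))
  also have "\<dots> = tensA C n (\<lambda>i. if i < k then Ide C (x i)
      else if i = k then tensA C m (\<lambda>j. Ide C (x (j + k - 1))) else Ide C (x (i + m - 1)))"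
    using assms by (intro tensA_graft) (auto intro: hom_mor ide_hom)
  also have "\<dots> = tensA C n (\<lambda>i. Ide C (?y i))"
    using inner by (intro tensA_cong) simp
  also have "\<dots> = Ide C (tensO C n ?y)"
    by (rule tensA_ide) (rule y)
  finally show ?thesis
    using Ide_inject tensO_obj[of "n + m - 1" x] tensO_obj[of n ?y] assms(2) y by blast
qed


section \<open>Tensor products with one free factor\<close>

definition zobj :: "(nat \<Rightarrow> 'a) \<Rightarrow> nat set \<Rightarrow> nat \<Rightarrow> 'o" where
  "zobj f I i = (if i \<in> I then Cod C (f i) else Dom C (f i))"

definition zarr :: "(nat \<Rightarrow> 'a) \<Rightarrow> nat set \<Rightarrow> nat set \<Rightarrow> nat \<Rightarrow> 'a" where
  "zarr f I J i = (if i \<in> I then Ide C (Cod C (f i)) else if i \<in> J then f i else Ide C (Dom C (f i)))"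

lemma zO_eq: "zO C n f I = tensO C n (zobj f I)"
  by (simp add: zO_def zobj_def[abs_def])

lemma zA_eq: "zA C n f (I, J) = tensA C n (zarr f I J)"
  by (simp add: zA_def zarr_def[abs_def] cong: if_cong)

lemma zobj_obj: "f i \<in> Mor C \<Longrightarrow> zobj f I i \<in> Obj C"
  by (simp add: zobj_def dom_obj cod_obj)

lemma zarr_hom: "f i \<in> Mor C \<Longrightarrow> I \<subseteq> J \<Longrightarrow> zarr f I J i \<in> hom (zobj f I i) (zobj f J i)"
  by (auto simp: zobj_def zarr_def dom_obj cod_obj ide_hom mor_hom)

lemma zarr_refl: "zarr f I I = (\<lambda>i. Ide C (zobj f I i))"
  by (simp add: zobj_def zarr_def fun_eq_iff)

lemma zarr_cmp:
  assumes "f i \<in> Mor C" "I \<subseteq> J" "J \<subseteq> K"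
  shows "zarr f J K i \<cdot> zarr f I J i = zarr f I K i"
proof -
  note h = mor_hom[OF assms(1)]
  have "Ide C (Dom C (f i)) \<cdot> Ide C (Dom C (f i)) = Ide C (Dom C (f i))"
      "Ide C (Cod C (f i)) \<cdot> Ide C (Cod C (f i)) = Ide C (Cod C (f i))"
    using cmp_ide ide_hom dom_obj cod_obj assms(1) by blast+
  then show ?thesis
    using assms(2,3) cmp_ide[OF h] ide_cmp[OF h] by (auto simp: zarr_def)
qed

lemma zO_obj: "(\<And>i. i \<in> {1..n} \<Longrightarrow> f i \<in> Mor C) \<Longrightarrow> zO C n f I \<in> Obj C"
  unfolding zO_eq by (intro tensO_obj zobj_obj)

lemma zA_hom:
  "(\<And>i. i \<in> {1..n} \<Longrightarrow> f i \<in> Mor C) \<Longrightarrow> I \<subseteq> J \<Longrightarrow> zA C n f (I, J) \<in> hom (zO C n f I) (zO C n f J)"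
  unfolding zO_eq zA_eq by (intro tensA_hom zarr_hom)

lemma zA_refl: "(\<And>i. i \<in> {1..n} \<Longrightarrow> f i \<in> Mor C) \<Longrightarrow> zA C n f (I, I) = Ide C (zO C n f I)"
  unfolding zO_eq zA_eq zarr_refl by (intro tensA_ide zobj_obj)

lemma zA_cmp:
  assumes "\<And>i. i \<in> {1..n} \<Longrightarrow> f i \<in> Mor C" "I \<subseteq> J" "J \<subseteq> K"
  shows "zA C n f (J, K) \<cdot> zA C n f (I, J) = zA C n f (I, K)"
proof -
  have "tensA C n (\<lambda>i. zarr f J K i \<cdot> zarr f I J i) = tensA C n (zarr f J K) \<cdot> tensA C n (zarr f I J)"
    by (rule tensA_cmp; rule zarr_hom; use assms in auto)
  moreover have "tensA C n (\<lambda>i. zarr f J K i \<cdot> zarr f I J i) = tensA C n (zarr f I K)"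
    by (intro tensA_cong zarr_cmp) (use assms in auto)
  ultimately show ?thesis by (simp add: zA_eq)
qed

lemma is_functor_z:
  assumes "\<And>i. i \<in> {1..n} \<Longrightarrow> f i \<in> Mor C"
  shows "is_functor (cat K) C (zO C n f) (zA C n f)"
  unfolding is_functor_def
proof (intro conjI ballI)
  fix I assume "I \<in> Obj (cat K)"
  then show "zO C n f I \<in> Obj C" "zA C n f (Ide (cat K) I) = Ide C (zO C n f I)"
    using zO_obj[OF assms] zA_refl[OF assms] by (simp_all add: cat_simps)
next
  fix I J u assume "u \<in> hom_set (cat K) I J"
  then show "zA C n f u \<in> hom (zO C n f I) (zO C n f J)"
    using zA_hom[OF assms] by (auto simp: hom_cat split: if_splits)
next
  fix I J H u v assume "u \<in> hom_set (cat K) I J" "v \<in> hom_set (cat K) J H"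
  then show "zA C n f (Cmp (cat K) v u) = zA C n f v \<cdot> zA C n f u"
    using zA_cmp[OF assms] by (auto simp: hom_cat cat_simps split: if_splits)
qed

text \<open>The factors of the cubical functor outside position \<open>k\<close>, with position \<open>k\<close> left free:
  a functor of two variables, a subset of \<open>[n]\<close> that matters only outside \<open>k\<close>, and an
  object of \<open>C\<close>.\<close>

definition slotO :: "nat \<Rightarrow> (nat \<Rightarrow> 'a) \<Rightarrow> nat \<Rightarrow> nat set \<Rightarrow> 'o \<Rightarrow> 'o" where
  "slotO n f k I x = tensO C n ((zobj f I)(k := x))"

definition slotA :: "nat \<Rightarrow> (nat \<Rightarrow> 'a) \<Rightarrow> nat \<Rightarrow> nat set \<Rightarrow> nat set \<Rightarrow> 'a \<Rightarrow> 'a" where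
  "slotA n f k I J u = tensA C n ((zarr f I J)(k := u))"

lemma slotO_cong: "I - {k} = I' - {k} \<Longrightarrow> slotO n f k I x = slotO n f k I' x"
  unfolding slotO_def by (rule tensO_cong) (auto simp: zobj_def)

lemma slotA_cong:
  "I - {k} = I' - {k} \<Longrightarrow> J - {k} = J' - {k} \<Longrightarrow> slotA n f k I J u = slotA n f k I' J' u"
  unfolding slotA_def by (rule tensA_cong) (auto simp: zarr_def)

lemma slotO_z: "zO C n f I = slotO n f k I (zobj f I k)"
  by (simp add: slotO_def zO_eq)

lemma slotA_z: "zA C n f (I, J) = slotA n f k I J (zarr f I J k)"
  by (simp add: slotA_def zA_eq)


lemma slotA_hom:
  assumes "\<And>i. i \<in> {1..n} - {k} \<Longrightarrow> f i \<in> Mor C" "I - {k} \<subseteq> J" "u \<in> hom x y"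
  shows "slotA n f k I J u \<in> hom (slotO n f k I x) (slotO n f k J y)"
proof -
  have "slotA n f k (I - {k}) J u \<in> hom (slotO n f k (I - {k}) x) (slotO n f k J y)"
    unfolding slotO_def slotA_def
    by (rule tensA_hom) (use assms in \<open>auto simp: zarr_hom\<close>)
  moreover have "slotA n f k (I - {k}) J u = slotA n f k I J u" by (rule slotA_cong) auto
  moreover have "slotO n f k (I - {k}) x = slotO n f k I x" by (rule slotO_cong) auto
  ultimately show ?thesis by simp
qed

lemma slotA_cmp:
  assumes "\<And>i. i \<in> {1..n} - {k} \<Longrightarrow> f i \<in> Mor C" "I - {k} \<subseteq> J" "J - {k} \<subseteq> H"
    and "u \<in> hom x y" "v \<in> hom y z"
  shows "slotA n f k J H v \<cdot> slotA n f k I J u = slotA n f k I H (v \<cdot> u)"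
proof -
  have 1: "slotA n f k (I - {k}) (J - {k}) u = slotA n f k I J u"
      "slotA n f k (J - {k}) (H - {k}) v = slotA n f k J H v"
      "slotA n f k (I - {k}) (H - {k}) (v \<cdot> u) = slotA n f k I H (v \<cdot> u)"
    by (auto intro!: slotA_cong)
  have sub: "I - {k} \<subseteq> J - {k}" "J - {k} \<subseteq> H - {k}" using assms(2,3) by auto
  let ?u = "(zarr f (I - {k}) (J - {k}))(k := u)" and ?v = "(zarr f (J - {k}) (H - {k}))(k := v)"
  have "tensA C n (\<lambda>i. ?v i \<cdot> ?u i) = tensA C n ?v \<cdot> tensA C n ?u"
    by (rule tensA_cmp[where x = "(zobj f (I - {k}))(k := x)" and y = "(zobj f (J - {k}))(k := y)"
          and z = "(zobj f (H - {k}))(k := z)"]; use assms sub in \<open>auto simp: zarr_hom\<close>)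
  moreover have "tensA C n (\<lambda>i. ?v i \<cdot> ?u i) =
      tensA C n ((zarr f (I - {k}) (H - {k}))(k := v \<cdot> u))"
    by (rule tensA_cong) (use assms sub in \<open>auto simp: zarr_cmp\<close>)
  ultimately show ?thesis
    using 1 by (simp add: slotA_def)
qed

lemma is_functor_ten_left: "x \<in> Obj C \<Longrightarrow> is_functor C C (tenO C x) (tenA C (Ide C x))"
  unfolding is_functor_def
proof (intro conjI ballI)
  fix y z w u v assume x: "x \<in> Obj C" and u: "u \<in> hom y z" and v: "v \<in> hom z w"
  have "tenA C (Ide C x \<cdot> Ide C x) (v \<cdot> u) = tenA C (Ide C x) v \<cdot> tenA C (Ide C x) u"
    using ten_cmp[OF ide_hom[OF x] ide_hom[OF x] u v] .
  then show "tenA C (Ide C x) (v \<cdot> u) = tenA C (Ide C x) v \<cdot> tenA C (Ide C x) u"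
    using cmp_ide[OF ide_hom[OF x]] by simp
qed (auto simp: ten_obj ten_hom ide_hom ten_ide)

lemma is_functor_ten_right: "x \<in> Obj C \<Longrightarrow> is_functor C C (\<lambda>y. tenO C y x) (\<lambda>f. tenA C f (Ide C x))"
  unfolding is_functor_def
proof (intro conjI ballI)
  fix y z w u v assume x: "x \<in> Obj C" and u: "u \<in> hom y z" and v: "v \<in> hom z w"
  have "tenA C (v \<cdot> u) (Ide C x \<cdot> Ide C x) = tenA C v (Ide C x) \<cdot> tenA C u (Ide C x)"
    using ten_cmp[OF u v ide_hom[OF x] ide_hom[OF x]] .
  then show "tenA C (v \<cdot> u) (Ide C x) = tenA C v (Ide C x) \<cdot> tenA C u (Ide C x)"
    using cmp_ide[OF ide_hom[OF x]] by simp
qed (auto simp: ten_obj ten_hom ide_hom ten_ide)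

lemma tens_slot_preserves_colimits:
  assumes cc: "cocontinuous TYPE('i::infinite) C"
    and a: "\<And>i. i \<in> {1..n} \<Longrightarrow> a i \<in> Obj C" and k: "k \<in> {1..n}"
  shows "is_functor C C (\<lambda>x. tensO C n (a(k := x))) (\<lambda>u. tensA C n ((\<lambda>i. Ide C (a i))(k := u))) \<and>
    preserves_colimits TYPE('i) C (\<lambda>x. tensO C n (a(k := x)))
      (\<lambda>u. tensA C n ((\<lambda>i. Ide C (a i))(k := u)))"
  using a k
proof (induction n)
  case 0
  then show ?case by simp
next
  case (Suc n)
  show ?case
  proof (cases "k = Suc n")
    case True
    have A: "tensO C n a \<in> Obj C" "tensA C n (\<lambda>i. Ide C (a i)) = Ide C (tensO C n a)"
      using Suc.prems by (auto intro!: tensO_obj tensA_ide)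
    have "tensO C (Suc n) (a(k := x)) = tenO C (tensO C n a) x" for x
      using True tensO_cong[of n "a(k := x)" a C] by simp
    moreover have "tensA C (Suc n) ((\<lambda>i. Ide C (a i))(k := u)) = tenA C (Ide C (tensO C n a)) u" for u
      using True A tensA_cong[of n "(\<lambda>i. Ide C (a i))(k := u)" "\<lambda>i. Ide C (a i)" C] by simp
    ultimately show ?thesis
      using cc A is_functor_ten_left[OF A(1)] by (simp only: cocontinuous_def)
  next
    case False
    have b: "a (Suc n) \<in> Obj C" using Suc.prems by simp
    have k: "k \<in> {1..n}" using Suc.prems False by auto
    have a: "\<And>i. i \<in> {1..n} \<Longrightarrow> a i \<in> Obj C" using Suc.prems by simp
    note IH = Suc.IH[OF a k]
    note IH1 = IH[THEN conjunct1] and IH2 = IH[THEN conjunct2]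
    have right: "preserves_colimits TYPE('i) C (\<lambda>y. tenO C y (a (Suc n))) (\<lambda>f. tenA C f (Ide C (a (Suc n))))"
      using cc b by (simp add: cocontinuous_def)
    show ?thesis
      using preserves_colimits_compose[OF IH1 IH2 right] False
        is_functor_compose[OF IH1 is_functor_ten_right[OF b]]
      by (simp add: o_def del: fun_upd_apply add: fun_upd_other)
  qed
qed

text \<open>Only the free factor varies here, so that colimits in it are preserved by
  cocontinuity, one factor at a time.\<close>

lemma slot_preserves_colimits:
  assumes "cocontinuous TYPE('i::infinite) C" "k \<in> {1..n}"
    and "\<And>i. i \<in> {1..n} - {k} \<Longrightarrow> f i \<in> Mor C"
  shows "preserves_colimits TYPE('i) C (slotO n f k I) (slotA n f k I I)"
proof -
  \<comment> \<open>The entry in position \<open>k\<close> will be overwritten; any object will do.\<close>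
  let ?a = "(zobj f I)(k := unitO C)"
  have "preserves_colimits TYPE('i) C (\<lambda>x. tensO C n (?a(k := x)))
      (\<lambda>u. tensA C n ((\<lambda>i. Ide C (?a i))(k := u)))"
    using assms unit_obj by (intro tens_slot_preserves_colimits[THEN conjunct2]) (auto simp: zobj_obj)
  moreover have "(\<lambda>x. tensO C n (?a(k := x))) = slotO n f k I"
    by (simp add: slotO_def fun_eq_iff)
  moreover have "tensA C n ((\<lambda>i. Ide C (?a i))(k := u)) = slotA n f k I I u" for u
    unfolding slotA_def by (rule tensA_cong) (simp add: zarr_refl)
  ultimately show ?thesis by simp
qed

end


section \<open>Splitting subsets along a block\<close>

text \<open>The decomposition inverse to \<open>set_comp\<close>: the part of a subset of \<open>[n + m - 1]\<close> that lies outside the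
  block \<open>k, \<dots>, k + m - 1\<close>, with its elements renumbered as elements of \<open>[n]\<close> other than \<open>k\<close>,
  and the part inside the block, renumbered as a subset of \<open>[m]\<close>.\<close>

definition outer :: "nat \<Rightarrow> nat \<Rightarrow> nat set \<Rightarrow> nat set" where
  "outer m k S = {i. i < k \<and> i \<in> S \<or> k < i \<and> i + m - 1 \<in> S}"

definition inner :: "nat \<Rightarrow> nat \<Rightarrow> nat set \<Rightarrow> nat set" where
  "inner m k S = {j \<in> {1..m}. j + k - 1 \<in> S}"

lemma outer_mono: "S \<subseteq> T \<Longrightarrow> outer m k S \<subseteq> outer m k T"
  by (auto simp: outer_def)

lemma inner_mono: "S \<subseteq> T \<Longrightarrow> inner m k S \<subseteq> inner m k T"
  by (auto simp: inner_def)

lemma inner_subset: "inner m k S \<subseteq> {1..m}"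
  by (auto simp: inner_def)

lemma outer_notin: "k \<notin> outer m k S"
  by (simp add: outer_def)

lemma mem_set_comp:
  assumes "1 \<le> k" "1 \<le> m" "J \<subseteq> {1..m}"
  shows "s \<in> set_comp m k I J \<longleftrightarrow>
    (if s < k then s \<in> I
     else if s < k + m then k \<in> I \<or> s + 1 - k \<in> J
     else s + 1 - m \<in> I)"
proof -
  have block: "s \<in> (\<lambda>j. j + k - 1) ` B \<longleftrightarrow> k \<le> s \<and> s + 1 - k \<in> B" if "B \<subseteq> {1..m}" for B
    using that assms(1) by (force simp: image_iff)
  have tail: "s \<in> (\<lambda>i. i + m - 1) ` {i \<in> I. k < i} \<longleftrightarrow> k + m \<le> s \<and> s + 1 - m \<in> I"
    using assms(1,2) by (force simp: image_iff)
  show ?thesis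
    unfolding set_comp_def using block[of "{1..m}"] block[of J] tail assms by auto
qed

lemma outer_set_comp:
  assumes "1 \<le> k" "1 \<le> m" "J \<subseteq> {1..m}"
  shows "outer m k (set_comp m k I J) = I - {k}"
  using assms by (auto simp: outer_def mem_set_comp)

lemma inner_set_comp:
  assumes "1 \<le> k" "1 \<le> m" "J \<subseteq> {1..m}"
  shows "inner m k (set_comp m k I J) = (if k \<in> I then {1..m} else J)"
  using assms by (auto simp: inner_def mem_set_comp subset_iff)

lemma set_comp_mono:
  assumes "1 \<le> k" "1 \<le> m" "J \<subseteq> J'" "J' \<subseteq> {1..m}" "I \<subseteq> I'"
  shows "set_comp m k I J \<subseteq> set_comp m k I' J'"
  using assms mem_set_comp[of k m J] mem_set_comp[of k m J'] by (auto split: if_splits)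

lemma set_comp_bound:
  assumes "k \<in> {1..n}" "1 \<le> m" "J \<subseteq> {1..m}" "I \<subseteq> {1..n}"
  shows "set_comp m k I J \<subseteq> {1..n + m - 1}"
  using assms by (auto simp: mem_set_comp subset_iff split: if_splits)

lemma set_comp_outer_inner:
  assumes "1 \<le> k" "1 \<le> m" "S \<subseteq> {1..n + m - 1}"
  shows "set_comp m k (outer m k S) (inner m k S) = S"
  using assms inner_subset[of m k S] by (auto simp: mem_set_comp outer_def inner_def subset_iff split: if_splits)

lemma outer_bound:
  assumes "k \<in> {1..n}" "1 \<le> m" "S \<subseteq> {1..n + m - 1}"
  shows "outer m k S \<subseteq> {1..n}"
  using assms by (auto simp: outer_def subset_iff)

lemma outer_all:
  assumes "k \<in> {1..n}" "1 \<le> m"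
  shows "outer m k {1..n + m - 1} = {1..n} - {k}" "inner m k {1..n + m - 1} = {1..m}"
  using assms by (auto simp: outer_def inner_def)

lemma scpx_subset: "K \<in> scpx n \<Longrightarrow> I \<in> K \<Longrightarrow> I \<subseteq> {1..n}"
  by (auto simp: scpx_def)

lemma scpx_down: "K \<in> scpx n \<Longrightarrow> I \<in> K \<Longrightarrow> J \<subseteq> I \<Longrightarrow> J \<in> K"
  by (auto simp: scpx_def)

lemma scpx_empty: "K \<in> scpx n \<Longrightarrow> {} \<in> K"
  by (auto simp: scpx_def)

text \<open>A face of the composite lies below some \<open>I \<circ>\<^sub>k J\<close>. If \<open>k \<in> I\<close> the whole block is
  available and \<open>J\<close> is immaterial; if \<open>k \<notin> I\<close> the inner part has to be a face of \<open>L\<close>. The two cases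
  overlap, so maps defined separately in each of them have to be compared.\<close>

lemma mem_scpx_comp:
  assumes "k \<in> {1..n}" "1 \<le> m" "K \<in> scpx n" "L \<in> scpx m"
  shows "S \<in> scpx_comp m k K L \<longleftrightarrow>
    S \<subseteq> {1..n + m - 1} \<and> (insert k (outer m k S) \<in> K \<or> outer m k S \<in> K \<and> inner m k S \<in> L)"
proof (intro iffI conjI; (elim conjE)?)
  have k: "1 \<le> k" using assms(1) by simp
  {
    assume "S \<in> scpx_comp m k K L"
    then obtain I J where I: "I \<in> K" "J \<in> L" "S \<subseteq> set_comp m k I J"
      by (auto simp: scpx_comp_def)
    have J: "J \<subseteq> {1..m}" and I': "I \<subseteq> {1..n}"
      using I scpx_subset assms(3,4) by blast+
    show "S \<subseteq> {1..n + m - 1}"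
      using I(3) set_comp_bound[OF assms(1,2) J I'] by blast
    have o: "outer m k S \<subseteq> I - {k}"
      using outer_mono[OF I(3), of m k] unfolding outer_set_comp[OF k assms(2) J] .
    have i: "inner m k S \<subseteq> (if k \<in> I then {1..m} else J)"
      using inner_mono[OF I(3), of m k] unfolding inner_set_comp[OF k assms(2) J] .
    show "insert k (outer m k S) \<in> K \<or> outer m k S \<in> K \<and> inner m k S \<in> L"
    proof (cases "k \<in> I")
      case True
      then have "insert k (outer m k S) \<subseteq> I" using o by auto
      then show ?thesis using scpx_down[OF assms(3) I(1)] by blast
    next
      case False
      then have "outer m k S \<subseteq> I" "inner m k S \<subseteq> J" using o i by auto
      then show ?thesis using scpx_down[OF assms(3) I(1)] scpx_down[OF assms(4) I(2)] by blast
    qed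
  }
  assume S: "S \<subseteq> {1..n + m - 1}"
    and cases: "insert k (outer m k S) \<in> K \<or> outer m k S \<in> K \<and> inner m k S \<in> L"
  note SS = set_comp_outer_inner[OF k assms(2) S]
  from cases show "S \<in> scpx_comp m k K L"
  proof
    assume K: "insert k (outer m k S) \<in> K"
    have "s \<in> set_comp m k (insert k (outer m k S)) {}" if "s \<in> S" for s
    proof -
      have "s \<in> set_comp m k (outer m k S) (inner m k S)" using that by (simp only: SS)
      then show ?thesis
        using mem_set_comp[OF k assms(2) inner_subset] mem_set_comp[OF k assms(2) empty_subsetI]
        by (auto split: if_splits)
    qed
    then show ?thesis
      using K scpx_empty[OF assms(4)] unfolding scpx_comp_def by blast
  next
    assume "outer m k S \<in> K \<and> inner m k S \<in> L"
    then show ?thesis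
      using SS unfolding scpx_comp_def by blast
  qed
qed


section \<open>Substituting a canonical arrow for one factor\<close>

text \<open>The tuple \<open>f\<close> of length \<open>n + m - 1\<close> consists of a block \<open>fb\<close> of length \<open>m\<close>, placed in
  positions \<open>k, \<dots>, k + m - 1\<close>, and of the entries of \<open>f'\<close> other than \<open>f' k\<close>. The entry \<open>f' k\<close>
  is left open: it is where an arrow built from the block is to be inserted.\<close>

locale block_substitution = strict_symmetric_monoidal_category C
  for C :: "('o, 'a, 'z) smc_struct_scheme" (structure) +
  fixes n m k :: nat and f fb f' :: "nat \<Rightarrow> 'a"
  assumes k: "k \<in> {1..n}" and m: "1 \<le> m"
    and f_mor: "\<And>i. i \<in> {1..n + m - 1} \<Longrightarrow> f i \<in> Mor C"
    and fb: "\<And>j. j \<in> {1..m} \<Longrightarrow> fb j = f (j + k - 1)"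
    and f'_low: "\<And>i. i \<in> {1..n} \<Longrightarrow> i < k \<Longrightarrow> f' i = f i"
    and f'_high: "\<And>i. i \<in> {1..n} \<Longrightarrow> k < i \<Longrightarrow> f' i = f (i + m - 1)"
begin

abbreviation "outr \<equiv> outer m k"
abbreviation "innr \<equiv> inner m k"
abbreviation "slO \<equiv> slotO n f' k"
abbreviation "slA \<equiv> slotA n f' k"

lemma fb_mor: "j \<in> {1..m} \<Longrightarrow> fb j \<in> Mor C"
  using k m by (auto simp: fb intro!: f_mor)

lemma f'_mor: "i \<in> {1..n} - {k} \<Longrightarrow> f' i \<in> Mor C"
  using k m f'_low[of i] f'_high[of i] by (cases "i < k") (auto intro!: f_mor)

lemma zO_block: "zO C (n + m - 1) f S = slO (outr S) (zO C m fb (innr S))"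
proof -
  have "tensO C (n + m - 1) (zobj f S) =
    tensO C n (\<lambda>i. if i < k then zobj f S i else if i = k then tensO C m (\<lambda>j. zobj f S (j + k - 1))
                   else zobj f S (i + m - 1))"
    by (intro tensO_graft k zobj_obj f_mor)
  also have "tensO C m (\<lambda>j. zobj f S (j + k - 1)) = zO C m fb (innr S)"
    unfolding zO_eq by (rule tensO_cong) (auto simp: zobj_def inner_def fb)
  finally show ?thesis
    unfolding zO_eq[of "n + m - 1"] slotO_def
    by (rule trans) (rule tensO_cong, auto simp: zobj_def outer_def f'_low f'_high)
qed

lemma zA_block:
  assumes "S \<subseteq> T"
  shows "zA C (n + m - 1) f (S, T) = slA (outr S) (outr T) (zA C m fb (innr S, innr T))"
proof -
  have "tensA C (n + m - 1) (zarr f S T) =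
    tensA C n (\<lambda>i. if i < k then zarr f S T i else if i = k then tensA C m (\<lambda>j. zarr f S T (j + k - 1))
                   else zarr f S T (i + m - 1))"
    by (intro tensA_graft k hom_mor[OF zarr_hom[OF f_mor assms]])
  also have "tensA C m (\<lambda>j. zarr f S T (j + k - 1)) = zA C m fb (innr S, innr T)"
    unfolding zA_eq by (rule tensA_cong) (auto simp: zarr_def inner_def fb)
  finally show ?thesis
    unfolding zA_eq[of "n + m - 1"] slotA_def
    by (rule trans) (rule tensA_cong, auto simp: zarr_def outer_def f'_low f'_high)
qed

lemma slA_hom: "I - {k} \<subseteq> J \<Longrightarrow> u \<in> hom x y \<Longrightarrow> slA I J u \<in> hom (slO I x) (slO J y)"
  by (rule slotA_hom) (auto intro: f'_mor)

lemma slA_cmp: "I - {k} \<subseteq> J \<Longrightarrow> J - {k} \<subseteq> H \<Longrightarrow> u \<in> hom x y \<Longrightarrow> v \<in> hom y z \<Longrightarrow>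
    slA J H v \<cdot> slA I J u = slA I H (v \<cdot> u)"
  by (rule slotA_cmp) (auto intro: f'_mor)

end


context category
begin

lemma cat_cocone_iff:
  "is_cocone (cat K) C Fo Fa c \<gamma> \<longleftrightarrow>
     c \<in> Obj C \<and> (\<forall>I\<in>K. \<gamma> I \<in> hom (Fo I) c) \<and>
     (\<forall>I\<in>K. \<forall>J\<in>K. I \<subseteq> J \<longrightarrow> \<gamma> J \<cdot> Fa (I, J) = \<gamma> I)"
  by (auto simp: is_cocone_def cat_simps)

lemma colimit_factor:
  assumes "is_colimit (cat K) C Fo Fa c \<gamma>" "is_cocone (cat K) C Fo Fa d \<delta>"
  obtains e where "e \<in> hom c d" "\<And>I. I \<in> K \<Longrightarrow> e \<cdot> \<gamma> I = \<delta> I"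
proof -
  from assms have "\<exists>!e. e \<in> hom c d \<and> (\<forall>I\<in>K. e \<cdot> \<gamma> I = \<delta> I)"
    by (simp add: is_colimit_def cat_simps)
  then show thesis using that by blast
qed

text \<open>The uniqueness half of the universal property, as a principle for proving arrows out of a
  colimit equal.\<close>

lemma colimit_hom_eq:
  assumes lim: "is_colimit (cat K) C Fo Fa c \<gamma>"
    and e: "e \<in> hom c d" and e': "e' \<in> hom c d" and Fa: "\<And>I J. I \<in> K \<Longrightarrow> J \<in> K \<Longrightarrow> I \<subseteq> J \<Longrightarrow>
      Fa (I, J) \<in> hom (Fo I) (Fo J)"
    and eq: "\<And>I. I \<in> K \<Longrightarrow> e \<cdot> \<gamma> I = e' \<cdot> \<gamma> I"
  shows "e = e'"
proof -
  have cone: "is_cocone (cat K) C Fo Fa c \<gamma>" using lim by (simp add: is_colimit_def)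
  have "is_cocone (cat K) C Fo Fa d (\<lambda>I. e \<cdot> \<gamma> I)"
    unfolding cat_cocone_iff
  proof (intro conjI ballI impI)
    show "d \<in> Obj C" using e hom_obj by blast
    fix I assume I: "I \<in> K"
    then have \<gamma>: "\<gamma> I \<in> hom (Fo I) c" using cone by (simp add: cat_cocone_iff)
    then show "e \<cdot> \<gamma> I \<in> hom (Fo I) d" using e cmp_hom by blast
    fix J assume J: "J \<in> K" "I \<subseteq> J"
    then have "\<gamma> J \<in> hom (Fo J) c" "\<gamma> J \<cdot> Fa (I, J) = \<gamma> I"
      using cone I by (simp_all add: cat_cocone_iff)
    then show "(e \<cdot> \<gamma> J) \<cdot> Fa (I, J) = e \<cdot> \<gamma> I"
      using cmp_assoc[OF Fa[OF I J], of "\<gamma> J" c e d] e by simp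
  qed
  then have "\<exists>!h. h \<in> hom c d \<and> (\<forall>I\<in>K. h \<cdot> \<gamma> I = e \<cdot> \<gamma> I)"
    using lim by (simp add: is_colimit_def cat_simps)
  then show ?thesis using e e' eq[symmetric] by blast
qed

end

lemma finite_cat: "K \<in> scpx n \<Longrightarrow> finite (Obj (cat K))" "K \<in> scpx n \<Longrightarrow> finite (Mor (cat K))"
proof -
  assume "K \<in> scpx n"
  then have K: "finite K"
    using finite_subset[of K "Pow {1..n}"] by (auto simp: scpx_def)
  then show "finite (Obj (cat K))" by (simp add: cat_simps)
  show "finite (Mor (cat K))"
    by (rule finite_subset[of _ "K \<times> K"]) (use K in \<open>auto simp: cat_simps\<close>)
qed

context block_substitution
begin

text \<open>A face \<open>S\<close> of the composite complex has an outer part \<open>I\<close> and an inner part \<open>J\<close>, and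
  \<open>z(S; f)\<close> is \<open>z(J; fb)\<close> placed between the outer factors selected by \<open>I\<close>. Either
  \<open>I \<union> {k}\<close> is a face of \<open>K\<close>, and \<open>z(S; f)\<close> maps to the colimit over \<open>K\<close> through the target of
  \<open>f' k\<close>; or \<open>I\<close> and \<open>J\<close> are faces, and it maps there through the source of \<open>f' k\<close>, which
  is the colimit over \<open>L\<close>. Where both apply, both maps agree because \<open>f' k\<close> is the canonical arrow.
  Conversely, a cocone on the composite complex restricts to the faces with inner part
  everything; and for a face \<open>I\<close> of \<open>K\<close> without \<open>k\<close> its values on all inner faces of \<open>L\<close>
  combine into one arrow, because the outer factors preserve the colimit over \<open>L\<close>.\<close>

lemma canonical_arrow_substitution:
  assumes cc: "cocontinuous TYPE('i::infinite) C"
    and K: "K \<in> scpx n" and L: "L \<in> scpx m"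
    and can_g: "canonical_arrow C m L fb (f' k)" and can_h: "canonical_arrow C n K f' h"
  shows "canonical_arrow C (n + m - 1) (scpx_comp m k K L) f h"
proof -
  define N where "N = n + m - 1"
  define M where "M = scpx_comp m k K L"
  define X where "X = zO C m fb {1..m}"
  define g where "g = f' k"
  define zm where "zm J = zA C m fb (J, {1..m})" for J
  let ?sc = "set_comp m k"
  have k1: "1 \<le> k" using k by simp
  obtain c \<gamma> where lim_c: "is_colimit (cat L) C (zO C m fb) (zA C m fb) c \<gamma>"
    and g: "g \<in> hom c X" and g_\<gamma>: "\<And>J. J \<in> L \<Longrightarrow> g \<cdot> \<gamma> J = zm J"
    using can_g unfolding canonical_arrow_def g_def X_def zm_def by blast
  obtain d \<delta> where lim_d: "is_colimit (cat K) C (zO C n f') (zA C n f') d \<delta>"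
    and h: "h \<in> hom d (zO C n f' {1..n})"
    and h_\<delta>: "\<And>I. I \<in> K \<Longrightarrow> h \<cdot> \<delta> I = zA C n f' (I, {1..n})"
    using can_h unfolding canonical_arrow_def by blast
  have c: "c \<in> Obj C" and X: "X \<in> Obj C" using g hom_obj by blast+
  have d: "d \<in> Obj C" using h hom_obj by blast
  have f'_all: "f' i \<in> Mor C" if "i \<in> {1..n}" for i
    using that f'_mor[of i] hom_mor[OF g] by (cases "i = k") (auto simp: g_def)
  note K_sub = scpx_subset[OF K] and L_sub = scpx_subset[OF L]
  note K_down = scpx_down[OF K] and L_down = scpx_down[OF L]

  have zm_hom: "zm J \<in> hom (zO C m fb J) X" if "J \<subseteq> {1..m}" for J
    unfolding zm_def X_def by (rule zA_hom) (use that fb_mor in auto)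
  have zm_all: "zm {1..m} = Ide C X"
    unfolding zm_def X_def by (rule zA_refl) (rule fb_mor)
  have zb_hom: "zA C m fb (J, J') \<in> hom (zO C m fb J) (zO C m fb J')" if "J \<subseteq> J'" for J J'
    by (rule zA_hom) (use that fb_mor in auto)
  have zm_zb: "zm J' \<cdot> zA C m fb (J, J') = zm J" if "J \<subseteq> J'" "J' \<subseteq> {1..m}" for J J'
    unfolding zm_def by (rule zA_cmp) (use that fb_mor in auto)
  have \<gamma>: "\<gamma> J \<in> hom (zO C m fb J) c" if "J \<in> L" for J
    using lim_c that by (simp add: is_colimit_def cat_cocone_iff)
  have \<gamma>_zb: "\<gamma> J' \<cdot> zA C m fb (J, J') = \<gamma> J" if "J \<in> L" "J' \<in> L" "J \<subseteq> J'" for J J'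
    using lim_c that by (simp add: is_colimit_def cat_cocone_iff)
  have zK: "zO C n f' I = slO I (if k \<in> I then X else c)" for I
    using g by (simp add: slotO_z[of n f' I k] zobj_def hom_dom hom_cod flip: g_def)
  have zKA: "zA C n f' (I, J) =
      slA I J (if k \<in> I then Ide C X else if k \<in> J then g else Ide C c)" for I J
    using g by (simp add: slotA_z[of n f' I J k] zarr_def hom_dom hom_cod flip: g_def)
  have \<delta>: "\<delta> I \<in> hom (slO I (if k \<in> I then X else c)) d" if "I \<in> K" for I
    using lim_d that by (simp add: is_colimit_def cat_cocone_iff flip: zK)
  have \<delta>1: "\<delta> I \<in> hom (slO I X) d" if "I \<in> K" "k \<in> I" for I
    using \<delta>[OF that(1)] that(2) by simp
  have \<delta>0: "\<delta> I \<in> hom (slO I c) d" if "I \<in> K" "k \<notin> I" for I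
    using \<delta>[OF that(1)] that(2) by simp
  have \<delta>_z: "\<delta> J \<cdot> zA C n f' (I, J) = \<delta> I" if "I \<in> K" "J \<in> K" "I \<subseteq> J" for I J
    using lim_d that by (simp add: is_colimit_def cat_cocone_iff)
  have zN: "zO C N f S = slO (outr S) (zO C m fb (innr S))" for S
    unfolding N_def by (rule zO_block)
  have zNA: "zA C N f (S, T) = slA (outr S) (outr T) (zA C m fb (innr S, innr T))" if "S \<subseteq> T" for S T
    unfolding N_def using that by (rule zA_block)
  have zN_hom: "zA C N f (S, T) \<in> hom (zO C N f S) (zO C N f T)" if "S \<subseteq> T" for S T
    using that by (intro zA_hom) (auto simp: N_def intro!: f_mor)
  have insert_k: "slO (insert k I) x = slO I x" "slA (insert k I) J u = slA I J u"
      "slA I (insert k J) u = slA I J u" for I J x u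
    by (auto intro: slotO_cong slotA_cong)
  have minus_k: "slO (I - {k}) x = slO I x" "slA (I - {k}) J u = slA I J u"
      "slA I (J - {k}) u = slA I J u" for I J x u
    by (auto intro: slotO_cong slotA_cong)

  have M: "S \<in> M \<longleftrightarrow> S \<subseteq> {1..N} \<and> (insert k (outr S) \<in> K \<or> outr S \<in> K \<and> innr S \<in> L)" for S
    unfolding M_def N_def by (rule mem_scpx_comp[OF k m K L])
  have M_comp: "?sc I J \<in> M" if "I \<in> K" "J \<in> L" for I J
    using that by (auto simp: M_def scpx_comp_def)
  have o_sc: "outr (?sc I J) = I - {k}" and i_sc: "innr (?sc I J) = (if k \<in> I then {1..m} else J)"
    if "J \<in> L" for I J
    using outer_set_comp[OF k1 m L_sub[OF that]] inner_set_comp[OF k1 m L_sub[OF that]] by auto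
  have sc_mono: "?sc I J \<subseteq> ?sc I' J" if "J \<in> L" "I \<subseteq> I'" for I I' J
    using set_comp_mono[OF k1 m order_refl L_sub[OF that(1)] that(2)] .
  have sc_id: "?sc (outr S) (innr S) = S" if "S \<in> M" for S
    using that set_comp_outer_inner[OF k1 m, of S n] by (simp add: M N_def)
  have E: "{} \<in> L" by (rule scpx_empty[OF L])
  have sc_top: "S \<subseteq> ?sc (insert k (outr S)) {}" if "S \<in> M" for S
  proof
    fix s assume "s \<in> S"
    then have "s \<in> ?sc (outr S) (innr S)" using sc_id[OF that] by simp
    then show "s \<in> ?sc (insert k (outr S)) {}"
      using mem_set_comp[OF k1 m inner_subset] mem_set_comp[OF k1 m empty_subsetI]
      by (auto split: if_splits)
  qed

  define \<epsilon> where "\<epsilon> S = (if insert k (outr S) \<in> K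
      then \<delta> (insert k (outr S)) \<cdot> slA (outr S) (outr S) (zm (innr S))
      else \<delta> (outr S) \<cdot> slA (outr S) (outr S) (\<gamma> (innr S)))" for S
  have \<epsilon>1: "\<epsilon> S = \<delta> (insert k (outr S)) \<cdot> slA (outr S) (outr S) (zm (innr S))"
    if "insert k (outr S) \<in> K" for S
    using that by (simp add: \<epsilon>_def)
  \<comment> \<open>In the overlap of the two cases both formulas agree, because \<open>g \<cdot> \<gamma> J\<close> is the map from
    \<open>z(J)\<close> to \<open>X\<close>.\<close>
  have \<epsilon>0: "\<epsilon> S = \<delta> (outr S) \<cdot> slA (outr S) (outr S) (\<gamma> (innr S))"
    if "outr S \<in> K" "innr S \<in> L" for S
  proof (cases "insert k (outr S) \<in> K")
    case True
    let ?I = "outr S"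
    have \<gamma>S: "slA ?I ?I (\<gamma> (innr S)) \<in> hom (slO ?I (zO C m fb (innr S))) (slO ?I c)"
      by (rule slA_hom[OF _ \<gamma>[OF that(2)]]) auto
    have gS: "slA ?I ?I g \<in> hom (slO ?I c) (slO ?I X)"
      by (rule slA_hom[OF _ g]) auto
    have \<delta>S: "\<delta> (insert k ?I) \<in> hom (slO ?I X) d"
      using \<delta>1[OF True] by (simp add: insert_k)
    have "\<delta> ?I = \<delta> (insert k ?I) \<cdot> slA ?I ?I g"
      using \<delta>_z[OF that(1) True subset_insertI] by (simp add: zKA outer_notin insert_k)
    then have "\<delta> ?I \<cdot> slA ?I ?I (\<gamma> (innr S)) = (\<delta> (insert k ?I) \<cdot> slA ?I ?I g) \<cdot> slA ?I ?I (\<gamma> (innr S))"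
      by simp
    also have "\<dots> = \<delta> (insert k ?I) \<cdot> (slA ?I ?I g \<cdot> slA ?I ?I (\<gamma> (innr S)))"
      by (rule cmp_assoc[OF \<gamma>S gS \<delta>S, symmetric])
    also have "slA ?I ?I g \<cdot> slA ?I ?I (\<gamma> (innr S)) = slA ?I ?I (g \<cdot> \<gamma> (innr S))"
      by (rule slA_cmp[OF _ _ \<gamma>[OF that(2)] g]) auto
    finally show ?thesis
      using that(2) by (simp add: \<epsilon>1[OF True] g_\<gamma>)
  next
    case False
    then show ?thesis by (simp add: \<epsilon>_def)
  qed
  have \<epsilon>: "\<epsilon> S \<in> hom (zO C N f S) d" if "S \<in> M" for S
  proof (cases "insert k (outr S) \<in> K")
    case True
    have "slA (outr S) (outr S) (zm (innr S)) \<in> hom (zO C N f S) (slO (outr S) X)"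
      unfolding zN by (rule slA_hom) (auto intro: zm_hom inner_subset[THEN subsetD])
    then show ?thesis
      unfolding \<epsilon>1[OF True] using \<delta>1[OF True] by (auto simp: insert_k intro: cmp_hom)
  next
    case False
    with that have S: "outr S \<in> K" "innr S \<in> L" by (auto simp: M)
    have "slA (outr S) (outr S) (\<gamma> (innr S)) \<in> hom (zO C N f S) (slO (outr S) c)"
      unfolding zN by (rule slA_hom[OF _ \<gamma>[OF S(2)]]) auto
    then show ?thesis
      unfolding \<epsilon>0[OF S] using \<delta>0[OF S(1) outer_notin] by (rule cmp_hom)
  qed
  have \<epsilon>_z: "\<epsilon> T \<cdot> zA C N f (S, T) = \<epsilon> S" if S: "S \<in> M" and T: "T \<in> M" and ST: "S \<subseteq> T" for S T
  proof -
    let ?I = "outr S" and ?I' = "outr T" and ?J = "innr S" and ?J' = "innr T"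
    have I: "?I \<subseteq> ?I'" and J: "?J \<subseteq> ?J'" using ST by (simp_all add: outer_mono inner_mono)
    have I_k: "?I - {k} \<subseteq> ?I'" using I by auto
    note zST = zNA[OF ST]
    have ST_hom: "zA C N f (S, T) \<in> hom (slO ?I (zO C m fb ?J)) (slO ?I' (zO C m fb ?J'))"
      unfolding zST by (rule slA_hom[OF I_k zb_hom[OF J]])
    show ?thesis
    proof (cases "insert k ?I' \<in> K")
      case True
      have S1: "insert k ?I \<in> K"
        by (rule K_down[OF True]) (use I in auto)
      have zmT: "slA ?I' ?I' (zm ?J') \<in> hom (slO ?I' (zO C m fb ?J')) (slO ?I' X)"
        by (rule slA_hom[OF _ zm_hom[OF inner_subset]]) auto
      have \<delta>T: "\<delta> (insert k ?I') \<in> hom (slO ?I' X) d"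
        using \<delta>1[OF True] by (simp add: insert_k)
      have zmS: "slA ?I ?I (zm ?J) \<in> hom (slO ?I (zO C m fb ?J)) (slO ?I X)"
        by (rule slA_hom[OF _ zm_hom[OF inner_subset]]) auto
      have idST: "slA ?I ?I' (Ide C X) \<in> hom (slO ?I X) (slO ?I' X)"
        by (rule slA_hom[OF I_k ide_hom[OF X]])
      have "\<epsilon> T \<cdot> zA C N f (S, T) = \<delta> (insert k ?I') \<cdot> (slA ?I' ?I' (zm ?J') \<cdot> zA C N f (S, T))"
        unfolding \<epsilon>1[OF True] by (rule cmp_assoc[OF ST_hom zmT \<delta>T, symmetric])
      also have "slA ?I' ?I' (zm ?J') \<cdot> zA C N f (S, T) = slA ?I ?I' (zm ?J' \<cdot> zA C m fb (?J, ?J'))"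
        unfolding zST by (rule slA_cmp[OF I_k _ zb_hom[OF J] zm_hom[OF inner_subset]]) auto
      also have "zm ?J' \<cdot> zA C m fb (?J, ?J') = Ide C X \<cdot> zm ?J"
        using zm_zb[OF J inner_subset] ide_cmp[OF zm_hom[OF inner_subset]] by simp
      also have "slA ?I ?I' (Ide C X \<cdot> zm ?J) = slA ?I ?I' (Ide C X) \<cdot> slA ?I ?I (zm ?J)"
        by (rule slA_cmp[symmetric, OF _ I_k zm_hom[OF inner_subset] ide_hom[OF X]]) auto
      also have "\<delta> (insert k ?I') \<cdot> (slA ?I ?I' (Ide C X) \<cdot> slA ?I ?I (zm ?J)) =
          (\<delta> (insert k ?I') \<cdot> slA ?I ?I' (Ide C X)) \<cdot> slA ?I ?I (zm ?J)"
        by (rule cmp_assoc[OF zmS idST \<delta>T])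
      also have "\<delta> (insert k ?I') \<cdot> slA ?I ?I' (Ide C X) = \<delta> (insert k ?I)"
        using \<delta>_z[OF S1 True] I by (auto simp: zKA insert_k)
      finally show ?thesis by (simp add: \<epsilon>1[OF S1])
    next
      case False
      with T have T0: "?I' \<in> K" "?J' \<in> L" by (auto simp: M)
      have S0: "?I \<in> K" "?J \<in> L" using T0 K_down L_down I J by blast+
      have \<gamma>T: "slA ?I' ?I' (\<gamma> ?J') \<in> hom (slO ?I' (zO C m fb ?J')) (slO ?I' c)"
        by (rule slA_hom[OF _ \<gamma>[OF T0(2)]]) auto
      have \<delta>T: "\<delta> ?I' \<in> hom (slO ?I' c) d"
        by (rule \<delta>0[OF T0(1) outer_notin])
      have \<gamma>S: "slA ?I ?I (\<gamma> ?J) \<in> hom (slO ?I (zO C m fb ?J)) (slO ?I c)"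
        by (rule slA_hom[OF _ \<gamma>[OF S0(2)]]) auto
      have idST: "slA ?I ?I' (Ide C c) \<in> hom (slO ?I c) (slO ?I' c)"
        by (rule slA_hom[OF I_k ide_hom[OF c]])
      have "\<epsilon> T \<cdot> zA C N f (S, T) = \<delta> ?I' \<cdot> (slA ?I' ?I' (\<gamma> ?J') \<cdot> zA C N f (S, T))"
        unfolding \<epsilon>0[OF T0] by (rule cmp_assoc[OF ST_hom \<gamma>T \<delta>T, symmetric])
      also have "slA ?I' ?I' (\<gamma> ?J') \<cdot> zA C N f (S, T) = slA ?I ?I' (\<gamma> ?J' \<cdot> zA C m fb (?J, ?J'))"
        unfolding zST by (rule slA_cmp[OF I_k _ zb_hom[OF J] \<gamma>[OF T0(2)]]) auto
      also have "\<gamma> ?J' \<cdot> zA C m fb (?J, ?J') = Ide C c \<cdot> \<gamma> ?J"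
        using \<gamma>_zb[OF S0(2) T0(2) J] ide_cmp[OF \<gamma>[OF S0(2)]] by simp
      also have "slA ?I ?I' (Ide C c \<cdot> \<gamma> ?J) = slA ?I ?I' (Ide C c) \<cdot> slA ?I ?I (\<gamma> ?J)"
        by (rule slA_cmp[symmetric, OF _ I_k \<gamma>[OF S0(2)] ide_hom[OF c]]) auto
      also have "\<delta> ?I' \<cdot> (slA ?I ?I' (Ide C c) \<cdot> slA ?I ?I (\<gamma> ?J)) =
          (\<delta> ?I' \<cdot> slA ?I ?I' (Ide C c)) \<cdot> slA ?I ?I (\<gamma> ?J)"
        by (rule cmp_assoc[OF \<gamma>S idST \<delta>T])
      also have "\<delta> ?I' \<cdot> slA ?I ?I' (Ide C c) = \<delta> ?I"
        using \<delta>_z[OF S0(1) T0(1) I] by (simp add: zKA outer_notin)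
      finally show ?thesis by (simp add: \<epsilon>0[OF S0])
    qed
  qed
  have \<epsilon>_cocone: "is_cocone (cat M) C (zO C N f) (zA C N f) d \<epsilon>"
    unfolding cat_cocone_iff using d \<epsilon> \<epsilon>_z by simp

  \<comment> \<open>The next two facts recover \<open>\<delta>\<close> from \<open>\<epsilon>\<close>, in the case \<open>k \<notin> I\<close> after restriction along a
    colimit cocone; they give uniqueness of the induced arrow.\<close>
  have \<epsilon>_full: "\<epsilon> (?sc I {}) = \<delta> I" if "I \<in> K" "k \<in> I" for I
  proof -
    have "slA I I (Ide C X) = Ide C (zO C n f' I)"
      using zA_refl[of n f' I] f'_all that(2) by (simp add: zKA)
    moreover have o: "insert k (outr (?sc I {})) = I" using that(2) o_sc[OF E, of I] by auto
    moreover have "zm (innr (?sc I {})) = Ide C X" using that(2) i_sc[OF E, of I] zm_all by simp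
    moreover have "slA (outr (?sc I {})) (outr (?sc I {})) u = slA I I u" for u
      by (simp only: o_sc[OF E] minus_k)
    moreover have "\<delta> I \<cdot> Ide C (zO C n f' I) = \<delta> I"
      by (rule cmp_ide) (use \<delta>[OF that(1)] in \<open>simp add: zK\<close>)
    ultimately show ?thesis
      using \<epsilon>1[of "?sc I {}"] that(1) by simp
  qed
  have \<epsilon>_part: "\<epsilon> (?sc I J) = \<delta> I \<cdot> slA I I (\<gamma> J)" if "I \<in> K" "k \<notin> I" "J \<in> L" for I J
    using \<epsilon>0[of "?sc I J"] that by (simp add: o_sc i_sc)

  \<comment> \<open>This is where cocontinuity enters.\<close>
  have lim_sl: "is_colimit (cat L) C (slO I \<circ> zO C m fb) (slA I I \<circ> zA C m fb) (slO I c) (slA I I \<circ> \<gamma>)" for I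
  proof (rule preserves_colimits_finite_shape[OF _ category_cat finite_cat(1)[OF L] finite_cat(2)[OF L] _ lim_c])
    show "preserves_colimits TYPE('i) C (slO I) (slA I I)"
      by (rule slot_preserves_colimits[OF cc k]) (rule f'_mor)
    show "is_functor (cat L) C (zO C m fb) (zA C m fb)"
      by (rule is_functor_z) (rule fb_mor)
  qed
  have sl_eq: "e = e'"
    if "e \<in> hom (slO I c) t" "e' \<in> hom (slO I c) t"
      "\<And>J. J \<in> L \<Longrightarrow> e \<cdot> slA I I (\<gamma> J) = e' \<cdot> slA I I (\<gamma> J)" for e e' I t
  proof (rule colimit_hom_eq[OF lim_sl that(1,2)])
    fix J J' assume "J \<in> L" "J' \<in> L" "J \<subseteq> J'"
    then show "(slA I I \<circ> zA C m fb) (J, J') \<in> hom ((slO I \<circ> zO C m fb) J) ((slO I \<circ> zO C m fb) J')"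
      by (auto intro: slA_hom zb_hom)
  qed (use that(3) in simp)

  have univ: "\<exists>!e. e \<in> hom d t \<and> (\<forall>S\<in>M. e \<cdot> \<epsilon> S = \<tau> S)"
    if \<tau>_cocone: "is_cocone (cat M) C (zO C N f) (zA C N f) t \<tau>" for t \<tau>
  proof -
    have t: "t \<in> Obj C" and \<tau>: "\<And>S. S \<in> M \<Longrightarrow> \<tau> S \<in> hom (zO C N f S) t"
      and \<tau>_z: "\<And>S T. S \<in> M \<Longrightarrow> T \<in> M \<Longrightarrow> S \<subseteq> T \<Longrightarrow> \<tau> T \<cdot> zA C N f (S, T) = \<tau> S"
      using \<tau>_cocone by (auto simp: cat_cocone_iff)
    have \<tau>1: "\<tau> (?sc I {}) \<in> hom (slO I X) t" if "I \<in> K" "k \<in> I" for I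
      using \<tau>[OF M_comp[OF that(1) E]] that by (simp add: zN o_sc[OF E] i_sc[OF E] minus_k X_def)
    have \<tau>0: "\<tau> (?sc I J) \<in> hom (slO I (zO C m fb J)) t" if "I \<in> K" "k \<notin> I" "J \<in> L" for I J
      using \<tau>[OF M_comp[OF that(1,3)]] that by (simp add: zN o_sc i_sc)
    \<comment> \<open>For a face without \<open>k\<close>, glue the values on the inner faces.\<close>
    have "\<exists>e. e \<in> hom (slO I c) t \<and> (\<forall>J\<in>L. e \<cdot> slA I I (\<gamma> J) = \<tau> (?sc I J))"
      if I: "I \<in> K" "k \<notin> I" for I
    proof -
      have "is_cocone (cat L) C (slO I \<circ> zO C m fb) (slA I I \<circ> zA C m fb) t (\<lambda>J. \<tau> (?sc I J))"
        unfolding cat_cocone_iff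
      proof (intro conjI ballI impI)
        fix J J' assume J: "J \<in> L" "J' \<in> L" "J \<subseteq> J'"
        have sub: "?sc I J \<subseteq> ?sc I J'"
          by (rule set_comp_mono[OF k1 m J(3) L_sub[OF J(2)] order_refl])
        show "\<tau> (?sc I J') \<cdot> (slA I I \<circ> zA C m fb) (J, J') = \<tau> (?sc I J)"
          using \<tau>_z[OF M_comp[OF I(1) J(1)] M_comp[OF I(1) J(2)] sub] I(2)
          by (simp add: zNA[OF sub] o_sc[OF J(1)] o_sc[OF J(2)] i_sc[OF J(1)] i_sc[OF J(2)])
      qed (use t \<tau>0[OF I] in auto)
      then show ?thesis
        by (rule colimit_factor[OF lim_sl]) auto
    qed
    then obtain \<eta> where \<eta>: "\<And>I. I \<in> K \<Longrightarrow> k \<notin> I \<Longrightarrow> \<eta> I \<in> hom (slO I c) t"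
      and \<eta>_\<gamma>: "\<And>I J. I \<in> K \<Longrightarrow> k \<notin> I \<Longrightarrow> J \<in> L \<Longrightarrow> \<eta> I \<cdot> slA I I (\<gamma> J) = \<tau> (?sc I J)"
      by metis
    define \<kappa> where "\<kappa> I = (if k \<in> I then \<tau> (?sc I {}) else \<eta> I)" for I
    have \<kappa>_z: "\<kappa> I' \<cdot> zA C n f' (I, I') = \<kappa> I" if I: "I \<in> K" "I' \<in> K" "I \<subseteq> I'" for I I'
    proof -
      have Ik: "I - {k} \<subseteq> I'" using I(3) by auto
      consider "k \<in> I" | "k \<notin> I" "k \<in> I'" | "k \<notin> I'" using I(3) by auto
      then show ?thesis
      proof cases
        case 1
        then have k': "k \<in> I'" using I(3) by auto
        show ?thesis
          using \<tau>_z[OF M_comp[OF I(1) E] M_comp[OF I(2) E] sc_mono[OF E I(3)]] 1 k' zm_all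
          by (simp add: \<kappa>_def zKA zNA[OF sc_mono[OF E I(3)]] o_sc[OF E] i_sc[OF E] minus_k zm_def)
      next
        case 2
        have gI: "slA I I' g \<in> hom (slO I c) (slO I' X)" by (rule slA_hom[OF Ik g])
        have "\<tau> (?sc I' {}) \<cdot> slA I I' g = \<eta> I"
        proof (rule sl_eq)
          show "\<tau> (?sc I' {}) \<cdot> slA I I' g \<in> hom (slO I c) t"
            by (rule cmp_hom[OF gI \<tau>1[OF I(2) 2(2)]])
          show "\<eta> I \<in> hom (slO I c) t" by (rule \<eta>[OF I(1) 2(1)])
          fix J assume J: "J \<in> L"
          have \<gamma>J: "slA I I (\<gamma> J) \<in> hom (slO I (zO C m fb J)) (slO I c)"
            by (rule slA_hom[OF _ \<gamma>[OF J]]) auto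
          have sub: "?sc I J \<subseteq> ?sc I' {}"
          proof
            fix s assume "s \<in> ?sc I J"
            then show "s \<in> ?sc I' {}"
              using I(3) 2 mem_set_comp[OF k1 m L_sub[OF J], of s I]
                mem_set_comp[OF k1 m empty_subsetI, of s I']
              by (auto split: if_splits)
          qed
          have "(\<tau> (?sc I' {}) \<cdot> slA I I' g) \<cdot> slA I I (\<gamma> J) =
              \<tau> (?sc I' {}) \<cdot> (slA I I' g \<cdot> slA I I (\<gamma> J))"
            by (rule cmp_assoc[OF \<gamma>J gI \<tau>1[OF I(2) 2(2)], symmetric])
          also have "slA I I' g \<cdot> slA I I (\<gamma> J) = slA I I' (zm J)"
            using slA_cmp[OF _ Ik \<gamma>[OF J] g, of I] g_\<gamma>[OF J] by auto
          also have "\<tau> (?sc I' {}) \<cdot> slA I I' (zm J) = \<tau> (?sc I J)"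
            using \<tau>_z[OF M_comp[OF I(1) J] M_comp[OF I(2) E] sub] 2
            by (simp add: zNA[OF sub] o_sc[OF E] o_sc[OF J] i_sc[OF E] i_sc[OF J] minus_k zm_def)
          finally show "(\<tau> (?sc I' {}) \<cdot> slA I I' g) \<cdot> slA I I (\<gamma> J) = \<eta> I \<cdot> slA I I (\<gamma> J)"
            using \<eta>_\<gamma>[OF I(1) 2(1) J] by simp
        qed
        then show ?thesis using 2 by (simp add: \<kappa>_def zKA)
      next
        case 3
        then have k0: "k \<notin> I" using I(3) by auto
        have idI: "slA I I' (Ide C c) \<in> hom (slO I c) (slO I' c)"
          by (rule slA_hom[OF Ik ide_hom[OF c]])
        have "\<eta> I' \<cdot> slA I I' (Ide C c) = \<eta> I"
        proof (rule sl_eq)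
          show "\<eta> I' \<cdot> slA I I' (Ide C c) \<in> hom (slO I c) t"
            by (rule cmp_hom[OF idI \<eta>[OF I(2) 3]])
          show "\<eta> I \<in> hom (slO I c) t" by (rule \<eta>[OF I(1) k0])
          fix J assume J: "J \<in> L"
          note sub = sc_mono[OF J I(3)]
          let ?z = "zO C m fb J"
          have \<gamma>J: "slA I I (\<gamma> J) \<in> hom (slO I ?z) (slO I c)"
            by (rule slA_hom[OF _ \<gamma>[OF J]]) auto
          have \<gamma>J': "slA I' I' (\<gamma> J) \<in> hom (slO I' ?z) (slO I' c)"
            by (rule slA_hom[OF _ \<gamma>[OF J]]) auto
          have z: "?z \<in> Obj C" using \<gamma>[OF J] hom_obj by blast
          have idz: "slA I I' (Ide C ?z) \<in> hom (slO I ?z) (slO I' ?z)"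
            by (rule slA_hom[OF Ik ide_hom[OF z]])
          have "(\<eta> I' \<cdot> slA I I' (Ide C c)) \<cdot> slA I I (\<gamma> J) = \<eta> I' \<cdot> (slA I I' (Ide C c) \<cdot> slA I I (\<gamma> J))"
            by (rule cmp_assoc[OF \<gamma>J idI \<eta>[OF I(2) 3], symmetric])
          also have "slA I I' (Ide C c) \<cdot> slA I I (\<gamma> J) = slA I I' (Ide C c \<cdot> \<gamma> J)"
            by (rule slA_cmp[OF _ Ik \<gamma>[OF J] ide_hom[OF c]]) auto
          also have "Ide C c \<cdot> \<gamma> J = \<gamma> J \<cdot> Ide C ?z"
            using ide_cmp[OF \<gamma>[OF J]] cmp_ide[OF \<gamma>[OF J]] by simp
          also have "slA I I' (\<gamma> J \<cdot> Ide C ?z) = slA I' I' (\<gamma> J) \<cdot> slA I I' (Ide C ?z)"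
            by (rule slA_cmp[symmetric, OF Ik _ ide_hom[OF z] \<gamma>[OF J]]) auto
          also have "\<eta> I' \<cdot> (slA I' I' (\<gamma> J) \<cdot> slA I I' (Ide C ?z)) =
              (\<eta> I' \<cdot> slA I' I' (\<gamma> J)) \<cdot> slA I I' (Ide C ?z)"
            by (rule cmp_assoc[OF idz \<gamma>J' \<eta>[OF I(2) 3]])
          also have "\<dots> = \<tau> (?sc I' J) \<cdot> slA I I' (Ide C ?z)"
            using \<eta>_\<gamma>[OF I(2) 3 J] by simp
          also have "\<dots> = \<tau> (?sc I J)"
            using \<tau>_z[OF M_comp[OF I(1) J] M_comp[OF I(2) J] sub] 3 k0
              zA_refl[of m fb J] fb_mor
            by (simp add: zNA[OF sub] o_sc[OF J] i_sc[OF J])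
          finally show "(\<eta> I' \<cdot> slA I I' (Ide C c)) \<cdot> slA I I (\<gamma> J) = \<eta> I \<cdot> slA I I (\<gamma> J)"
            using \<eta>_\<gamma>[OF I(1) k0 J] by simp
        qed
        then show ?thesis using 3 k0 by (simp add: \<kappa>_def zKA)
      qed
    qed
    have \<kappa>: "\<kappa> I \<in> hom (zO C n f' I) t" if "I \<in> K" for I
      using that \<tau>1 \<eta> by (simp add: \<kappa>_def zK)
    have \<kappa>_cocone: "is_cocone (cat K) C (zO C n f') (zA C n f') t \<kappa>"
      unfolding cat_cocone_iff using t \<kappa> \<kappa>_z by simp
    obtain e where e: "e \<in> hom d t" and e_\<delta>: "\<And>I. I \<in> K \<Longrightarrow> e \<cdot> \<delta> I = \<kappa> I"
      using colimit_factor[OF lim_d \<kappa>_cocone] by blast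
    have e_\<epsilon>: "e \<cdot> \<epsilon> S = \<tau> S" if S: "S \<in> M" for S
    proof (cases "insert k (outr S) \<in> K")
      case True
      let ?I = "insert k (outr S)"
      note sub = sc_top[OF S]
      have o: "insert k (outr S) - {k} = outr S" using outer_notin by auto
      have zS: "slA (outr S) (outr S) (zm (innr S)) \<in> hom (zO C N f S) (slO ?I X)"
        unfolding zN insert_k by (rule slA_hom[OF _ zm_hom[OF inner_subset]]) auto
      have "e \<cdot> \<epsilon> S = (e \<cdot> \<delta> ?I) \<cdot> slA (outr S) (outr S) (zm (innr S))"
        unfolding \<epsilon>1[OF True] by (rule cmp_assoc[OF zS \<delta>1[OF True insertI1] e])
      also have "\<dots> = \<tau> (?sc ?I {}) \<cdot> slA (outr S) (outr S) (zm (innr S))"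
        by (simp add: e_\<delta>[OF True] \<kappa>_def)
      also have "\<dots> = \<tau> S"
        using \<tau>_z[OF S M_comp[OF True E] sub]
        by (simp add: zNA[OF sub] o_sc[OF E] i_sc[OF E] o zm_def)
      finally show ?thesis .
    next
      case False
      with S have S0: "outr S \<in> K" "innr S \<in> L" by (auto simp: M)
      have \<gamma>S: "slA (outr S) (outr S) (\<gamma> (innr S)) \<in> hom (zO C N f S) (slO (outr S) c)"
        unfolding zN by (rule slA_hom[OF _ \<gamma>[OF S0(2)]]) auto
      have "e \<cdot> \<epsilon> S = (e \<cdot> \<delta> (outr S)) \<cdot> slA (outr S) (outr S) (\<gamma> (innr S))"
        unfolding \<epsilon>0[OF S0] by (rule cmp_assoc[OF \<gamma>S \<delta>0[OF S0(1) outer_notin] e])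
      then show ?thesis
        by (simp add: e_\<delta>[OF S0(1)] \<kappa>_def outer_notin \<eta>_\<gamma> S0 sc_id[OF S])
    qed
    show ?thesis
    proof (rule ex1I[of _ e])
      show "e \<in> hom d t \<and> (\<forall>S\<in>M. e \<cdot> \<epsilon> S = \<tau> S)" using e e_\<epsilon> by simp
      fix e' assume e': "e' \<in> hom d t \<and> (\<forall>S\<in>M. e' \<cdot> \<epsilon> S = \<tau> S)"
      show "e' = e"
      proof (rule colimit_hom_eq[OF lim_d conjunct1[OF e'] e])
        show "zA C n f' (I, J) \<in> hom (zO C n f' I) (zO C n f' J)" if "I \<subseteq> J" for I J
          by (rule zA_hom) (use that f'_all in auto)
        fix I assume I: "I \<in> K"
        have "e' \<cdot> \<delta> I = \<kappa> I"
        proof (cases "k \<in> I")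
          case True
          then show ?thesis
            using e' M_comp[OF I E] \<epsilon>_full[OF I True] by (auto simp: \<kappa>_def)
        next
          case False
          have "e' \<cdot> \<delta> I = \<eta> I"
          proof (rule sl_eq)
            show "e' \<cdot> \<delta> I \<in> hom (slO I c) t"
              using cmp_hom[OF \<delta>0[OF I False]] e' by blast
            show "\<eta> I \<in> hom (slO I c) t" by (rule \<eta>[OF I False])
            fix J assume J: "J \<in> L"
            have \<gamma>J: "slA I I (\<gamma> J) \<in> hom (slO I (zO C m fb J)) (slO I c)"
              by (rule slA_hom[OF _ \<gamma>[OF J]]) auto
            have "(e' \<cdot> \<delta> I) \<cdot> slA I I (\<gamma> J) = e' \<cdot> \<epsilon> (?sc I J)"
              unfolding \<epsilon>_part[OF I False J]
              using cmp_assoc[OF \<gamma>J \<delta>0[OF I False] conjunct1[OF e']] by simp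
            also have "\<dots> = \<eta> I \<cdot> slA I I (\<gamma> J)"
              using e' M_comp[OF I J] \<eta>_\<gamma>[OF I False J] by simp
            finally show "(e' \<cdot> \<delta> I) \<cdot> slA I I (\<gamma> J) = \<eta> I \<cdot> slA I I (\<gamma> J)" .
          qed
          then show ?thesis using False by (simp add: \<kappa>_def)
        qed
        then show "e' \<cdot> \<delta> I = e \<cdot> \<delta> I" by (simp add: e_\<delta>[OF I])
      qed
    qed
  qed
  have lim: "is_colimit (cat M) C (zO C N f) (zA C N f) d \<epsilon>"
    unfolding is_colimit_def cat_simps(1) using \<epsilon>_cocone univ by blast

  have oN: "outr {1..N} = {1..n} - {k}" and iN: "innr {1..N} = {1..m}"
    unfolding N_def by (rule outer_all[OF k m])+
  have target: "zO C N f {1..N} = zO C n f' {1..n}"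
    unfolding zN oN iN zK using k by (simp add: minus_k X_def)
  have "h \<cdot> \<epsilon> S = zA C N f (S, {1..N})" if S: "S \<in> M" for S
  proof -
    let ?I = "outr S" and ?J = "innr S"
    have sub: "S \<subseteq> {1..N}" using S by (simp add: M)
    have In: "?I \<subseteq> {1..n}" using outer_bound[OF k m, of S] sub by (simp add: N_def)
    then have Ik: "?I - {k} \<subseteq> {1..n}" by auto
    have zS: "zA C N f (S, {1..N}) = slA ?I {1..n} (zm ?J)"
      unfolding zNA[OF sub] oN iN zm_def by (rule minus_k(3))
    show ?thesis
    proof (cases "insert k ?I \<in> K")
      case True
      have zmS: "slA ?I ?I (zm ?J) \<in> hom (slO ?I (zO C m fb ?J)) (slO (insert k ?I) X)"
        unfolding insert_k by (rule slA_hom[OF _ zm_hom[OF inner_subset]]) auto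
      have "h \<cdot> \<epsilon> S = (h \<cdot> \<delta> (insert k ?I)) \<cdot> slA ?I ?I (zm ?J)"
        unfolding \<epsilon>1[OF True] by (rule cmp_assoc[OF zmS \<delta>1[OF True insertI1] h])
      also have "h \<cdot> \<delta> (insert k ?I) = slA ?I {1..n} (Ide C X)"
        by (simp add: h_\<delta>[OF True] zKA insert_k)
      also have "slA ?I {1..n} (Ide C X) \<cdot> slA ?I ?I (zm ?J) = slA ?I {1..n} (Ide C X \<cdot> zm ?J)"
        by (rule slA_cmp[OF _ Ik zm_hom[OF inner_subset] ide_hom[OF X]]) auto
      finally show ?thesis
        by (simp only: zS ide_cmp[OF zm_hom[OF inner_subset]])
    next
      case False
      with S have S0: "?I \<in> K" "?J \<in> L" by (auto simp: M)
      have \<gamma>S: "slA ?I ?I (\<gamma> ?J) \<in> hom (slO ?I (zO C m fb ?J)) (slO ?I c)"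
        by (rule slA_hom[OF _ \<gamma>[OF S0(2)]]) auto
      have "h \<cdot> \<epsilon> S = (h \<cdot> \<delta> ?I) \<cdot> slA ?I ?I (\<gamma> ?J)"
        unfolding \<epsilon>0[OF S0] by (rule cmp_assoc[OF \<gamma>S \<delta>0[OF S0(1) outer_notin] h])
      also have "h \<cdot> \<delta> ?I = slA ?I {1..n} g"
        using k by (simp add: h_\<delta>[OF S0(1)] zKA outer_notin)
      also have "slA ?I {1..n} g \<cdot> slA ?I ?I (\<gamma> ?J) = slA ?I {1..n} (g \<cdot> \<gamma> ?J)"
        by (rule slA_cmp[OF _ Ik \<gamma>[OF S0(2)] g]) auto
      finally show ?thesis
        by (simp only: zS g_\<gamma>[OF S0(2)])
    qed
  qed
  then show ?thesis
    unfolding canonical_arrow_def N_def[symmetric] M_def[symmetric]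
    using lim h target by (intro exI[of _ d] exI[of _ \<epsilon>]) simp
qed

end


section \<open>Isomorphisms of arrows\<close>

context category
begin

lemma isoI:
  "f \<in> hom x y \<Longrightarrow> g \<in> hom y x \<Longrightarrow> g \<cdot> f = Ide C x \<Longrightarrow> f \<cdot> g = Ide C y \<Longrightarrow> is_iso C f"
  by (auto simp: is_iso_def hom_set_def)

lemma iso_inverse:
  assumes "is_iso C f" "f \<in> hom x y"
  obtains g where "g \<in> hom y x" "is_iso C g" "g \<cdot> f = Ide C x" "f \<cdot> g = Ide C y"
proof -
  obtain g where g: "g \<in> hom y x" "g \<cdot> f = Ide C x" "f \<cdot> g = Ide C y"
    using assms by (auto simp: is_iso_def hom_set_def)
  then show thesis using that isoI[OF g(1) assms(2) g(3,2)] by blast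
qed

lemma iso_ide: "x \<in> Obj C \<Longrightarrow> is_iso C (Ide C x)"
  using isoI[OF ide_hom ide_hom] cmp_ide[OF ide_hom] by blast

lemma cancel_middle:
  assumes "f \<in> hom w x" "g \<in> hom x y" "g' \<in> hom y x" "h \<in> hom x z" "g' \<cdot> g = Ide C x"
  shows "(h \<cdot> g') \<cdot> (g \<cdot> f) = h \<cdot> f"
proof -
  have "(h \<cdot> g') \<cdot> (g \<cdot> f) = h \<cdot> (g' \<cdot> (g \<cdot> f))"
    by (rule cmp_assoc[OF cmp_hom[OF assms(1,2)] assms(3,4), symmetric])
  also have "g' \<cdot> (g \<cdot> f) = (g' \<cdot> g) \<cdot> f"
    by (rule cmp_assoc[OF assms(1-3)])
  finally show ?thesis using ide_cmp[OF assms(1)] by (simp add: assms(5))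
qed

lemma iso_cmp:
  assumes "is_iso C f" "is_iso C g" "f \<in> hom x y" "g \<in> hom y z"
  shows "is_iso C (g \<cdot> f)"
proof -
  obtain f' where f': "f' \<in> hom y x" "f' \<cdot> f = Ide C x" "f \<cdot> f' = Ide C y"
    using iso_inverse[OF assms(1,3)] by blast
  obtain g' where g': "g' \<in> hom z y" "g' \<cdot> g = Ide C y" "g \<cdot> g' = Ide C z"
    using iso_inverse[OF assms(2,4)] by blast
  show ?thesis
    using cancel_middle[OF assms(3,4) g'(1) f'(1) g'(2)] cancel_middle[OF g'(1) f'(1) assms(3,4) f'(3)]
      f' g' assms by (intro isoI[of _ x z "f' \<cdot> g'"]) (auto intro: cmp_hom)
qed

text \<open>Isomorphism of arrows over a common target: unlike in \<open>arrow_iso\<close>, the isomorphism of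
  targets has to be an identity.\<close>

definition slice_iso :: "('a \<times> 'a) set" where
  "slice_iso = {(f, g). f \<in> Mor C \<and> g \<in> Mor C \<and> Cod C f = Cod C g \<and>
     (\<exists>a \<in> hom (Dom C f) (Dom C g). is_iso C a \<and> g \<cdot> a = f)}"

lemma slice_isoI:
  "f \<in> hom x z \<Longrightarrow> g \<in> hom y z \<Longrightarrow> a \<in> hom x y \<Longrightarrow> is_iso C a \<Longrightarrow> g \<cdot> a = f \<Longrightarrow> (f, g) \<in> slice_iso"
  by (auto simp: slice_iso_def hom_set_def)

lemma slice_isoE:
  assumes "(f, g) \<in> slice_iso"
  obtains x y z a where "f \<in> hom x z" "g \<in> hom y z" "a \<in> hom x y" "is_iso C a" "g \<cdot> a = f"
  using assms that[of "Dom C f" "Cod C f" "Dom C g"] by (auto simp: slice_iso_def hom_set_def)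

lemma slice_iso_sym: "(f, g) \<in> slice_iso \<Longrightarrow> (g, f) \<in> slice_iso"
proof (erule slice_isoE)
  fix x y z a assume f: "f \<in> hom x z" and g: "g \<in> hom y z" and a: "a \<in> hom x y" "is_iso C a" "g \<cdot> a = f"
  obtain b where b: "b \<in> hom y x" "is_iso C b" "a \<cdot> b = Ide C y"
    using iso_inverse[OF a(2,1)] by blast
  have "f \<cdot> b = g"
    using cmp_assoc[OF b(1) a(1) g] cmp_ide[OF g] by (simp add: a(3) b(3))
  then show ?thesis by (rule slice_isoI[OF g f b(1,2)])
qed

lemma slice_iso_trans:
  assumes "(f, g) \<in> slice_iso" "(g, h) \<in> slice_iso"
  shows "(f, h) \<in> slice_iso"
proof -
  obtain x y z a where f: "f \<in> hom x z" and g: "g \<in> hom y z" and a: "a \<in> hom x y" "is_iso C a" "g \<cdot> a = f"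
    by (rule slice_isoE[OF assms(1)]) (rule that)
  obtain y' w z' b where g': "g \<in> hom y' z'" and h: "h \<in> hom w z'" and b: "b \<in> hom y' w" "is_iso C b" "h \<cdot> b = g"
    by (rule slice_isoE[OF assms(2)]) (rule that)
  have eq: "y' = y" "z' = z" using g g' by (auto simp: hom_set_def)
  note h = h[unfolded eq] and b = b[unfolded eq]
  have "h \<cdot> (b \<cdot> a) = f"
    using cmp_assoc[OF a(1) b(1) h] by (simp add: a(3) b(3))
  then show ?thesis
    by (rule slice_isoI[OF f h cmp_hom[OF a(1) b(1)] iso_cmp[OF a(2) b(2) a(1) b(1)]])
qed

lemma equiv_slice_iso: "equiv (Mor C) slice_iso"
proof (rule equivI)
  show "slice_iso \<subseteq> Mor C \<times> Mor C" by (auto simp: slice_iso_def)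
  show "refl_on (Mor C) slice_iso"
    using slice_isoI[OF mor_hom mor_hom ide_hom[OF dom_obj] iso_ide[OF dom_obj] cmp_ide[OF mor_hom]]
    by (auto simp: refl_on_def)
  show "sym slice_iso" using slice_iso_sym by (rule symI)
  show "trans slice_iso" using slice_iso_trans by (rule transI)
qed

lemma arrow_isoI:
  "f \<in> hom x y \<Longrightarrow> g \<in> hom x' y' \<Longrightarrow> a \<in> hom x x' \<Longrightarrow> b \<in> hom y y' \<Longrightarrow> is_iso C a \<Longrightarrow> is_iso C b \<Longrightarrow>
    b \<cdot> f = g \<cdot> a \<Longrightarrow> (f, g) \<in> arrow_iso C"
  by (auto simp: arrow_iso_def hom_set_def)

lemma arrow_isoE:
  assumes "(f, g) \<in> arrow_iso C"
  obtains a b where "f \<in> Mor C" "g \<in> Mor C" "a \<in> hom (Dom C f) (Dom C g)" "b \<in> hom (Cod C f) (Cod C g)"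
    "is_iso C a" "is_iso C b" "b \<cdot> f = g \<cdot> a"
  using assms by (auto simp: arrow_iso_def)

lemma equiv_arrow_iso: "equiv (Mor C) (arrow_iso C)"
proof (rule equivI)
  show "arrow_iso C \<subseteq> Mor C \<times> Mor C" by (auto simp: arrow_iso_def)
  show "refl_on (Mor C) (arrow_iso C)"
  proof (rule refl_onI)
    fix f assume f: "f \<in> Mor C"
    note h = mor_hom[OF f]
    show "(f, f) \<in> arrow_iso C"
      by (rule arrow_isoI[OF h h ide_hom[OF dom_obj[OF f]] ide_hom[OF cod_obj[OF f]]
            iso_ide[OF dom_obj[OF f]] iso_ide[OF cod_obj[OF f]]])
        (simp only: cmp_ide[OF h] ide_cmp[OF h])
  qed
  show "sym (arrow_iso C)"
  proof (rule symI)
    fix f g assume fg: "(f, g) \<in> arrow_iso C"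
    obtain a b where m: "f \<in> Mor C" "g \<in> Mor C" and a: "a \<in> hom (Dom C f) (Dom C g)" "is_iso C a"
      and b: "b \<in> hom (Cod C f) (Cod C g)" "is_iso C b" and eq: "b \<cdot> f = g \<cdot> a"
      using arrow_isoE[OF fg] by blast
    note f = mor_hom[OF m(1)] and g = mor_hom[OF m(2)]
    obtain a' where a': "a' \<in> hom (Dom C g) (Dom C f)" "is_iso C a'" "a \<cdot> a' = Ide C (Dom C g)"
      using iso_inverse[OF a(2,1)] by blast
    obtain b' where b': "b' \<in> hom (Cod C g) (Cod C f)" "is_iso C b'" "b' \<cdot> b = Ide C (Cod C f)"
      using iso_inverse[OF b(2,1)] by blast
    have ga: "g \<cdot> a \<in> hom (Dom C f) (Cod C g)" by (rule cmp_hom[OF a(1) g])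
    have "f \<cdot> a' = (b' \<cdot> (b \<cdot> f)) \<cdot> a'"
      using cmp_assoc[OF f b(1) b'(1)] ide_cmp[OF f] by (simp add: b'(3))
    also have "\<dots> = b' \<cdot> ((g \<cdot> a) \<cdot> a')"
      unfolding eq by (rule cmp_assoc[OF a'(1) ga b'(1), symmetric])
    also have "(g \<cdot> a) \<cdot> a' = g"
      using cmp_assoc[OF a'(1) a(1) g] cmp_ide[OF g] by (simp add: a'(3))
    finally show "(g, f) \<in> arrow_iso C"
      by (intro arrow_isoI[OF g f a'(1) b'(1) a'(2) b'(2)]) simp
  qed
  show "trans (arrow_iso C)"
  proof (rule transI)
    fix f g h assume fg: "(f, g) \<in> arrow_iso C" and gh: "(g, h) \<in> arrow_iso C"
    obtain a b where m: "f \<in> Mor C" "g \<in> Mor C" and a: "a \<in> hom (Dom C f) (Dom C g)" "is_iso C a"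
      and b: "b \<in> hom (Cod C f) (Cod C g)" "is_iso C b" and eq: "b \<cdot> f = g \<cdot> a"
      using arrow_isoE[OF fg] by blast
    obtain a' b' where h: "h \<in> Mor C" and a': "a' \<in> hom (Dom C g) (Dom C h)" "is_iso C a'"
      and b': "b' \<in> hom (Cod C g) (Cod C h)" "is_iso C b'" and eq': "b' \<cdot> g = h \<cdot> a'"
      using arrow_isoE[OF gh] by blast
    note f = mor_hom[OF m(1)] and g = mor_hom[OF m(2)] and h = mor_hom[OF h]
    have "(b' \<cdot> b) \<cdot> f = b' \<cdot> (g \<cdot> a)"
      using cmp_assoc[OF f b(1) b'(1)] by (simp add: eq)
    also have "\<dots> = (h \<cdot> a') \<cdot> a"
      using cmp_assoc[OF a(1) g b'(1)] by (simp add: eq')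
    also have "\<dots> = h \<cdot> (a' \<cdot> a)"
      by (rule cmp_assoc[OF a(1) a'(1) h, symmetric])
    finally show "(f, h) \<in> arrow_iso C"
      by (rule arrow_isoI[OF f h cmp_hom[OF a(1) a'(1)] cmp_hom[OF b(1) b'(1)]
            iso_cmp[OF a(2) a'(2) a(1) a'(1)] iso_cmp[OF b(2) b'(2) b(1) b'(1)]])
  qed
qed


section \<open>Transport of colimits along isomorphisms\<close>

lemma colimit_unique_iso:
  assumes lim: "is_colimit (cat K) C Fo Fa c \<gamma>" and lim': "is_colimit (cat K) C Fo Fa c' \<gamma>'"
    and Fa: "\<And>I J. I \<in> K \<Longrightarrow> J \<in> K \<Longrightarrow> I \<subseteq> J \<Longrightarrow> Fa (I, J) \<in> hom (Fo I) (Fo J)"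
  obtains a where "a \<in> hom c c'" "is_iso C a" "\<And>I. I \<in> K \<Longrightarrow> a \<cdot> \<gamma> I = \<gamma>' I"
proof -
  have cone: "is_cocone (cat K) C Fo Fa c \<gamma>" and cone': "is_cocone (cat K) C Fo Fa c' \<gamma>'"
    using lim lim' by (simp_all add: is_colimit_def)
  have \<gamma>: "\<gamma> I \<in> hom (Fo I) c" and \<gamma>': "\<gamma>' I \<in> hom (Fo I) c'" if "I \<in> K" for I
    using cone cone' that by (auto simp: cat_cocone_iff)
  have c: "c \<in> Obj C" "c' \<in> Obj C" using cone cone' by (auto simp: cat_cocone_iff)
  obtain a where a: "a \<in> hom c c'" "\<And>I. I \<in> K \<Longrightarrow> a \<cdot> \<gamma> I = \<gamma>' I"
    using colimit_factor[OF lim cone'] by blast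
  obtain b where b: "b \<in> hom c' c" "\<And>I. I \<in> K \<Longrightarrow> b \<cdot> \<gamma>' I = \<gamma> I"
    using colimit_factor[OF lim' cone] by blast
  have "b \<cdot> a = Ide C c"
  proof (rule colimit_hom_eq[OF lim cmp_hom[OF a(1) b(1)] ide_hom[OF c(1)] Fa])
    fix I assume I: "I \<in> K"
    show "(b \<cdot> a) \<cdot> \<gamma> I = Ide C c \<cdot> \<gamma> I"
      using cmp_assoc[OF \<gamma>[OF I] a(1) b(1)] ide_cmp[OF \<gamma>[OF I]] by (simp add: a(2) b(2) I)
  qed
  moreover have "a \<cdot> b = Ide C c'"
  proof (rule colimit_hom_eq[OF lim' cmp_hom[OF b(1) a(1)] ide_hom[OF c(2)] Fa])
    fix I assume I: "I \<in> K"
    show "(a \<cdot> b) \<cdot> \<gamma>' I = Ide C c' \<cdot> \<gamma>' I"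
      using cmp_assoc[OF \<gamma>'[OF I] b(1) a(1)] ide_cmp[OF \<gamma>'[OF I]] by (simp add: a(2) b(2) I)
  qed
  ultimately show thesis using that a isoI[OF a(1) b(1)] by blast
qed

lemma colimit_precompose_iso:
  assumes lim: "is_colimit (cat K) C Fo Fa c \<gamma>"
    and \<theta>: "\<And>I. I \<in> K \<Longrightarrow> \<theta> I \<in> hom (Fo' I) (Fo I)" "\<And>I. I \<in> K \<Longrightarrow> is_iso C (\<theta> I)"
    and Fa: "\<And>I J. I \<in> K \<Longrightarrow> J \<in> K \<Longrightarrow> I \<subseteq> J \<Longrightarrow> Fa (I, J) \<in> hom (Fo I) (Fo J)"
    and Fa': "\<And>I J. I \<in> K \<Longrightarrow> J \<in> K \<Longrightarrow> I \<subseteq> J \<Longrightarrow> Fa' (I, J) \<in> hom (Fo' I) (Fo' J)"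
    and nat: "\<And>I J. I \<in> K \<Longrightarrow> J \<in> K \<Longrightarrow> I \<subseteq> J \<Longrightarrow> \<theta> J \<cdot> Fa' (I, J) = Fa (I, J) \<cdot> \<theta> I"
  shows "is_colimit (cat K) C Fo' Fa' c (\<lambda>I. \<gamma> I \<cdot> \<theta> I)"
proof -
  have cone: "is_cocone (cat K) C Fo Fa c \<gamma>" using lim by (simp add: is_colimit_def)
  have c: "c \<in> Obj C" using cone by (simp add: cat_cocone_iff)
  have \<gamma>: "\<gamma> I \<in> hom (Fo I) c" if "I \<in> K" for I
    using cone that by (auto simp: cat_cocone_iff)
  have \<gamma>_Fa: "\<gamma> J \<cdot> Fa (I, J) = \<gamma> I" if "I \<in> K" "J \<in> K" "I \<subseteq> J" for I J
    using cone that by (auto simp: cat_cocone_iff)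
  have "\<forall>I\<in>K. \<exists>t. t \<in> hom (Fo I) (Fo' I) \<and> t \<cdot> \<theta> I = Ide C (Fo' I) \<and> \<theta> I \<cdot> t = Ide C (Fo I)"
    using iso_inverse[OF \<theta>(2,1)] by blast
  then obtain \<theta>' where \<theta>': "\<And>I. I \<in> K \<Longrightarrow> \<theta>' I \<in> hom (Fo I) (Fo' I)"
      and inv: "\<And>I. I \<in> K \<Longrightarrow> \<theta>' I \<cdot> \<theta> I = Ide C (Fo' I)" "\<And>I. I \<in> K \<Longrightarrow> \<theta> I \<cdot> \<theta>' I = Ide C (Fo I)"
    by metis
  have cancel: "(u \<cdot> \<theta>' I) \<cdot> \<theta> I = u" if "I \<in> K" "u \<in> hom (Fo' I) d" for u d I
    using cmp_assoc[OF \<theta>(1)[OF that(1)] \<theta>'[OF that(1)] that(2)] cmp_ide[OF that(2)]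
    by (simp add: inv that(1))
  have cancel': "(u \<cdot> \<theta> I) \<cdot> \<theta>' I = u" if "I \<in> K" "u \<in> hom (Fo I) d" for u d I
    using cmp_assoc[OF \<theta>'[OF that(1)] \<theta>(1)[OF that(1)] that(2)] cmp_ide[OF that(2)]
    by (simp add: inv that(1))
  have cone1: "is_cocone (cat K) C Fo' Fa' c (\<lambda>I. \<gamma> I \<cdot> \<theta> I)"
    unfolding cat_cocone_iff
  proof (intro conjI ballI impI c)
    fix I assume I: "I \<in> K"
    show "\<gamma> I \<cdot> \<theta> I \<in> hom (Fo' I) c" by (rule cmp_hom[OF \<theta>(1)[OF I] \<gamma>[OF I]])
    fix J assume J: "J \<in> K" "I \<subseteq> J"
    have "(\<gamma> J \<cdot> \<theta> J) \<cdot> Fa' (I, J) = \<gamma> J \<cdot> (Fa (I, J) \<cdot> \<theta> I)"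
      using cmp_assoc[OF Fa'[OF I J] \<theta>(1)[OF J(1)] \<gamma>[OF J(1)]] nat[OF I J] by simp
    also have "\<dots> = \<gamma> I \<cdot> \<theta> I"
      using cmp_assoc[OF \<theta>(1)[OF I] Fa[OF I J] \<gamma>[OF J(1)]] \<gamma>_Fa[OF I J] by simp
    finally show "(\<gamma> J \<cdot> \<theta> J) \<cdot> Fa' (I, J) = \<gamma> I \<cdot> \<theta> I" .
  qed
  have univ: "\<exists>!e. e \<in> hom c d \<and> (\<forall>I\<in>K. e \<cdot> (\<gamma> I \<cdot> \<theta> I) = \<tau> I)"
    if \<tau>_cone: "is_cocone (cat K) C Fo' Fa' d \<tau>" for d \<tau>
  proof -
    have d: "d \<in> Obj C" using \<tau>_cone by (simp add: cat_cocone_iff)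
    have \<tau>: "\<tau> I \<in> hom (Fo' I) d" if "I \<in> K" for I
      using \<tau>_cone that by (auto simp: cat_cocone_iff)
    have \<tau>_Fa: "\<tau> J \<cdot> Fa' (I, J) = \<tau> I" if "I \<in> K" "J \<in> K" "I \<subseteq> J" for I J
      using \<tau>_cone that by (auto simp: cat_cocone_iff)
    have "is_cocone (cat K) C Fo Fa d (\<lambda>I. \<tau> I \<cdot> \<theta>' I)"
      unfolding cat_cocone_iff
    proof (intro conjI ballI impI d)
      fix I assume I: "I \<in> K"
      show "\<tau> I \<cdot> \<theta>' I \<in> hom (Fo I) d" by (rule cmp_hom[OF \<theta>'[OF I] \<tau>[OF I]])
      fix J assume J: "J \<in> K" "I \<subseteq> J"
      have \<tau>\<theta>: "\<tau> J \<cdot> \<theta>' J \<in> hom (Fo J) d" by (rule cmp_hom[OF \<theta>'[OF J(1)] \<tau>[OF J(1)]])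
      have F: "(\<tau> J \<cdot> \<theta>' J) \<cdot> Fa (I, J) \<in> hom (Fo I) d" by (rule cmp_hom[OF Fa[OF I J] \<tau>\<theta>])
      have "((\<tau> J \<cdot> \<theta>' J) \<cdot> Fa (I, J)) \<cdot> \<theta> I = (\<tau> J \<cdot> \<theta>' J) \<cdot> (\<theta> J \<cdot> Fa' (I, J))"
        using cmp_assoc[OF \<theta>(1)[OF I] Fa[OF I J] \<tau>\<theta>] nat[OF I J] by simp
      also have "\<dots> = \<tau> J \<cdot> Fa' (I, J)"
        by (rule cancel_middle[OF Fa'[OF I J] \<theta>(1)[OF J(1)] \<theta>'[OF J(1)] \<tau>[OF J(1)] inv(1)[OF J(1)]])
      finally have "((\<tau> J \<cdot> \<theta>' J) \<cdot> Fa (I, J)) \<cdot> \<theta> I = \<tau> I" using \<tau>_Fa[OF I J] by simp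
      then show "(\<tau> J \<cdot> \<theta>' J) \<cdot> Fa (I, J) = \<tau> I \<cdot> \<theta>' I"
        using cancel'[OF I F] by simp
    qed
    then have "\<exists>!e. e \<in> hom c d \<and> (\<forall>I\<in>K. e \<cdot> \<gamma> I = \<tau> I \<cdot> \<theta>' I)"
      using lim by (simp add: is_colimit_def cat_simps)
    moreover have "(\<forall>I\<in>K. e \<cdot> \<gamma> I = \<tau> I \<cdot> \<theta>' I) \<longleftrightarrow> (\<forall>I\<in>K. e \<cdot> (\<gamma> I \<cdot> \<theta> I) = \<tau> I)"
      if e: "e \<in> hom c d" for e
    proof (intro ball_cong refl)
      fix I assume I: "I \<in> K"
      have e\<gamma>: "e \<cdot> \<gamma> I \<in> hom (Fo I) d" by (rule cmp_hom[OF \<gamma>[OF I] e])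
      show "e \<cdot> \<gamma> I = \<tau> I \<cdot> \<theta>' I \<longleftrightarrow> e \<cdot> (\<gamma> I \<cdot> \<theta> I) = \<tau> I"
        using cancel[OF I \<tau>[OF I]] cancel'[OF I e\<gamma>] cmp_assoc[OF \<theta>(1)[OF I] \<gamma>[OF I] e] by metis
    qed
    ultimately show ?thesis by metis
  qed
  show ?thesis
    unfolding is_colimit_def cat_simps(1) using cone1 univ by blast
qed

lemma colimit_postcompose_iso:
  assumes lim: "is_colimit (cat K) C Fo Fa c \<gamma>" and a: "a \<in> hom c c'" "is_iso C a"
    and Fa: "\<And>I J. I \<in> K \<Longrightarrow> J \<in> K \<Longrightarrow> I \<subseteq> J \<Longrightarrow> Fa (I, J) \<in> hom (Fo I) (Fo J)"
  shows "is_colimit (cat K) C Fo Fa c' (\<lambda>I. a \<cdot> \<gamma> I)"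
proof -
  have cone: "is_cocone (cat K) C Fo Fa c \<gamma>" using lim by (simp add: is_colimit_def)
  have \<gamma>: "\<gamma> I \<in> hom (Fo I) c" if "I \<in> K" for I
    using cone that by (auto simp: cat_cocone_iff)
  have \<gamma>_Fa: "\<gamma> J \<cdot> Fa (I, J) = \<gamma> I" if "I \<in> K" "J \<in> K" "I \<subseteq> J" for I J
    using cone that by (auto simp: cat_cocone_iff)
  obtain b where b: "b \<in> hom c' c" "b \<cdot> a = Ide C c" "a \<cdot> b = Ide C c'"
    using iso_inverse[OF a(2,1)] by blast
  have cone': "is_cocone (cat K) C Fo Fa c' (\<lambda>I. a \<cdot> \<gamma> I)"
    unfolding cat_cocone_iff
  proof (intro conjI ballI impI)
    show "c' \<in> Obj C" using a hom_obj by blast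
    fix I assume I: "I \<in> K"
    show "a \<cdot> \<gamma> I \<in> hom (Fo I) c'" by (rule cmp_hom[OF \<gamma>[OF I] a(1)])
    fix J assume J: "J \<in> K" "I \<subseteq> J"
    show "(a \<cdot> \<gamma> J) \<cdot> Fa (I, J) = a \<cdot> \<gamma> I"
      using cmp_assoc[OF Fa[OF I J] \<gamma>[OF J(1)] a(1)] \<gamma>_Fa[OF I J] by simp
  qed
  have "\<exists>!e. e \<in> hom c' d \<and> (\<forall>I\<in>K. e \<cdot> (a \<cdot> \<gamma> I) = \<tau> I)"
    if \<tau>: "is_cocone (cat K) C Fo Fa d \<tau>" for d \<tau>
  proof -
    obtain e where e: "e \<in> hom c d" "\<And>I. I \<in> K \<Longrightarrow> e \<cdot> \<gamma> I = \<tau> I"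
      using colimit_factor[OF lim \<tau>] by blast
    show ?thesis
    proof (rule ex1I[of _ "e \<cdot> b"], intro conjI ballI)
      show "e \<cdot> b \<in> hom c' d" by (rule cmp_hom[OF b(1) e(1)])
      show "(e \<cdot> b) \<cdot> (a \<cdot> \<gamma> I) = \<tau> I" if "I \<in> K" for I
        using cancel_middle[OF \<gamma>[OF that] a(1) b(1) e(1) b(2)] e(2)[OF that] by simp
      fix e' assume e': "e' \<in> hom c' d \<and> (\<forall>I\<in>K. e' \<cdot> (a \<cdot> \<gamma> I) = \<tau> I)"
      have "e' \<cdot> a = e"
      proof (rule colimit_hom_eq[OF lim cmp_hom[OF a(1) conjunct1[OF e']] e(1) Fa])
        fix I assume I: "I \<in> K"
        show "(e' \<cdot> a) \<cdot> \<gamma> I = e \<cdot> \<gamma> I"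
          using cmp_assoc[OF \<gamma>[OF I] a(1) conjunct1[OF e']] e' e(2)[OF I] I by simp
      qed
      then show "e' = e \<cdot> b"
        using cmp_assoc[OF b(1) a(1) conjunct1[OF e']] cmp_ide[OF conjunct1[OF e']] by (simp add: b(3))
    qed
  qed
  then show ?thesis
    unfolding is_colimit_def cat_simps(1) using cone' by blast
qed

end


section \<open>Permuting tensor factors\<close>

context strict_symmetric_monoidal_category
begin

lemma ten_iso:
  assumes "is_iso C f" "is_iso C g"
  shows "is_iso C (tenA C f g)"
proof -
  have f: "f \<in> hom (Dom C f) (Cod C f)" and g: "g \<in> hom (Dom C g) (Cod C g)"
    using assms by (auto simp: is_iso_def hom_set_def)
  note xs = hom_obj[OF f] hom_obj[OF g]
  obtain f' where f': "f' \<in> hom (Cod C f) (Dom C f)" "f' \<cdot> f = Ide C (Dom C f)" "f \<cdot> f' = Ide C (Cod C f)"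
    using iso_inverse[OF assms(1) f] by blast
  obtain g' where g': "g' \<in> hom (Cod C g) (Dom C g)" "g' \<cdot> g = Ide C (Dom C g)" "g \<cdot> g' = Ide C (Cod C g)"
    using iso_inverse[OF assms(2) g] by blast
  show ?thesis
    by (rule isoI[OF ten_hom[OF f g] ten_hom[OF f'(1) g'(1)]])
      (simp_all add: ten_ide xs f' g' flip: ten_cmp[OF f f'(1) g g'(1)] ten_cmp[OF f'(1) f g'(1) g])
qed

lemma tensA_iso: "(\<And>i. i \<in> {1..n} \<Longrightarrow> is_iso C (f i)) \<Longrightarrow> is_iso C (tensA C n f)"
  by (induction n) (auto simp: iso_ide unit_obj intro!: ten_iso)

text \<open>What the transport of canonical arrows uses of a permutation of \<open>n\<close> tensor factors: it is natural
  and invertible, and it is an identity if the symmetry is. For the equality of isomorphism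
  classes it is enough that some such family exists for each permutation.\<close>

definition permutes_factors :: "nat \<Rightarrow> (nat \<Rightarrow> nat) \<Rightarrow> ((nat \<Rightarrow> 'o) \<Rightarrow> 'a) \<Rightarrow> bool" where
  "permutes_factors n s P \<longleftrightarrow>
     (\<forall>x. (\<forall>i\<in>{1..n}. x i \<in> Obj C) \<longrightarrow>
        P x \<in> hom (tensO C n (x \<circ> s)) (tensO C n x) \<and> is_iso C (P x) \<and>
        (trivial_symmetry C \<longrightarrow> P x = Ide C (tensO C n x))) \<and>
     (\<forall>u x y. (\<forall>i\<in>{1..n}. u i \<in> hom (x i) (y i)) \<longrightarrow>
        P y \<cdot> tensA C n (u \<circ> s) = tensA C n u \<cdot> P x)"

lemma permutes_factors_id: "permutes_factors n id (\<lambda>x. Ide C (tensO C n x))"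
  unfolding permutes_factors_def
proof (intro conjI allI impI)
  fix x assume "\<forall>i\<in>{1..n}. x i \<in> Obj C"
  then have "tensO C n x \<in> Obj C" by (intro tensO_obj) auto
  then show "Ide C (tensO C n x) \<in> hom (tensO C n (x \<circ> id)) (tensO C n x)" "is_iso C (Ide C (tensO C n x))"
    by (simp_all add: ide_hom iso_ide)
next
  fix u x y assume "\<forall>i\<in>{1..n}. u i \<in> hom (x i) (y i)"
  then have u: "tensA C n u \<in> hom (tensO C n x) (tensO C n y)" by (intro tensA_hom) auto
  show "Ide C (tensO C n y) \<cdot> tensA C n (u \<circ> id) = tensA C n u \<cdot> Ide C (tensO C n x)"
    using ide_cmp[OF u] cmp_ide[OF u] by simp
qed simp

lemma permutes_factors_compose:
  assumes s: "permutes_factors n s P" "s permutes {1..n}" and t: "permutes_factors n t Q" "t permutes {1..n}"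
  shows "permutes_factors n (s \<circ> t) (\<lambda>x. P x \<cdot> Q (x \<circ> s))"
  unfolding permutes_factors_def
proof (intro conjI allI impI)
  have s_in: "s i \<in> {1..n}" if "i \<in> {1..n}" for i
    using permutes_in_image[OF s(2)] that by blast
  have t_in: "t i \<in> {1..n}" if "i \<in> {1..n}" for i
    using permutes_in_image[OF t(2)] that by blast
  {
    fix x assume x: "\<forall>i\<in>{1..n}. x i \<in> Obj C"
    then have xs: "\<forall>i\<in>{1..n}. (x \<circ> s) i \<in> Obj C" using s_in by simp
    have P: "P x \<in> hom (tensO C n (x \<circ> s)) (tensO C n x)" "is_iso C (P x)"
        "trivial_symmetry C \<Longrightarrow> P x = Ide C (tensO C n x)"
      using s(1) x unfolding permutes_factors_def by blast+
    have Q: "Q (x \<circ> s) \<in> hom (tensO C n (x \<circ> (s \<circ> t))) (tensO C n (x \<circ> s))" "is_iso C (Q (x \<circ> s))"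
        "trivial_symmetry C \<Longrightarrow> Q (x \<circ> s) = Ide C (tensO C n (x \<circ> s))"
      using t(1) xs unfolding permutes_factors_def o_assoc by blast+
    show "P x \<cdot> Q (x \<circ> s) \<in> hom (tensO C n (x \<circ> (s \<circ> t))) (tensO C n x)"
      by (rule cmp_hom[OF Q(1) P(1)])
    show "is_iso C (P x \<cdot> Q (x \<circ> s))" by (rule iso_cmp[OF Q(2) P(2) Q(1) P(1)])
    assume "trivial_symmetry C"
    then show "P x \<cdot> Q (x \<circ> s) = Ide C (tensO C n x)"
      using cmp_ide[OF P(1)] P(3) Q(3) by simp
  }
  fix u x y assume u: "\<forall>i\<in>{1..n}. u i \<in> hom (x i) (y i)"
  then have us: "\<forall>i\<in>{1..n}. (u \<circ> s) i \<in> hom ((x \<circ> s) i) ((y \<circ> s) i)" using s_in by simp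
  have xy: "\<forall>i\<in>{1..n}. x i \<in> Obj C" "\<forall>i\<in>{1..n}. y i \<in> Obj C" using u hom_obj by blast+
  then have xys: "\<forall>i\<in>{1..n}. (x \<circ> s) i \<in> Obj C" "\<forall>i\<in>{1..n}. (y \<circ> s) i \<in> Obj C" using s_in by simp_all
  have Px: "P x \<in> hom (tensO C n (x \<circ> s)) (tensO C n x)"
    and Py: "P y \<in> hom (tensO C n (y \<circ> s)) (tensO C n y)"
    and Pu: "P y \<cdot> tensA C n (u \<circ> s) = tensA C n u \<cdot> P x"
    using s(1) xy u unfolding permutes_factors_def by blast+
  have Qx: "Q (x \<circ> s) \<in> hom (tensO C n (x \<circ> s \<circ> t)) (tensO C n (x \<circ> s))"
    and Qy: "Q (y \<circ> s) \<in> hom (tensO C n (y \<circ> s \<circ> t)) (tensO C n (y \<circ> s))"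
    and Qu: "Q (y \<circ> s) \<cdot> tensA C n (u \<circ> s \<circ> t) = tensA C n (u \<circ> s) \<cdot> Q (x \<circ> s)"
    using t(1) xys us unfolding permutes_factors_def by blast+
  have u1: "tensA C n u \<in> hom (tensO C n x) (tensO C n y)"
    by (rule tensA_hom) (use u in auto)
  have us1: "tensA C n (u \<circ> s) \<in> hom (tensO C n (x \<circ> s)) (tensO C n (y \<circ> s))"
    by (rule tensA_hom) (use us in auto)
  have ust1: "tensA C n (u \<circ> s \<circ> t) \<in> hom (tensO C n (x \<circ> s \<circ> t)) (tensO C n (y \<circ> s \<circ> t))"
    by (rule tensA_hom) (use us t_in in auto)
  show "(P y \<cdot> Q (y \<circ> s)) \<cdot> tensA C n (u \<circ> (s \<circ> t)) = tensA C n u \<cdot> (P x \<cdot> Q (x \<circ> s))"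
    using cmp_assoc[OF ust1 Qy Py] cmp_assoc[OF Qx us1 Py] cmp_assoc[OF Qx Px u1]
    by (simp add: o_assoc Pu Qu)
qed

text \<open>A transposition of adjacent factors is the symmetry, tensored with identities on the
  factors before it (this lemma) and after it (the next one). All other permutations are composites of these.\<close>

lemma permutes_factors_last_two:
  "permutes_factors (Suc (Suc p)) (Transposition.transpose (Suc p) (Suc (Suc p)))
     (\<lambda>x. tenA C (Ide C (tensO C p x)) (symA C (x (Suc (Suc p))) (x (Suc p))))"
    (is "permutes_factors ?n ?s ?P")
proof -
  have fixed: "tensO C p (x \<circ> ?s) = tensO C p x" for x
    by (rule tensO_cong) (auto simp: Transposition.transpose_def)
  have fixedA: "tensA C p (u \<circ> ?s) = tensA C p u" for u
    by (rule tensA_cong) (auto simp: Transposition.transpose_def)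
  have O: "tensO C ?n x = tenO C (tensO C p x) (tenO C (x (Suc p)) (x (Suc (Suc p))))"
    "tensO C ?n (x \<circ> ?s) = tenO C (tensO C p x) (tenO C (x (Suc (Suc p))) (x (Suc p)))"
    if "\<forall>i\<in>{1..?n}. x i \<in> Obj C" for x
  proof -
    have "tensO C p x \<in> Obj C" using that by (intro tensO_obj) auto
    then show "tensO C ?n x = tenO C (tensO C p x) (tenO C (x (Suc p)) (x (Suc (Suc p))))"
      "tensO C ?n (x \<circ> ?s) = tenO C (tensO C p x) (tenO C (x (Suc (Suc p))) (x (Suc p)))"
      using that fixed by (simp_all add: tenO_assoc)
  qed
  show ?thesis
    unfolding permutes_factors_def
  proof (intro conjI allI impI)
    fix x assume x: "\<forall>i\<in>{1..?n}. x i \<in> Obj C"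
    let ?a = "x (Suc p)" and ?b = "x (Suc (Suc p))" and ?A = "tensO C p x"
    have A: "?A \<in> Obj C" using x by (intro tensO_obj) auto
    have ab: "?a \<in> Obj C" "?b \<in> Obj C" using x by auto
    show "?P x \<in> hom (tensO C ?n (x \<circ> ?s)) (tensO C ?n x)"
      unfolding O[OF x] by (rule ten_hom[OF ide_hom[OF A] sym_hom[OF ab(2,1)]])
    have "is_iso C (symA C ?b ?a)"
      by (rule isoI[OF sym_hom sym_hom sym_inverse sym_inverse]) (use ab in auto)
    then show "is_iso C (?P x)"
      using iso_ide[OF A] by (intro ten_iso)
    assume triv: "trivial_symmetry C"
    have "symA C ?b ?a = Ide C (tenO C ?b ?a)" "symA C ?a ?b = Ide C (tenO C ?a ?b)"
      using triv ab by (auto simp: trivial_symmetry_def)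
    moreover have "tenO C ?b ?a = tenO C ?a ?b"
      using hom_cod[OF sym_hom[OF ab(2,1)]] hom_cod[OF ide_hom[OF ten_obj[OF ab(2,1)]]]
        calculation(1) by simp
    ultimately show "?P x = Ide C (tensO C ?n x)"
      unfolding O[OF x] using A ab by (simp add: ten_ide ten_obj)
  next
    fix u x y assume u: "\<forall>i\<in>{1..?n}. u i \<in> hom (x i) (y i)"
    then have ua: "u (Suc p) \<in> hom (x (Suc p)) (y (Suc p))"
      and ub: "u (Suc (Suc p)) \<in> hom (x (Suc (Suc p))) (y (Suc (Suc p)))" by auto
    have A: "tensA C p u \<in> hom (tensO C p x) (tensO C p y)"
      by (rule tensA_hom) (use u in auto)
    note mors = hom_mor[OF A] hom_mor[OF ua] hom_mor[OF ub]
    note objs = hom_obj[OF A] hom_obj[OF ua] hom_obj[OF ub]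
    have U: "tensA C ?n u = tenA C (tensA C p u) (tenA C (u (Suc p)) (u (Suc (Suc p))))"
      "tensA C ?n (u \<circ> ?s) = tenA C (tensA C p u) (tenA C (u (Suc (Suc p))) (u (Suc p)))"
      using tenA_assoc mors by (simp_all add: fixedA)
    show "?P y \<cdot> tensA C ?n (u \<circ> ?s) = tensA C ?n u \<cdot> ?P x"
      unfolding U
        ten_cmp[OF A ide_hom[OF objs(2)] ten_hom[OF ub ua] sym_hom[OF objs(6,4)], symmetric]
        ten_cmp[OF ide_hom[OF objs(1)] A sym_hom[OF objs(5,3)] ten_hom[OF ua ub], symmetric]
      by (simp only: ide_cmp[OF A] cmp_ide[OF A] sym_natural[OF ub ua])
  qed
qed

lemma permutes_factors_extend:
  assumes "permutes_factors n s P" "s permutes {1..n}"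
  shows "permutes_factors (Suc n) s (\<lambda>x. tenA C (P x) (Ide C (x (Suc n))))"
  unfolding permutes_factors_def
proof (intro conjI allI impI)
  have last: "s (Suc n) = Suc n" using permutes_not_in[OF assms(2)] by simp
  fix x assume x: "\<forall>i\<in>{1..Suc n}. x i \<in> Obj C"
  then have P: "P x \<in> hom (tensO C n (x \<circ> s)) (tensO C n x)" "is_iso C (P x)"
      "trivial_symmetry C \<Longrightarrow> P x = Ide C (tensO C n x)"
    using assms(1) unfolding permutes_factors_def by auto
  have b: "x (Suc n) \<in> Obj C" using x by simp
  show "tenA C (P x) (Ide C (x (Suc n))) \<in> hom (tensO C (Suc n) (x \<circ> s)) (tensO C (Suc n) x)"
    using ten_hom[OF P(1) ide_hom[OF b]] by (simp add: last)
  show "is_iso C (tenA C (P x) (Ide C (x (Suc n))))"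
    by (rule ten_iso[OF P(2) iso_ide[OF b]])
  assume "trivial_symmetry C"
  then show "tenA C (P x) (Ide C (x (Suc n))) = Ide C (tensO C (Suc n) x)"
    using P(3) ten_ide[OF hom_obj(2)[OF P(1)] b] by simp
next
  have last: "s (Suc n) = Suc n" using permutes_not_in[OF assms(2)] by simp
  fix u x y assume u: "\<forall>i\<in>{1..Suc n}. u i \<in> hom (x i) (y i)"
  have s_in: "s i \<in> {1..n}" if "i \<in> {1..n}" for i
    using permutes_in_image[OF assms(2)] that by blast
  have un: "\<forall>i\<in>{1..n}. u i \<in> hom (x i) (y i)" using u by auto
  have xy: "\<forall>i\<in>{1..n}. x i \<in> Obj C" "\<forall>i\<in>{1..n}. y i \<in> Obj C" using un hom_obj by blast+
  have Px: "P x \<in> hom (tensO C n (x \<circ> s)) (tensO C n x)"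
    and Py: "P y \<in> hom (tensO C n (y \<circ> s)) (tensO C n y)"
    and Pu: "P y \<cdot> tensA C n (u \<circ> s) = tensA C n u \<cdot> P x"
    using assms(1) xy un unfolding permutes_factors_def by blast+
  have u1: "tensA C n u \<in> hom (tensO C n x) (tensO C n y)"
    by (rule tensA_hom) (use un in auto)
  have us1: "tensA C n (u \<circ> s) \<in> hom (tensO C n (x \<circ> s)) (tensO C n (y \<circ> s))"
    by (rule tensA_hom) (use un s_in in auto)
  have ul: "u (Suc n) \<in> hom (x (Suc n)) (y (Suc n))" using u by simp
  show "tenA C (P y) (Ide C (y (Suc n))) \<cdot> tensA C (Suc n) (u \<circ> s) =
      tensA C (Suc n) u \<cdot> tenA C (P x) (Ide C (x (Suc n)))"
    using ten_cmp[OF us1 Py ul ide_hom[OF hom_obj(2)[OF ul]]]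
      ten_cmp[OF Px u1 ide_hom[OF hom_obj(1)[OF ul]] ul]
    by (simp add: last Pu ide_cmp[OF ul] cmp_ide[OF ul])
qed

lemma permutes_factors_adjacent:
  "i \<in> {1..<n} \<Longrightarrow> \<exists>P. permutes_factors n (Transposition.transpose i (Suc i)) P"
proof (induction n)
  case (Suc n)
  show ?case
  proof (cases "i = n")
    case True
    then obtain p where "i = Suc p" "n = Suc p" using Suc.prems by (cases n) auto
    then show ?thesis using permutes_factors_last_two[of p] by auto
  next
    case False
    then have i: "i \<in> {1..<n}" using Suc.prems by auto
    then obtain P where P: "permutes_factors n (Transposition.transpose i (Suc i)) P"
      using Suc.IH by blast
    have "Transposition.transpose i (Suc i) permutes {1..n}"
      by (rule permutes_swap_id) (use i in auto)
    then show ?thesis using permutes_factors_extend[OF P] by blast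
  qed
qed simp

text \<open>Induction on the distance, conjugating by an adjacent transposition:
  \<open>(a b+1) = (b b+1) (a b) (b b+1)\<close>.\<close>

lemma permutes_factors_transpose:
  "1 \<le> a \<Longrightarrow> a < b \<Longrightarrow> b \<le> n \<Longrightarrow> \<exists>P. permutes_factors n (Transposition.transpose a b) P"
proof (induction b)
  case (Suc b)
  let ?t = "Transposition.transpose b (Suc b)"
  obtain Q where Q: "permutes_factors n ?t Q"
    using permutes_factors_adjacent[of b n] Suc.prems by auto
  have t: "?t permutes {1..n}"
    by (rule permutes_swap_id) (use Suc.prems in auto)
  show ?case
  proof (cases "a = b")
    case True
    then show ?thesis using Q by blast
  next
    case False
    then obtain P where P: "permutes_factors n (Transposition.transpose a b) P"
      using Suc by auto
    have ab: "Transposition.transpose a b permutes {1..n}"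
      by (rule permutes_swap_id) (use Suc.prems in auto)
    have "Transposition.transpose (Suc b) b \<circ> Transposition.transpose b a \<circ> Transposition.transpose (Suc b) b =
        Transposition.transpose (Suc b) a"
      by (rule transpose_comp_triple) (use Suc.prems False in auto)
    then have "?t \<circ> Transposition.transpose a b \<circ> ?t = Transposition.transpose a (Suc b)"
      by (simp only: transpose_commute[of "Suc b" b] transpose_commute[of b a] transpose_commute[of "Suc b" a])
    then show ?thesis
      using permutes_factors_compose[OF permutes_factors_compose[OF Q t P ab] permutes_compose[OF ab t] Q t]
      by auto
  qed
qed simp

lemma permutes_factors_exists:
  assumes "s permutes {1..n}"
  shows "\<exists>P. permutes_factors n s P"
  using assms finite_atLeastAtMost
proof (induction rule: permutes_induct)
  case id
  show ?case using permutes_factors_id by blast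
next
  case (swap a b p)
  obtain P where P: "permutes_factors n p P" using swap by blast
  have t: "Transposition.transpose a b permutes {1..n}"
    by (rule permutes_swap_id) (use swap in auto)
  obtain Q where "permutes_factors n (Transposition.transpose a b) Q"
  proof (cases "a < b")
    case True
    then show ?thesis using permutes_factors_transpose[of a b n] swap that by auto
  next
    case False
    then show ?thesis
      using permutes_factors_transpose[of b a n] swap that by (auto simp: transpose_commute)
  qed
  then show ?case using permutes_factors_compose[OF _ t P] swap by blast
qed

end


section \<open>Canonical arrows up to isomorphism\<close>

context strict_symmetric_monoidal_category
begin

lemma canonical_arrow_hom:
  "canonical_arrow C n K f g \<Longrightarrow> g \<in> hom (Dom C g) (zO C n f {1..n})"
  by (auto simp: canonical_arrow_def hom_set_def)

lemma canonical_arrow_mor: "canonical_arrow C n K f g \<Longrightarrow> g \<in> Mor C"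
  using canonical_arrow_hom hom_mor by blast

text \<open>The arrows \<open>z(I) \<rightarrow> z([n])\<close> form a cocone, and \<open>cat K\<close> is finite.\<close>

lemma canonical_arrow_exists:
  assumes "cocomplete TYPE('i::infinite) C" "K \<in> scpx n"
    and f: "\<And>i. i \<in> {1..n} \<Longrightarrow> f i \<in> Mor C"
  shows "\<exists>g. canonical_arrow C n K f g"
proof -
  have "is_functor (cat K) C (zO C n f) (zA C n f)" by (rule is_functor_z) (rule f)
  then obtain c \<gamma> where lim: "is_colimit (cat K) C (zO C n f) (zA C n f) c \<gamma>"
    using cocomplete_finite_shape[OF assms(1) category_cat finite_cat(1)[OF assms(2)]
        finite_cat(2)[OF assms(2)]] by blast
  have "is_cocone (cat K) C (zO C n f) (zA C n f) (zO C n f {1..n}) (\<lambda>I. zA C n f (I, {1..n}))"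
    unfolding cat_cocone_iff
  proof (intro conjI ballI impI)
    show "zO C n f {1..n} \<in> Obj C" by (rule zO_obj[OF f])
    fix I assume "I \<in> K"
    then show "zA C n f (I, {1..n}) \<in> hom (zO C n f I) (zO C n f {1..n})"
      by (intro zA_hom f scpx_subset[OF assms(2)])
    fix J assume "J \<in> K" "I \<subseteq> J"
    then show "zA C n f (J, {1..n}) \<cdot> zA C n f (I, J) = zA C n f (I, {1..n})"
      by (intro zA_cmp f scpx_subset[OF assms(2)])
  qed
  then obtain e where "e \<in> hom c (zO C n f {1..n})" "\<And>I. I \<in> K \<Longrightarrow> e \<cdot> \<gamma> I = zA C n f (I, {1..n})"
    using colimit_factor[OF lim] by blast
  with lim show ?thesis unfolding canonical_arrow_def by blast
qed

lemma canonical_arrow_slice_closed: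
  assumes can: "canonical_arrow C n K f g" and f: "\<And>i. i \<in> {1..n} \<Longrightarrow> f i \<in> Mor C"
    and gh: "(g, h) \<in> slice_iso"
  shows "canonical_arrow C n K f h"
proof -
  obtain c \<gamma> where lim: "is_colimit (cat K) C (zO C n f) (zA C n f) c \<gamma>"
    and g: "g \<in> hom c (zO C n f {1..n})" and g_\<gamma>: "\<And>I. I \<in> K \<Longrightarrow> g \<cdot> \<gamma> I = zA C n f (I, {1..n})"
    using can unfolding canonical_arrow_def by blast
  obtain a where a: "a \<in> hom c (Dom C h)" "is_iso C a" "h \<cdot> a = g"
    and h: "h \<in> hom (Dom C h) (zO C n f {1..n})"
    using gh g by (auto simp: slice_iso_def hom_set_def)
  have \<gamma>: "\<gamma> I \<in> hom (zO C n f I) c" if "I \<in> K" for I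
    using lim that by (auto simp: is_colimit_def cat_cocone_iff)
  have "is_colimit (cat K) C (zO C n f) (zA C n f) (Dom C h) (\<lambda>I. a \<cdot> \<gamma> I)"
    by (rule colimit_postcompose_iso[OF lim a(1,2)]) (rule zA_hom[OF f])
  moreover have "h \<cdot> (a \<cdot> \<gamma> I) = zA C n f (I, {1..n})" if "I \<in> K" for I
    using cmp_assoc[OF \<gamma>[OF that] a(1) h] g_\<gamma>[OF that] by (simp add: a(3))
  ultimately show ?thesis
    unfolding canonical_arrow_def using h by blast
qed

text \<open>Since a colimit depends on its diagram only up to natural isomorphism and relabelling of
  the shape, so does the canonical arrow, and the isomorphism of targets is prescribed.\<close>

lemma canonical_arrow_transport:
  assumes K: "K \<in> scpx n" and s: "s permutes {1..n}"
    and f: "\<And>i. i \<in> {1..n} \<Longrightarrow> f i \<in> Mor C" and f': "\<And>i. i \<in> {1..n} \<Longrightarrow> f' i \<in> Mor C"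
    and \<theta>: "\<And>I. I \<subseteq> {1..n} \<Longrightarrow> \<theta> I \<in> hom (zO C n f' I) (zO C n f (s ` I))"
      "\<And>I. I \<subseteq> {1..n} \<Longrightarrow> is_iso C (\<theta> I)"
    and nat: "\<And>I J. I \<subseteq> J \<Longrightarrow> J \<subseteq> {1..n} \<Longrightarrow>
      \<theta> J \<cdot> zA C n f' (I, J) = zA C n f (s ` I, s ` J) \<cdot> \<theta> I"
    and g: "canonical_arrow C n (image s ` K) f g" and g': "canonical_arrow C n K f' g'"
  obtains a where "a \<in> hom (Dom C g') (Dom C g)" "is_iso C a" "g \<cdot> a = \<theta> {1..n} \<cdot> g'"
proof -
  let ?N = "{1..n}" and ?\<phi> = "image s" and ?\<psi> = "map_prod (image s) (image s)"
  have inj: "inj s" using s by (rule permutes_inj)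
  have sN: "s ` ?N = ?N" using s by (rule permutes_image)
  note KN = scpx_subset[OF K]
  obtain c \<gamma> where *: "is_colimit (cat (?\<phi> ` K)) C (zO C n f) (zA C n f) c \<gamma> \<and>
      g \<in> hom c (zO C n f ?N) \<and> (\<forall>I\<in>?\<phi> ` K. g \<cdot> \<gamma> I = zA C n f (I, ?N))"
    using g unfolding canonical_arrow_def by (elim exE) (rule that)
  then have lim: "is_colimit (cat (?\<phi> ` K)) C (zO C n f) (zA C n f) c \<gamma>"
    and gc: "g \<in> hom c (zO C n f ?N)" and g_\<gamma>: "\<And>I. I \<in> K \<Longrightarrow> g \<cdot> \<gamma> (s ` I) = zA C n f (s ` I, ?N)"
    by simp_all
  obtain c' \<gamma>' where lim': "is_colimit (cat K) C (zO C n f') (zA C n f') c' \<gamma>'"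
    and gc': "g' \<in> hom c' (zO C n f' ?N)" and g_\<gamma>': "\<And>I. I \<in> K \<Longrightarrow> g' \<cdot> \<gamma>' I = zA C n f' (I, ?N)"
    using g' unfolding canonical_arrow_def by blast
  have "is_colimit (cat K) C (zO C n f \<circ> ?\<phi>) (zA C n f \<circ> ?\<psi>) c (\<gamma> \<circ> ?\<phi>)"
  proof (rule iffD1[OF is_colimit_reindex lim])
    show "Mor (cat (?\<phi> ` K)) = ?\<psi> ` Mor (cat K)"
    proof (rule set_eqI, rule prod.induct)
      fix A B
      have "(A, B) \<in> Mor (cat (?\<phi> ` K)) \<longleftrightarrow> (\<exists>I\<in>K. \<exists>J\<in>K. A = s ` I \<and> B = s ` J \<and> s ` I \<subseteq> s ` J)"
        by (auto simp: cat_simps)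
      also have "\<dots> \<longleftrightarrow> (\<exists>I\<in>K. \<exists>J\<in>K. A = s ` I \<and> B = s ` J \<and> I \<subseteq> J)"
        by (simp only: inj_image_subset_iff[OF inj])
      also have "\<dots> \<longleftrightarrow> (\<exists>u\<in>Mor (cat K). (A, B) = ?\<psi> u)"
        by (auto simp: cat_simps Bex_def)
      also have "\<dots> \<longleftrightarrow> (A, B) \<in> ?\<psi> ` Mor (cat K)"
        by (rule image_iff[symmetric])
      finally show "(A, B) \<in> Mor (cat (?\<phi> ` K)) \<longleftrightarrow> (A, B) \<in> ?\<psi> ` Mor (cat K)" .
    qed
    show "inj_on ?\<phi> (Obj (cat K))"
      using inj_image_eq_iff[OF inj] by (simp add: inj_on_def)
  qed (auto simp: cat_simps)
  then have lim1: "is_colimit (cat K) C (zO C n f') (zA C n f') c (\<lambda>I. (\<gamma> \<circ> ?\<phi>) I \<cdot> \<theta> I)"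
  proof (rule colimit_precompose_iso)
    fix I assume I: "I \<in> K"
    show "\<theta> I \<in> hom (zO C n f' I) ((zO C n f \<circ> ?\<phi>) I)" "is_iso C (\<theta> I)"
      using \<theta>[OF KN[OF I]] by simp_all
    fix J assume J: "J \<in> K" "I \<subseteq> J"
    show "(zA C n f \<circ> ?\<psi>) (I, J) \<in> hom ((zO C n f \<circ> ?\<phi>) I) ((zO C n f \<circ> ?\<phi>) J)"
      using zA_hom[OF f image_mono[OF J(2)]] by simp
    show "zA C n f' (I, J) \<in> hom (zO C n f' I) (zO C n f' J)" by (rule zA_hom[OF f' J(2)])
    show "\<theta> J \<cdot> zA C n f' (I, J) = (zA C n f \<circ> ?\<psi>) (I, J) \<cdot> \<theta> I"
      using nat[OF J(2) KN[OF J(1)]] by simp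
  qed
  obtain a where a: "a \<in> hom c' c" "is_iso C a" "\<And>I. I \<in> K \<Longrightarrow> a \<cdot> \<gamma>' I = \<gamma> (s ` I) \<cdot> \<theta> I"
    using colimit_unique_iso[OF lim' lim1 zA_hom[OF f']] by auto
  have \<theta>N: "\<theta> ?N \<in> hom (zO C n f' ?N) (zO C n f ?N)" using \<theta>(1)[of ?N] sN by simp
  have "g \<cdot> a = \<theta> ?N \<cdot> g'"
  proof (rule colimit_hom_eq[OF lim' cmp_hom[OF a(1) gc] cmp_hom[OF gc' \<theta>N] zA_hom[OF f']])
    fix I assume I: "I \<in> K"
    have \<gamma>': "\<gamma>' I \<in> hom (zO C n f' I) c'"
      using lim' I by (simp add: is_colimit_def cat_cocone_iff)
    have \<gamma>: "\<gamma> (s ` I) \<in> hom (zO C n f (s ` I)) c"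
      using lim I by (simp add: is_colimit_def cat_cocone_iff)
    have "(g \<cdot> a) \<cdot> \<gamma>' I = g \<cdot> (\<gamma> (s ` I) \<cdot> \<theta> I)"
      using cmp_assoc[OF \<gamma>' a(1) gc] a(3)[OF I] by simp
    also have "\<dots> = zA C n f (s ` I, s ` ?N) \<cdot> \<theta> I"
      using cmp_assoc[OF \<theta>(1)[OF KN[OF I]] \<gamma> gc] g_\<gamma>[OF I] unfolding sN by simp
    also have "\<dots> = \<theta> ?N \<cdot> zA C n f' (I, ?N)"
      by (rule nat[OF KN[OF I] order_refl, symmetric])
    also have "\<dots> = (\<theta> ?N \<cdot> g') \<cdot> \<gamma>' I"
      using cmp_assoc[OF \<gamma>' gc' \<theta>N] g_\<gamma>'[OF I] by simp
    finally show "(g \<cdot> a) \<cdot> \<gamma>' I = (\<theta> ?N \<cdot> g') \<cdot> \<gamma>' I" .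
  qed
  then show thesis
    using that[of a] a(1,2) hom_dom[OF gc] hom_dom[OF gc'] by simp
qed

lemma canonical_arrow_slice_unique:
  assumes K: "K \<in> scpx n" and f: "\<And>i. i \<in> {1..n} \<Longrightarrow> f i \<in> Mor C"
    and g: "canonical_arrow C n K f g" and g': "canonical_arrow C n K f g'"
  shows "(g', g) \<in> slice_iso"
proof -
  let ?\<theta> = "\<lambda>I. Ide C (zO C n f I)"
  have z: "zO C n f I \<in> Obj C" for I by (rule zO_obj[OF f])
  have gid: "canonical_arrow C n (image id ` K) f g" using g by simp
  obtain a where a: "a \<in> hom (Dom C g') (Dom C g)" "is_iso C a" "g \<cdot> a = ?\<theta> {1..n} \<cdot> g'"
  proof (rule canonical_arrow_transport[OF K permutes_id f f _ _ _ gid g', where \<theta> = ?\<theta>])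
    show "?\<theta> I \<in> hom (zO C n f I) (zO C n f (id ` I))" for I using ide_hom[OF z] by simp
    show "is_iso C (?\<theta> I)" for I by (rule iso_ide[OF z])
    show "?\<theta> J \<cdot> zA C n f (I, J) = zA C n f (id ` I, id ` J) \<cdot> ?\<theta> I" if "I \<subseteq> J" for I J
      using ide_cmp[OF zA_hom[OF f that]] cmp_ide[OF zA_hom[OF f that]] by simp
  qed (use that in auto)
  have "g \<cdot> a = g'" using a(3) ide_cmp[OF canonical_arrow_hom[OF g']] by simp
  then show ?thesis
    by (rule slice_isoI[OF canonical_arrow_hom[OF g'] canonical_arrow_hom[OF g] a(1,2)])
qed

text \<open>Isomorphisms \<open>(a\<^sub>i, b\<^sub>i)\<close> between the entries induce the natural isomorphism whose value at \<open>I\<close> is the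
  tensor product of the \<open>b\<^sub>i\<close> for \<open>i \<in> I\<close> and the \<open>a\<^sub>i\<close> for \<open>i \<notin> I\<close>.\<close>

lemma canonical_arrow_arrow_iso:
  assumes K: "K \<in> scpx n"
    and iso: "\<And>i. i \<in> {1..n} \<Longrightarrow> (f' i, f i) \<in> arrow_iso C"
    and g: "canonical_arrow C n K f g" and g': "canonical_arrow C n K f' g'"
  shows "(g', g) \<in> arrow_iso C"
proof -
  have f: "f i \<in> Mor C" and f': "f' i \<in> Mor C" if "i \<in> {1..n}" for i
    using iso[OF that] by (auto simp: arrow_iso_def)
  have "\<forall>i\<in>{1..n}. \<exists>a b. a \<in> hom (Dom C (f' i)) (Dom C (f i)) \<and> b \<in> hom (Cod C (f' i)) (Cod C (f i)) \<and>
      is_iso C a \<and> is_iso C b \<and> b \<cdot> f' i = f i \<cdot> a"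
    using iso by (fastforce simp: arrow_iso_def)
  then obtain a b where ab: "\<And>i. i \<in> {1..n} \<Longrightarrow> a i \<in> hom (Dom C (f' i)) (Dom C (f i)) \<and>
      b i \<in> hom (Cod C (f' i)) (Cod C (f i)) \<and> is_iso C (a i) \<and> is_iso C (b i) \<and> b i \<cdot> f' i = f i \<cdot> a i"
    by metis
  define t where "t I i = (if i \<in> I then b i else a i)" for I i
  let ?\<theta> = "\<lambda>I. tensA C n (t I)"
  have t: "t I i \<in> hom (zobj f' I i) (zobj f I i)" "is_iso C (t I i)" if "i \<in> {1..n}" for I i
    using ab[OF that] by (auto simp: t_def zobj_def)
  have \<theta>: "?\<theta> I \<in> hom (zO C n f' I) (zO C n f I)" "is_iso C (?\<theta> I)" for I
    unfolding zO_eq by (auto intro: tensA_hom tensA_iso t)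
  have nat: "?\<theta> J \<cdot> zA C n f' (I, J) = zA C n f (I, J) \<cdot> ?\<theta> I" if IJ: "I \<subseteq> J" for I J
  proof -
    have "?\<theta> J \<cdot> zA C n f' (I, J) = tensA C n (\<lambda>i. t J i \<cdot> zarr f' I J i)"
      unfolding zA_eq
      by (rule tensA_cmp[symmetric, where x = "zobj f' I" and y = "zobj f' J" and z = "zobj f J"]) (use zarr_hom f' IJ t(1) in blast)+
    also have "\<dots> = tensA C n (\<lambda>i. zarr f I J i \<cdot> t I i)"
    proof (rule tensA_cong)
      fix i assume i: "i \<in> {1..n}"
      have A: "a i \<in> hom (Dom C (f' i)) (Dom C (f i))" and B: "b i \<in> hom (Cod C (f' i)) (Cod C (f i))"
        and "b i \<cdot> f' i = f i \<cdot> a i" using ab[OF i] by auto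
      then show "t J i \<cdot> zarr f' I J i = zarr f I J i \<cdot> t I i"
        using IJ ide_cmp[OF A] cmp_ide[OF A] ide_cmp[OF B] cmp_ide[OF B]
        by (auto simp: t_def zarr_def)
    qed
    also have "\<dots> = zA C n f (I, J) \<cdot> ?\<theta> I"
      unfolding zA_eq
      by (rule tensA_cmp[where x = "zobj f' I" and y = "zobj f I" and z = "zobj f J"]) (use zarr_hom f IJ t(1) in blast)+
    finally show ?thesis .
  qed
  have gid: "canonical_arrow C n (image id ` K) f g" using g by simp
  obtain e where e: "e \<in> hom (Dom C g') (Dom C g)" "is_iso C e" "g \<cdot> e = ?\<theta> {1..n} \<cdot> g'"
    by (rule canonical_arrow_transport[OF K permutes_id f f' _ _ _ gid g', where \<theta> = ?\<theta>])
      (use \<theta> nat in auto)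
  show ?thesis
    by (rule arrow_isoI[OF canonical_arrow_hom[OF g'] canonical_arrow_hom[OF g] e(1) \<theta>(1) e(2) \<theta>(2)
          e(3)[symmetric]])
qed

text \<open>The diagram of \<open>f \<circ> s\<close> at \<open>I\<close> has the same factors as the diagram of \<open>f\<close> at \<open>s(I)\<close>, in another
  order, so the transport is along a permutation of tensor factors.\<close>

lemma canonical_arrow_permute:
  assumes K: "K \<in> scpx n" and s: "s permutes {1..n}"
    and f: "\<And>i. i \<in> {1..n} \<Longrightarrow> f i \<in> Mor C"
    and g: "canonical_arrow C n (image s ` K) f g" and g': "canonical_arrow C n K (f \<circ> s) g'"
  shows "(g', g) \<in> arrow_iso C" and "trivial_symmetry C \<Longrightarrow> (g', g) \<in> slice_iso"
proof -
  have inj: "inj s" using s by (rule permutes_inj)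
  have fs: "(f \<circ> s) i \<in> Mor C" if "i \<in> {1..n}" for i
    using f permutes_in_image[OF s] that by simp
  obtain P where P: "permutes_factors n s P" using permutes_factors_exists[OF s] by blast
  let ?\<theta> = "\<lambda>I. P (zobj f (s ` I))"
  have zs: "zobj (f \<circ> s) I = zobj f (s ` I) \<circ> s" for I
    using inj by (auto simp: zobj_def fun_eq_iff inj_image_mem_iff)
  have zas: "zarr (f \<circ> s) I J = zarr f (s ` I) (s ` J) \<circ> s" for I J
    using inj by (auto simp: zarr_def fun_eq_iff inj_image_mem_iff)
  have obj: "\<forall>i\<in>{1..n}. zobj f I i \<in> Obj C" for I using f by (simp add: zobj_obj)
  have \<theta>: "?\<theta> I \<in> hom (zO C n (f \<circ> s) I) (zO C n f (s ` I))" "is_iso C (?\<theta> I)"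
      "trivial_symmetry C \<Longrightarrow> ?\<theta> I = Ide C (zO C n f (s ` I))" for I
    using P obj unfolding permutes_factors_def zO_eq zs by blast+
  have nat: "?\<theta> J \<cdot> zA C n (f \<circ> s) (I, J) = zA C n f (s ` I, s ` J) \<cdot> ?\<theta> I" if IJ: "I \<subseteq> J" for I J
  proof -
    have "\<forall>i\<in>{1..n}. zarr f (s ` I) (s ` J) i \<in> hom (zobj f (s ` I) i) (zobj f (s ` J) i)"
      by (intro ballI zarr_hom f image_mono IJ)
    then show ?thesis
      using P unfolding permutes_factors_def zA_eq zas by blast
  qed
  obtain e where e: "e \<in> hom (Dom C g') (Dom C g)" "is_iso C e" "g \<cdot> e = ?\<theta> {1..n} \<cdot> g'"
    by (rule canonical_arrow_transport[OF K s f fs \<theta>(1,2) nat g g']) auto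
  have sN: "s ` {1..n} = {1..n}" using s by (rule permutes_image)
  note h = canonical_arrow_hom[OF g] and h' = canonical_arrow_hom[OF g']
  have \<theta>N: "?\<theta> {1..n} \<in> hom (zO C n (f \<circ> s) {1..n}) (zO C n f {1..n})"
    using \<theta>(1)[of "{1..n}"] by (simp only: sN)
  show "(g', g) \<in> arrow_iso C"
    by (rule arrow_isoI[OF h' h e(1) \<theta>N e(2) \<theta>(2) e(3)[symmetric]])
  assume "trivial_symmetry C"
  then have id: "?\<theta> {1..n} = Ide C (zO C n f {1..n})" using \<theta>(3)[of "{1..n}"] by (simp only: sN)
  then have zz: "zO C n (f \<circ> s) {1..n} = zO C n f {1..n}"
    using hom_dom[OF \<theta>N] hom_dom[OF ide_hom[OF hom_obj(2)[OF h]]] by simp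
  have "g \<cdot> e = g'" using e(3) ide_cmp[OF h'] by (simp only: id zz)
  then show "(g', g) \<in> slice_iso"
    by (rule slice_isoI[OF h'[unfolded zz] h e(1,2)])
qed

text \<open>The shape has the empty set as its only object, so the colimit is the source of \<open>f 1\<close>.\<close>

lemma canonical_arrow_unit:
  assumes f: "f 1 \<in> Mor C"
  shows "canonical_arrow C 1 {{}} f (f 1)"
proof -
  let ?y = "Dom C (f 1)"
  have y: "?y \<in> Obj C" and x: "Cod C (f 1) \<in> Obj C" using f dom_obj cod_obj by auto
  have zO: "zO C 1 f {} = ?y" "zO C 1 f {1..1} = Cod C (f 1)"
    using y x by (simp_all add: zO_def tenO_unit)
  have zA: "zA C 1 f ({}, {}) = Ide C ?y" "zA C 1 f ({}, {1..1}) = f 1"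
    using f hom_mor[OF ide_hom[OF y]] by (simp_all add: zA_def tenA_unit)
  have "is_cocone (cat {{}}) C (zO C 1 f) (zA C 1 f) ?y (\<lambda>_. Ide C ?y)"
    unfolding cat_cocone_iff using y ide_hom[OF y] cmp_ide[OF ide_hom[OF y]] zO zA by simp
  moreover have "\<exists>!e. e \<in> hom ?y d \<and> (\<forall>I\<in>{{}}. e \<cdot> Ide C ?y = \<tau> I)"
    if "is_cocone (cat {{}}) C (zO C 1 f) (zA C 1 f) d \<tau>" for d \<tau>
  proof -
    have "\<tau> {} \<in> hom ?y d" using that zO by (simp add: cat_cocone_iff)
    then show ?thesis using cmp_ide by auto
  qed
  ultimately have "is_colimit (cat {{}}) C (zO C 1 f) (zA C 1 f) ?y (\<lambda>_. Ide C ?y)"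
    by (simp add: is_colimit_def cat_simps)
  moreover have "f 1 \<in> hom ?y (zO C 1 f {1..1})" using f unfolding zO by (rule mor_hom)
  moreover have "f 1 \<cdot> Ide C ?y = zA C 1 f ({}, {1..1})"
    unfolding zA by (rule cmp_ide[OF mor_hom[OF f]])
  ultimately show ?thesis
    unfolding canonical_arrow_def by blast
qed

end


section \<open>The two algebra structures\<close>

lemma scpx_one: "K \<in> scpx 1 \<Longrightarrow> K \<noteq> {{}} \<Longrightarrow> {1} \<in> K"
  by (auto simp: scpx_def subset_singleton_iff Pow_def)

lemma scpx_comp_closed:
  assumes "k \<in> {1..n}" "1 \<le> m" "K \<in> scpx n" "L \<in> scpx m"
  shows "scpx_comp m k K L \<in> scpx (n + m - 1)"
proof -
  have "S \<subseteq> {1..n + m - 1}" if "S \<in> scpx_comp m k K L" for S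
    using that mem_scpx_comp[OF assms] by blast
  moreover have "{} \<in> scpx_comp m k K L"
    using scpx_empty[OF assms(3)] scpx_empty[OF assms(4)] by (auto simp: scpx_comp_def)
  moreover have "T \<in> scpx_comp m k K L" if "S \<in> scpx_comp m k K L" "T \<subseteq> S" for S T
    using that unfolding scpx_comp_def by blast
  ultimately show ?thesis unfolding scpx_def by blast
qed

lemma scpx_comp_unit_left:
  assumes "L \<in> scpx m"
  shows "scpx_comp m 1 {{}} L = L"
proof -
  have "set_comp m 1 {} J = J" for J by (simp add: set_comp_def)
  then have "scpx_comp m 1 {{}} L = {S. \<exists>J\<in>L. S \<subseteq> J}" by (simp add: scpx_comp_def)
  also have "\<dots> = L" using scpx_down[OF assms] by blast
  finally show ?thesis .
qed

lemma scpx_comp_unit_right: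
  assumes "K \<in> scpx n" "k \<in> {1..n}"
  shows "scpx_comp 1 k K {{}} = K"
proof -
  have "set_comp 1 k I {} = I" for I
  proof (rule set_eqI)
    fix i
    show "i \<in> set_comp 1 k I {} \<longleftrightarrow> i \<in> I"
      using assms(2) mem_set_comp[of k 1 "{}" i I] by (cases "i < k"; cases "i = k") auto
  qed
  then have "scpx_comp 1 k K {{}} = {S. \<exists>I\<in>K. S \<subseteq> I}" by (simp add: scpx_comp_def)
  also have "\<dots> = K" using scpx_down[OF assms(1)] by blast
  finally show ?thesis .
qed

lemma scpx_image:
  assumes "K \<in> scpx n" "s permutes {1..n}"
  shows "image s ` K \<in> scpx n"
proof -
  have "s ` I \<subseteq> {1..n}" if "I \<in> K" for I
    using image_mono[OF scpx_subset[OF assms(1) that], of s] permutes_image[OF assms(2)] by simp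
  then have "image s ` K \<subseteq> Pow {1..n}" by blast
  moreover have "J \<in> image s ` K" if "I \<in> K" "J \<subseteq> s ` I" for I J
  proof -
    obtain H where "H \<subseteq> I" "J = s ` H" using \<open>J \<subseteq> s ` I\<close> by (auto simp: subset_image_iff)
    then show ?thesis using scpx_down[OF assms(1) that(1)] by blast
  qed
  ultimately show ?thesis using assms(1) by (auto simp: scpx_def)
qed

text \<open>The arguments of the outer operation in a partial composite of operations on tuples.\<close>

definition insert_block :: "nat \<Rightarrow> nat \<Rightarrow> nat \<Rightarrow> (nat \<Rightarrow> 'x) \<Rightarrow> 'x \<Rightarrow> nat \<Rightarrow> 'x" where
  "insert_block n m k x y = (\<lambda>i\<in>{1..n}. if i < k then x i else if i = k then y else x (i + m - 1))"

definition block :: "nat \<Rightarrow> nat \<Rightarrow> (nat \<Rightarrow> 'x) \<Rightarrow> nat \<Rightarrow> 'x" where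
  "block m k x = (\<lambda>j\<in>{1..m}. x (j + k - 1))"

lemma End_pcomp:
  "pcomp (End_operad X) n m k \<phi> \<psi> =
    (\<lambda>x\<in>tuples X (n + m - 1). \<phi> (insert_block n m k x (\<psi> (block m k x))))"
  unfolding End_operad_def insert_block_def block_def by simp

lemma tuples_mem: "x \<in> tuples X n \<Longrightarrow> i \<in> {1..n} \<Longrightarrow> x i \<in> X"
  by (auto simp: tuples_def)

lemma block_tuples:
  assumes "x \<in> tuples X (n + m - 1)" "k \<in> {1..n}" "1 \<le> m"
  shows "block m k x \<in> tuples X m"
proof -
  have "x (j + k - 1) \<in> X" if "j \<in> {1..m}" for j
    by (rule tuples_mem[OF assms(1)]) (use that assms in auto)
  then show ?thesis by (auto simp: tuples_def block_def)
qed

lemma insert_block_tuples: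
  assumes "x \<in> tuples X (n + m - 1)" "k \<in> {1..n}" "1 \<le> m" "y \<in> X"
  shows "insert_block n m k x y \<in> tuples X n"
proof -
  have "x i \<in> X" if "i \<in> {1..n}" "i < k" for i
    by (rule tuples_mem[OF assms(1)]) (use that assms in auto)
  moreover have "x (i + m - 1) \<in> X" if "i \<in> {1..n}" for i
    by (rule tuples_mem[OF assms(1)]) (use that assms in auto)
  ultimately show ?thesis using assms(4) by (auto simp: tuples_def insert_block_def)
qed

lemma permute_tuples:
  assumes "x \<in> tuples X n" "s permutes {1..n}"
  shows "x \<circ> s \<in> tuples X n"
proof -
  have "s i \<in> {1..n} \<longleftrightarrow> i \<in> {1..n}" for i by (rule permutes_in_image[OF assms(2)])
  moreover have "s i = i" if "i \<notin> {1..n}" for i by (rule permutes_not_in[OF assms(2) that])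
  ultimately show ?thesis using assms(1) by (auto simp: tuples_def PiE_iff extensional_def)
qed

lemma tuples_one_eq:
  assumes "x \<in> tuples X n"
  shows "insert_block n 1 k x (x k) = x" and "block n 1 x = x"
  using assms by (auto simp: tuples_def insert_block_def block_def PiE_iff extensional_def fun_eq_iff)

lemma ns_operad_algebraI:
  assumes closed: "\<And>n K x. 1 \<le> n \<Longrightarrow> K \<in> scpx n \<Longrightarrow> x \<in> tuples X n \<Longrightarrow> Z n K x \<in> X"
    and unit: "\<And>x. x \<in> tuples X 1 \<Longrightarrow> Z 1 {{}} x = x 1"
    and comp: "\<And>n m k K L x. 1 \<le> n \<Longrightarrow> 1 \<le> m \<Longrightarrow> k \<in> {1..n} \<Longrightarrow> K \<in> scpx n \<Longrightarrow> L \<in> scpx m \<Longrightarrow>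
      x \<in> tuples X (n + m - 1) \<Longrightarrow>
      Z (n + m - 1) (scpx_comp m k K L) x = Z n K (insert_block n m k x (Z m L (block m k x)))"
  shows "ns_operad_algebra scpx_operad X (\<lambda>n K. \<lambda>x\<in>tuples X n. Z n K x)"
  unfolding ns_operad_algebra_def ns_operad_morphism_def
proof (intro conjI allI impI ballI)
  fix n K assume "1 \<le> (n::nat)" "K \<in> ops scpx_operad n"
  then show "(\<lambda>x\<in>tuples X n. Z n K x) \<in> ops (End_operad X) n"
    using closed by (auto simp: End_operad_def scpx_operad_def)
next
  show "(\<lambda>x\<in>tuples X 1. Z 1 (opunit scpx_operad) x) = opunit (End_operad X)"
    using unit by (auto simp: End_operad_def scpx_operad_def intro!: restrict_ext)
next
  fix n m k K L assume n: "1 \<le> (n::nat)" "1 \<le> (m::nat)" "k \<in> {1..n}"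
    and K: "K \<in> ops scpx_operad n" and L: "L \<in> ops scpx_operad m"
  then have K': "K \<in> scpx n" and L': "L \<in> scpx m" by (simp_all add: scpx_operad_def)
  show "(\<lambda>x\<in>tuples X (n + m - 1). Z (n + m - 1) (pcomp scpx_operad n m k K L) x) =
      pcomp (End_operad X) n m k (\<lambda>x\<in>tuples X n. Z n K x) (\<lambda>x\<in>tuples X m. Z m L x)"
    unfolding End_pcomp
  proof (rule restrict_ext)
    fix x assume x: "x \<in> tuples X (n + m - 1)"
    have b: "block m k x \<in> tuples X m" by (rule block_tuples[OF x n(3,2)])
    have "insert_block n m k x (Z m L (block m k x)) \<in> tuples X n"
      by (rule insert_block_tuples[OF x n(3,2) closed[OF n(2) L' b]])
    then show "Z (n + m - 1) (pcomp scpx_operad n m k K L) x =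
        (\<lambda>x\<in>tuples X n. Z n K x) (insert_block n m k x ((\<lambda>x\<in>tuples X m. Z m L x) (block m k x)))"
      using comp[OF n K' L' x] b by (simp add: scpx_operad_def)
  qed
qed

lemma operad_algebraI:
  assumes "ns_operad_algebra scpx_operad X (\<lambda>n K. \<lambda>x\<in>tuples X n. Z n K x)"
    and "\<And>n s K x. 1 \<le> n \<Longrightarrow> s permutes {1..n} \<Longrightarrow> K \<in> scpx n \<Longrightarrow> x \<in> tuples X n \<Longrightarrow>
      Z n (image s ` K) x = Z n K (x \<circ> s)"
  shows "operad_algebra scpx_operad X (\<lambda>n K. \<lambda>x\<in>tuples X n. Z n K x)"
  unfolding operad_algebra_def operad_morphism_def
proof (intro conjI allI impI ballI)
  show "ns_operad_morphism scpx_operad (End_operad X) (\<lambda>n K. \<lambda>x\<in>tuples X n. Z n K x)"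
    using assms(1) by (simp add: ns_operad_algebra_def)
  fix n s K assume "1 \<le> (n::nat)" "s permutes {1..n}" "K \<in> ops scpx_operad n"
  then have "Z n (act scpx_operad n s K) x = (\<lambda>x\<in>tuples X n. Z n K x) (x \<circ> s)"
    if "x \<in> tuples X n" for x
    using that assms(2) permute_tuples[OF that] by (simp add: scpx_operad_def)
  then show "(\<lambda>x\<in>tuples X n. Z n (act scpx_operad n s K) x) =
      act (End_operad X) n s (\<lambda>x\<in>tuples X n. Z n K x)"
    unfolding End_operad_def by (simp cong: restrict_cong)
qed

context strict_symmetric_monoidal_category
begin

lemma canonical_arrow_exists_tuple:
  assumes "cocomplete TYPE('i::infinite) C" "K \<in> scpx n" "f \<in> tuples (Mor C) n"
  shows "\<exists>g. canonical_arrow C n K f g"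
  by (rule canonical_arrow_exists[OF assms(1,2)]) (rule tuples_mem[OF assms(3)])

lemma canonical_arrow_composite:
  assumes cc: "cocontinuous TYPE('i::infinite) C"
    and nm: "1 \<le> m" "k \<in> {1..n}" and K: "K \<in> scpx n" and L: "L \<in> scpx m"
    and x: "x \<in> tuples (Mor C) (n + m - 1)"
    and g: "canonical_arrow C m L (block m k x) g"
    and h: "canonical_arrow C n K (insert_block n m k x g) h"
  shows "canonical_arrow C (n + m - 1) (scpx_comp m k K L) x h"
proof -
  interpret block_substitution C n m k x "block m k x" "insert_block n m k x g"
    by unfold_locales
      (use nm tuples_mem[OF x] in \<open>auto simp: block_def insert_block_def\<close>)
  have "insert_block n m k x g k = g" using nm by (simp add: insert_block_def)
  then show ?thesis
    using canonical_arrow_substitution[OF cc K L _ h] g by simp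
qed

definition representative :: "'a \<Rightarrow> 'a" where
  "representative g = (SOME h. h \<in> slice_iso `` {g})"

lemma representative_slice_iso: "g \<in> Mor C \<Longrightarrow> (g, representative g) \<in> slice_iso"
  unfolding representative_def Image_singleton_iff[symmetric]
  by (rule someI[of _ g]) (rule equiv_class_self[OF equiv_slice_iso])

lemma representative_cong: "(g, h) \<in> slice_iso \<Longrightarrow> representative g = representative h"
  by (simp add: representative_def equiv_class_eq[OF equiv_slice_iso])

text \<open>A choice of colimits for which the algebra equations hold on the nose. Composition, and
  relabelling if the symmetry is trivial, change a canonical arrow only within its isomorphism class
  over its target, so picking one representative in each such class turns these isomorphisms into equalities.
  This would replace \<open>f\<close> by its representative for the unit of the operad, where \<open>f\<close> itself is
  required; setting this one value by hand is consistent because the unit is a composite of units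
  only.\<close>

definition strict_Z :: "nat \<Rightarrow> nat set set \<Rightarrow> (nat \<Rightarrow> 'a) \<Rightarrow> 'a" where
  "strict_Z n K f = (if n = 1 \<and> K = {{}} then f 1 else representative (SOME g. canonical_arrow C n K f g))"

lemma strict_Z_canonical:
  assumes "cocomplete TYPE('i::infinite) C" "K \<in> scpx n" "f \<in> tuples (Mor C) n"
  shows "canonical_arrow C n K f (strict_Z n K f)"
proof (cases "n = 1 \<and> K = {{}}")
  case True
  then have nK: "n = 1" "K = {{}}" by simp_all
  have "canonical_arrow C 1 {{}} f (f 1)"
    using tuples_mem[OF assms(3), of 1] nK by (intro canonical_arrow_unit) simp
  then show ?thesis unfolding nK strict_Z_def by simp
next
  case False
  note f = tuples_mem[OF assms(3)]
  let ?g = "SOME g. canonical_arrow C n K f g"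
  have g: "canonical_arrow C n K f ?g"
    using canonical_arrow_exists_tuple[OF assms] by (rule someI_ex)
  have "canonical_arrow C n K f (representative ?g)"
    by (rule canonical_arrow_slice_closed[OF g _ representative_slice_iso[OF canonical_arrow_mor[OF g]]]) (rule f)
  moreover have "strict_Z n K f = representative ?g"
    using False unfolding strict_Z_def by (rule if_not_P)
  ultimately show ?thesis by simp
qed

lemma strict_Z_eq:
  assumes "K \<in> scpx n" "f \<in> tuples (Mor C) n" "canonical_arrow C n K f g" "\<not> (n = 1 \<and> K = {{}})"
  shows "strict_Z n K f = representative g"
proof -
  note f = tuples_mem[OF assms(2)]
  have "canonical_arrow C n K f (SOME g. canonical_arrow C n K f g)"
    using assms(3) by (rule someI)
  then have "((SOME g. canonical_arrow C n K f g), g) \<in> slice_iso"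
    by (intro canonical_arrow_slice_unique[OF assms(1) _ assms(3)] f)
  then show ?thesis
    using assms(4) representative_cong by (auto simp: strict_Z_def)
qed

text \<open>If neither operand is the unit, neither is the composite, and both sides are the chosen
  representative of one class: the right-hand side is a canonical arrow of the composite.\<close>

lemma strict_Z_composite:
  assumes cocomp: "cocomplete TYPE('i::infinite) C" and cc: "cocontinuous TYPE('i) C"
    and nm: "1 \<le> n" "1 \<le> m" "k \<in> {1..n}" and K: "K \<in> scpx n" and L: "L \<in> scpx m"
    and x: "x \<in> tuples (Mor C) (n + m - 1)"
  shows "strict_Z (n + m - 1) (scpx_comp m k K L) x =
    strict_Z n K (insert_block n m k x (strict_Z m L (block m k x)))"
proof -
  let ?g = "strict_Z m L (block m k x)"
  let ?x' = "insert_block n m k x ?g"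
  have b: "block m k x \<in> tuples (Mor C) m" by (rule block_tuples[OF x nm(3,2)])
  have g: "canonical_arrow C m L (block m k x) ?g" by (rule strict_Z_canonical[OF cocomp L b])
  have x': "?x' \<in> tuples (Mor C) n"
    by (rule insert_block_tuples[OF x nm(3,2) canonical_arrow_mor[OF g]])
  have h: "canonical_arrow C n K ?x' (strict_Z n K ?x')" by (rule strict_Z_canonical[OF cocomp K x'])
  consider "n = 1 \<and> K = {{}}" | "m = 1 \<and> L = {{}}" | "\<not> (n = 1 \<and> K = {{}})" "\<not> (m = 1 \<and> L = {{}})"
    by blast
  then show ?thesis
  proof cases
    case 1
    then have k: "k = 1" and N: "n + m - 1 = m" using nm by auto
    have "block m 1 x = x" using tuples_one_eq(2)[OF x[unfolded N]] .
    moreover have "strict_Z 1 {{}} (insert_block 1 m 1 x y) = y" for y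
      by (simp add: strict_Z_def insert_block_def)
    moreover have "scpx_comp m 1 {{}} L = L" by (rule scpx_comp_unit_left[OF L])
    ultimately show ?thesis using 1 k by simp
  next
    case 2
    have xn: "x \<in> tuples (Mor C) n" using x 2 by simp
    have "strict_Z 1 {{}} (block 1 k x) = x k" by (simp add: strict_Z_def block_def)
    moreover have "scpx_comp 1 k K {{}} = K" by (rule scpx_comp_unit_right[OF K nm(3)])
    ultimately show ?thesis using 2 tuples_one_eq(1)[OF xn, of k] by simp
  next
    case 3
    \<comment> \<open>In arity one, the complex other than the unit contains the face \<open>{1}\<close>, and then so does
      the composite.\<close>
    have "\<not> (n + m - 1 = 1 \<and> scpx_comp m k K L = {{}})"
    proof
      assume u: "n + m - 1 = 1 \<and> scpx_comp m k K L = {{}}"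
      then have n: "n = 1" "m = 1" using nm(1,2) by linarith+
      then have k: "k = 1" using nm(3) by simp
      then have "{1} \<in> K" using scpx_one[of K] K 3(1) n by simp
      moreover have "set_comp 1 1 {1} {} = {1::nat}" by (auto simp: set_comp_def)
      ultimately have "{1} \<subseteq> set_comp m k {1} {} \<and> {1} \<in> K" by (simp add: n k)
      then have "{1} \<in> scpx_comp m k K L"
        using scpx_empty[OF L] unfolding scpx_comp_def by blast
      then show False using u by auto
    qed
    then have "strict_Z (n + m - 1) (scpx_comp m k K L) x = representative (strict_Z n K ?x')"
      by (rule strict_Z_eq[OF scpx_comp_closed[OF nm(3,2) K L] x
            canonical_arrow_composite[OF cc nm(2,3) K L x g h]])
    also have "\<dots> = strict_Z n K ?x'"
      by (rule strict_Z_eq[OF K x' h 3(1), symmetric])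
    finally show ?thesis .
  qed
qed

lemma strict_Z_permute:
  assumes cocomp: "cocomplete TYPE('i::infinite) C" and triv: "trivial_symmetry C"
    and s: "s permutes {1..n}" and K: "K \<in> scpx n" and x: "x \<in> tuples (Mor C) n"
  shows "strict_Z n (image s ` K) x = strict_Z n K (x \<circ> s)"
proof (cases "n = 1 \<and> K = {{}}")
  case True
  then have "s 1 = 1" using permutes_in_image[OF s, of 1] by simp
  then show ?thesis using True by (simp add: strict_Z_def)
next
  case False
  have False': "\<not> (n = 1 \<and> image s ` K = {{}})"
  proof
    assume u: "n = 1 \<and> image s ` K = {{}}"
    then have "I = {}" if "I \<in> K" for I using that by (metis image_eqI image_is_empty singletonD)
    then show False using False u scpx_empty[OF K] by blast
  qed
  note xs = permute_tuples[OF x s] and sK = scpx_image[OF K s]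
  note g = strict_Z_canonical[OF cocomp sK x] and g' = strict_Z_canonical[OF cocomp K xs]
  have "representative (strict_Z n K (x \<circ> s)) = representative (strict_Z n (image s ` K) x)"
    by (rule representative_cong[OF canonical_arrow_permute(2)[OF K s tuples_mem[OF x] g g' triv]])
  then show ?thesis
    using strict_Z_eq[OF sK x g False'] strict_Z_eq[OF K xs g' False] by simp
qed

lemma strict_algebra:
  assumes cocomp: "cocomplete TYPE('i::infinite) C" and cc: "cocontinuous TYPE('i) C"
  shows "\<exists>Z. (\<forall>n\<ge>1. \<forall>K\<in>scpx n. \<forall>f\<in>tuples (Mor C) n. canonical_arrow C n K f (Z n K f)) \<and>
    ns_operad_algebra scpx_operad (Mor C) Z \<and>
    (trivial_symmetry C \<longrightarrow> operad_algebra scpx_operad (Mor C) Z)"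
proof -
  let ?Z = "\<lambda>n K. \<lambda>x\<in>tuples (Mor C) n. strict_Z n K x"
  have ns: "ns_operad_algebra scpx_operad (Mor C) ?Z"
  proof (rule ns_operad_algebraI)
    show "strict_Z n K x \<in> Mor C" if "K \<in> scpx n" "x \<in> tuples (Mor C) n" for n K x
      by (rule canonical_arrow_mor[OF strict_Z_canonical[OF cocomp that]])
    show "strict_Z 1 {{}} x = x 1" for x by (simp add: strict_Z_def)
  qed (rule strict_Z_composite[OF cocomp cc])
  have "operad_algebra scpx_operad (Mor C) ?Z" if "trivial_symmetry C"
    by (rule operad_algebraI[OF ns]) (rule strict_Z_permute[OF cocomp that])
  moreover have "canonical_arrow C n K f (?Z n K f)" if "K \<in> scpx n" "f \<in> tuples (Mor C) n" for n K f
    using strict_Z_canonical[OF cocomp that] that by simp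
  ultimately show ?thesis using ns by (intro exI[of _ ?Z]) simp
qed

definition arrow_class :: "'a \<Rightarrow> 'a set" where
  "arrow_class f = arrow_iso C `` {f}"

definition class_tuple :: "nat \<Rightarrow> (nat \<Rightarrow> 'a) \<Rightarrow> nat \<Rightarrow> 'a set" where
  "class_tuple n f = (\<lambda>i\<in>{1..n}. arrow_class (f i))"

text \<open>Representatives of the arguments and a canonical arrow are chosen together, so that one lemma,
  \<open>class_Z_eq\<close>, shows independence of all choices.\<close>

definition class_Z :: "nat \<Rightarrow> nat set set \<Rightarrow> (nat \<Rightarrow> 'a set) \<Rightarrow> 'a set" where
  "class_Z n K F = (SOME G. \<exists>f g. f \<in> tuples (Mor C) n \<and> F = class_tuple n f \<and>
     canonical_arrow C n K f g \<and> G = arrow_class g)"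

lemma arrow_class_eq_iff:
  "f \<in> Mor C \<Longrightarrow> g \<in> Mor C \<Longrightarrow> arrow_class f = arrow_class g \<longleftrightarrow> (f, g) \<in> arrow_iso C"
  unfolding arrow_class_def by (rule eq_equiv_class_iff[OF equiv_arrow_iso])

lemma class_tuple_surj:
  assumes "F \<in> tuples (Mor C // arrow_iso C) n"
  obtains f where "f \<in> tuples (Mor C) n" "F = class_tuple n f"
proof -
  have "\<forall>i\<in>{1..n}. \<exists>h. h \<in> Mor C \<and> F i = arrow_class h"
    using tuples_mem[OF assms] by (fastforce simp: quotient_def arrow_class_def)
  then obtain f where f: "\<And>i. i \<in> {1..n} \<Longrightarrow> f i \<in> Mor C \<and> F i = arrow_class (f i)"
    by metis
  have "restrict f {1..n} \<in> tuples (Mor C) n" using f by (auto simp: tuples_def)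
  moreover have "F = class_tuple n (restrict f {1..n})"
    using f assms by (auto simp: class_tuple_def tuples_def PiE_iff extensional_def fun_eq_iff)
  ultimately show thesis using that by blast
qed

text \<open>Well-defined because isomorphic tuples of arrows have isomorphic canonical arrows.\<close>

lemma class_Z_eq:
  assumes K: "K \<in> scpx n" and f: "f \<in> tuples (Mor C) n" and g: "canonical_arrow C n K f g"
  shows "class_Z n K (class_tuple n f) = arrow_class g"
  unfolding class_Z_def
proof (rule someI2_ex)
  show "\<exists>G f' g. f' \<in> tuples (Mor C) n \<and> class_tuple n f = class_tuple n f' \<and>
      canonical_arrow C n K f' g \<and> G = arrow_class g"
    using f g by blast
  fix G assume "\<exists>f' g. f' \<in> tuples (Mor C) n \<and> class_tuple n f = class_tuple n f' \<and>
      canonical_arrow C n K f' g \<and> G = arrow_class g"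
  then obtain f' g' where f': "f' \<in> tuples (Mor C) n" "class_tuple n f = class_tuple n f'"
    and g': "canonical_arrow C n K f' g'" "G = arrow_class g'" by blast
  have "(f' i, f i) \<in> arrow_iso C" if i: "i \<in> {1..n}" for i
  proof -
    have "arrow_class (f' i) = arrow_class (f i)"
      using fun_cong[OF f'(2), of i] i by (simp add: class_tuple_def)
    then show ?thesis
      using arrow_class_eq_iff tuples_mem[OF f i] tuples_mem[OF f'(1) i] by simp
  qed
  then have "(g', g) \<in> arrow_iso C"
    by (rule canonical_arrow_arrow_iso[OF K _ g g'(1)])
  then show "G = arrow_class g"
    using arrow_class_eq_iff canonical_arrow_mor[OF g] canonical_arrow_mor[OF g'(1)] g'(2) by simp
qed

lemma class_algebra:
  assumes cocomp: "cocomplete TYPE('i::infinite) C" and cc: "cocontinuous TYPE('i) C"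
  shows "\<exists>Z. operad_algebra scpx_operad (Mor C // arrow_iso C) Z \<and>
    (\<forall>n\<ge>1. \<forall>K\<in>scpx n. \<forall>f\<in>tuples (Mor C) n. \<forall>g. canonical_arrow C n K f g \<longrightarrow>
       Z n K (\<lambda>i\<in>{1..n}. arrow_iso C `` {f i}) = arrow_iso C `` {g})"
proof -
  let ?X = "Mor C // arrow_iso C"
  let ?Z = "\<lambda>n K. \<lambda>F\<in>tuples ?X n. class_Z n K F"
  have class_mem: "arrow_class g \<in> ?X" if "g \<in> Mor C" for g
    unfolding arrow_class_def using that by (rule quotientI)
  have class_tuple: "class_tuple n f \<in> tuples ?X n" if "f \<in> tuples (Mor C) n" for n f
    using that class_mem by (auto simp: tuples_def class_tuple_def)
  have "ns_operad_algebra scpx_operad ?X ?Z"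
  proof (rule ns_operad_algebraI)
    fix n K F assume K: "K \<in> scpx n" and F: "F \<in> tuples ?X n"
    obtain f where f: "f \<in> tuples (Mor C) n" "F = class_tuple n f"
      using class_tuple_surj[OF F] .
    obtain g where g: "canonical_arrow C n K f g"
      using canonical_arrow_exists_tuple[OF cocomp K f(1)] by blast
    show "class_Z n K F \<in> ?X"
      unfolding f(2) class_Z_eq[OF K f(1) g] by (rule class_mem[OF canonical_arrow_mor[OF g]])
  next
    fix F assume F: "F \<in> tuples ?X 1"
    obtain f where f: "f \<in> tuples (Mor C) 1" "F = class_tuple 1 f"
      using class_tuple_surj[OF F] .
    have unit: "{{}} \<in> scpx 1" by (simp add: scpx_def)
    have "f 1 \<in> Mor C" using tuples_mem[OF f(1)] by simp
    then show "class_Z 1 {{}} F = F 1"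
      unfolding f(2) by (subst class_Z_eq[OF unit f(1) canonical_arrow_unit])
        (simp_all add: class_tuple_def)
  next
    fix n m k K L F assume nm: "1 \<le> (n::nat)" "1 \<le> (m::nat)" "k \<in> {1..n}" and K: "K \<in> scpx n"
      and L: "L \<in> scpx m" and F: "F \<in> tuples ?X (n + m - 1)"
    obtain f where f: "f \<in> tuples (Mor C) (n + m - 1)" "F = class_tuple (n + m - 1) f"
      using class_tuple_surj[OF F] .
    have b: "block m k f \<in> tuples (Mor C) m" by (rule block_tuples[OF f(1) nm(3,2)])
    obtain g where g: "canonical_arrow C m L (block m k f) g"
      using canonical_arrow_exists_tuple[OF cocomp L b] by blast
    have f': "insert_block n m k f g \<in> tuples (Mor C) n"
      by (rule insert_block_tuples[OF f(1) nm(3,2) canonical_arrow_mor[OF g]])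
    obtain h where h: "canonical_arrow C n K (insert_block n m k f g) h"
      using canonical_arrow_exists_tuple[OF cocomp K f'] by blast
    have "block m k F = class_tuple m (block m k f)"
      using nm by (auto simp: f(2) block_def class_tuple_def fun_eq_iff)
    then have Zb: "class_Z m L (block m k F) = arrow_class g"
      using class_Z_eq[OF L b g] by simp
    have "insert_block n m k F (arrow_class g) = class_tuple n (insert_block n m k f g)"
      using nm by (auto simp: f(2) insert_block_def class_tuple_def fun_eq_iff)
    then have "class_Z n K (insert_block n m k F (class_Z m L (block m k F))) = arrow_class h"
      using class_Z_eq[OF K f' h] by (simp add: Zb)
    moreover have "class_Z (n + m - 1) (scpx_comp m k K L) F = arrow_class h"
      unfolding f(2)
      by (rule class_Z_eq[OF scpx_comp_closed[OF nm(3,2) K L] f(1)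
            canonical_arrow_composite[OF cc nm(2,3) K L f(1) g h]])
    ultimately show "class_Z (n + m - 1) (scpx_comp m k K L) F =
        class_Z n K (insert_block n m k F (class_Z m L (block m k F)))" by simp
  qed
  then have "operad_algebra scpx_operad ?X ?Z"
  proof (rule operad_algebraI)
    fix n s K F assume s: "s permutes {1..(n::nat)}" and K: "K \<in> scpx n" and F: "F \<in> tuples ?X n"
    obtain f where f: "f \<in> tuples (Mor C) n" "F = class_tuple n f"
      using class_tuple_surj[OF F] .
    note fs = permute_tuples[OF f(1) s] and sK = scpx_image[OF K s]
    obtain g where g: "canonical_arrow C n (image s ` K) f g"
      using canonical_arrow_exists_tuple[OF cocomp sK f(1)] by blast
    obtain g' where g': "canonical_arrow C n K (f \<circ> s) g'"
      using canonical_arrow_exists_tuple[OF cocomp K fs] by blast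
    have "F \<circ> s = class_tuple n (f \<circ> s)"
      using permutes_in_image[OF s] by (auto simp: f(2) class_tuple_def fun_eq_iff)
    then have "class_Z n K (F \<circ> s) = arrow_class g'"
      using class_Z_eq[OF K fs g'] by simp
    moreover have "class_Z n (image s ` K) F = arrow_class g"
      unfolding f(2) by (rule class_Z_eq[OF sK f(1) g])
    moreover have "arrow_class g' = arrow_class g"
      using canonical_arrow_permute(1)[OF K s tuples_mem[OF f(1)] g g']
        arrow_class_eq_iff canonical_arrow_mor[OF g] canonical_arrow_mor[OF g'] by simp
    ultimately show "class_Z n (image s ` K) F = class_Z n K (F \<circ> s)" by simp
  qed
  moreover have "?Z n K (\<lambda>i\<in>{1..n}. arrow_iso C `` {f i}) = arrow_iso C `` {g}"
    if "K \<in> scpx n" "f \<in> tuples (Mor C) n" "canonical_arrow C n K f g" for n K f g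
    using class_Z_eq[OF that] class_tuple[OF that(2)]
    unfolding class_tuple_def arrow_class_def by simp
  ultimately show ?thesis by blast
qed

end

theorem theorem3p25:
  fixes C :: "('o, 'a) smc_struct"
  assumes "strict_symmetric_monoidal_category C"
    and "cocomplete TYPE('i::infinite) C"
    and "cocontinuous TYPE('i) C"
  shows
    "(\<exists>Z. (\<forall>n\<ge>1. \<forall>K\<in>scpx n. \<forall>f\<in>tuples (Mor C) n. canonical_arrow C n K f (Z n K f)) \<and>
          ns_operad_algebra scpx_operad (Mor C) Z \<and>
          (trivial_symmetry C \<longrightarrow> operad_algebra scpx_operad (Mor C) Z)) \<and>
     (\<exists>Z. operad_algebra scpx_operad (Mor C // arrow_iso C) Z \<and>
          (\<forall>n\<ge>1. \<forall>K\<in>scpx n. \<forall>f\<in>tuples (Mor C) n. \<forall>g. canonical_arrow C n K f g \<longrightarrow>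
             Z n K (\<lambda>i\<in>{1..n}. arrow_iso C `` {f i}) = arrow_iso C `` {g}))"
proof -
  interpret strict_symmetric_monoidal_category C by fact
  show ?thesis
    using strict_algebra[OF assms(2,3)] class_algebra[OF assms(2,3)] by (rule conjI)
qed

end
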